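(* The free product of two $\mathbf{ET0L}$-tabled groups is $\mathbf{ET0L}$-tabled.
   Context: For a word $w=a_1\cdots a_n$ write $w^{\mathrm{rev}}=a_n\cdots a_1$. Let $G$ be a group generated as a monoid by a finite set $A$, with surjective monoid homomorphism $\pi_G\colon A^\ast\to G$. A regular language $R\subseteq A^\ast$ is a language of normal forms for $G$ if every element of $G$ is represented (via $\pi_G$) by exactly one word of $R$. With $\#_1,\#_2$ new symbols not in $A$, let $\mathcal{T}_G(R)=\{u\#_1v\#_2w^{\mathrm{rev}}\mid u,v,w\in R,\ \pi_G(u)\pi_G(v)=\pi_G(w)\}$. For a class $\mathbf{C}$ of languages, $G$ is $\mathbf{C}$-tabled if (for some finite generating set $A$) there is a regular language $R\subseteq A^\ast$ of normal forms for $G$ with $\mathcal{T}_G(R)\in\mathbf{C}$. $\mathbf{ET0L}$ is the class of ET0L languages: an ET0L system consists of a finite alphabet $V$, a terminal alphabet $\Delta\subseteq V$, a start word $\omega\in V^+$, and a finite nonempty set of tables, each table being a finite subset $T\subset V\times V^\ast$ containing, for every $c\in V$, at least one pair $(c,x)$. A derivation step chooses one table $T$ and simultaneously replaces every letter $c$ of the current word by some $x$ with $(c,x)\in T$ (different occurrences of $c$ may use different $x$). The language generated is the set of words in $\Delta^\ast$ derivable from $\omega$ in finitely many steps. *)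

theory Defs
  imports "HOL-Algebra.Group"
begin

section \<open>Regular languages\<close>

text \<open>
  A language over the finite alphabet \<open>A\<close> is regular if it is recognised by a deterministic finite
  automaton. The states are natural numbers, which is no restriction as they are finitely many.
\<close>

definition regular_language :: "'a set \<Rightarrow> 'a list set \<Rightarrow> bool" where
  "regular_language A L \<longleftrightarrow> finite A \<and>
     (\<exists>(Q :: nat set) q0 \<delta> F.
        finite Q \<and> q0 \<in> Q \<and> F \<subseteq> Q \<and> (\<forall>q\<in>Q. \<forall>a\<in>A. \<delta> q a \<in> Q) \<and>
        L = {w \<in> lists A. foldl \<delta> q0 w \<in> F})"

section \<open>ET0L languages\<close>

record 'v et0l_system =
  symbols :: "'v set"
  terminals :: "'v set"
  start_word :: "'v list"
  tables :: "('v \<times> 'v list) set set"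

definition is_et0l_system :: "'v et0l_system \<Rightarrow> bool" where
  "is_et0l_system E \<longleftrightarrow>
     finite (symbols E) \<and> terminals E \<subseteq> symbols E \<and>
     start_word E \<in> lists (symbols E) \<and> start_word E \<noteq> [] \<and>
     finite (tables E) \<and> tables E \<noteq> {} \<and>
     (\<forall>T\<in>tables E. finite T \<and> T \<subseteq> symbols E \<times> lists (symbols E) \<and>
        (\<forall>c\<in>symbols E. \<exists>x. (c, x) \<in> T))"

definition table_step :: "('v \<times> 'v list) set \<Rightarrow> 'v list \<Rightarrow> 'v list \<Rightarrow> bool" where
  "table_step T u v \<longleftrightarrow> (\<exists>xs. list_all2 (\<lambda>c x. (c, x) \<in> T) u xs \<and> v = concat xs)"

definition et0l_step :: "'v et0l_system \<Rightarrow> 'v list \<Rightarrow> 'v list \<Rightarrow> bool" where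
  "et0l_step E u v \<longleftrightarrow> (\<exists>T\<in>tables E. table_step T u v)"

definition et0l_generated :: "'v et0l_system \<Rightarrow> 'v list set" where
  "et0l_generated E = {w \<in> lists (terminals E). (et0l_step E)\<^sup>*\<^sup>* (start_word E) w}"

text \<open>
  The class of ET0L languages over symbols of type \<open>'s\<close>. The systems work on \<open>'s + nat\<close>: the terminals
  lie in the left summand, and the right summand ensures that arbitrarily many nonterminals are
  available, even if \<open>'s\<close> is finite.
\<close>

definition ET0L :: "'s list set set" where
  "ET0L = {L. \<exists>E :: ('s + nat) et0l_system.
     is_et0l_system E \<and> terminals E \<subseteq> range Inl \<and> et0l_generated E = map Inl ` L}"

section \<open>Tabled groups\<close>

definition word_monoid :: "'a set \<Rightarrow> 'a list monoid" where
  "word_monoid A = \<lparr>carrier = lists A, mult = (@), one = []\<rparr>"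

definition normal_forms ::
  "('g, 'm) monoid_scheme \<Rightarrow> 'a set \<Rightarrow> ('a list \<Rightarrow> 'g) \<Rightarrow> 'a list set \<Rightarrow> bool" where
  "normal_forms G A \<pi> R \<longleftrightarrow>
     regular_language A R \<and> (\<forall>g\<in>carrier G. \<exists>!w. w \<in> R \<and> \<pi> w = g)"

datatype 'a table_symbol = Letter 'a | Hash1 | Hash2

definition mult_table ::
  "('g, 'm) monoid_scheme \<Rightarrow> ('a list \<Rightarrow> 'g) \<Rightarrow> 'a list set \<Rightarrow> 'a table_symbol list set" where
  "mult_table G \<pi> R =
     {map Letter u @ [Hash1] @ map Letter v @ [Hash2] @ map Letter (rev w) | u v w.
        u \<in> R \<and> v \<in> R \<and> w \<in> R \<and> \<pi> u \<otimes>\<^bsub>G\<^esub> \<pi> v = \<pi> w}"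

text \<open>
  The letters are taken to be natural numbers, so that every finite alphabet is available up to
  renaming. The map \<open>\<pi>\<close> need not be injective on letters.
\<close>

definition tabled :: "nat table_symbol list set set \<Rightarrow> ('g, 'm) monoid_scheme \<Rightarrow> bool" where
  "tabled \<C> G \<longleftrightarrow>
     (\<exists>(A :: nat set) \<pi> R. finite A \<and> \<pi> \<in> epi (word_monoid A) G \<and> \<pi> [] = \<one>\<^bsub>G\<^esub> \<and>
        normal_forms G A \<pi> R \<and> mult_table G \<pi> R \<in> \<C>)"

section \<open>Free products of groups\<close>

text \<open>
  The elements of the free product are the reduced words: sequences of nontrivial elements, taken
  alternately from the two factors.
\<close>

definition reduced_words ::
  "('a, 'm) monoid_scheme \<Rightarrow> ('b, 'n) monoid_scheme \<Rightarrow> ('a + 'b) list set" where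
  "reduced_words G H =
     {w \<in> lists ((carrier G <+> carrier H) - {Inl \<one>\<^bsub>G\<^esub>, Inr \<one>\<^bsub>H\<^esub>}).
        successively (\<lambda>x y. isl x \<noteq> isl y) w}"

text \<open>Multiplication of a reduced word from the left by an element of one of the factors.\<close>

fun syllable_mult ::
  "('a, 'm) monoid_scheme \<Rightarrow> ('b, 'n) monoid_scheme \<Rightarrow> 'a + 'b \<Rightarrow> ('a + 'b) list \<Rightarrow> ('a + 'b) list"
where
  "syllable_mult G H (Inl g) (Inl g' # w) =
     (if g \<otimes>\<^bsub>G\<^esub> g' = \<one>\<^bsub>G\<^esub> then w else Inl (g \<otimes>\<^bsub>G\<^esub> g') # w)"
| "syllable_mult G H (Inr h) (Inr h' # w) =
     (if h \<otimes>\<^bsub>H\<^esub> h' = \<one>\<^bsub>H\<^esub> then w else Inr (h \<otimes>\<^bsub>H\<^esub> h') # w)"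
| "syllable_mult G H x w = (if x \<in> {Inl \<one>\<^bsub>G\<^esub>, Inr \<one>\<^bsub>H\<^esub>} then w else x # w)"

definition free_product ::
  "('a, 'm) monoid_scheme \<Rightarrow> ('b, 'n) monoid_scheme \<Rightarrow> ('a + 'b) list monoid" where
  "free_product G H =
     \<lparr>carrier = reduced_words G H, mult = foldr (syllable_mult G H), one = []\<rparr>"

text \<open>
  The remaining lemmas show that this is a group with the universal property of the free product,
  with respect to the embeddings \<open>\<lambda>x. syllable_mult G H (Inl x) []\<close> and
  \<open>\<lambda>y. syllable_mult G H (Inr y) []\<close>.
\<close>

context
  fixes G :: "('a, 'm) monoid_scheme" and H :: "('b, 'n) monoid_scheme"
  assumes G: "group G" and H: "group H"
begin

interpretation G: group G by (rule G)
interpretation H: group H by (rule H)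

lemma reduced_words_Nil: "[] \<in> reduced_words G H"
  by (simp add: reduced_words_def)

lemma reduced_words_Cons:
  "x # w \<in> reduced_words G H \<longleftrightarrow>
     x \<in> (carrier G <+> carrier H) - {Inl \<one>\<^bsub>G\<^esub>, Inr \<one>\<^bsub>H\<^esub>} \<and> w \<in> reduced_words G H \<and>
     (w = [] \<or> isl x \<noteq> isl (hd w))"
  by (cases "w = []") (simp_all add: reduced_words_def successively_Cons conj_commute conj_left_commute del: Diff_iff)

lemma syllable_mult_cases [case_names Inl Inr neq]:
  obtains g g' v where "x = Inl g" "w = Inl g' # v"
    | h h' v where "x = Inr h" "w = Inr h' # v"
    | "syllable_mult G H x w = (if x \<in> {Inl \<one>\<^bsub>G\<^esub>, Inr \<one>\<^bsub>H\<^esub>} then w else x # w)"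
      "w = [] \<or> isl x \<noteq> isl (hd w)"
proof (cases w)
  case Nil
  then show ?thesis by (intro that(3)) auto
next
  case (Cons y v)
  show ?thesis
  proof (cases x; cases y)
    fix g g' assume "x = Inl g" "y = Inl g'"
    then show ?thesis using Cons by (intro that(1)) auto
  next
    fix h h' assume "x = Inr h" "y = Inr h'"
    then show ?thesis using Cons by (intro that(2)) auto
  qed (intro that(3); simp add: Cons)+
qed

lemma syllable_mult_closed:
  assumes "x \<in> carrier G <+> carrier H" "w \<in> reduced_words G H"
  shows "syllable_mult G H x w \<in> reduced_words G H"
  using assms
  by (cases x w rule: syllable_mult_cases) (auto simp: reduced_words_Nil reduced_words_Cons)

lemma syllable_mult_one:
  assumes "w \<in> reduced_words G H"
  shows "syllable_mult G H (Inl \<one>\<^bsub>G\<^esub>) w = w" "syllable_mult G H (Inr \<one>\<^bsub>H\<^esub>) w = w"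
proof -
  show "syllable_mult G H (Inl \<one>\<^bsub>G\<^esub>) w = w"
    using assms
    by (cases "Inl \<one>\<^bsub>G\<^esub> :: 'a + 'b" w rule: syllable_mult_cases)
       (auto simp: reduced_words_Cons)
  show "syllable_mult G H (Inr \<one>\<^bsub>H\<^esub>) w = w"
    using assms
    by (cases "Inr \<one>\<^bsub>H\<^esub> :: 'a + 'b" w rule: syllable_mult_cases)
       (auto simp: reduced_words_Cons)
qed

lemma syllable_mult_Inl_neq:
  "w = [] \<or> \<not> isl (hd w) \<Longrightarrow> syllable_mult G H (Inl g) w = (if g = \<one>\<^bsub>G\<^esub> then w else Inl g # w)"
  by (cases "Inl g :: 'a + 'b" w rule: syllable_mult_cases) auto

lemma syllable_mult_Inr_neq:
  "w = [] \<or> isl (hd w) \<Longrightarrow> syllable_mult G H (Inr h) w = (if h = \<one>\<^bsub>H\<^esub> then w else Inr h # w)"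
  by (cases "Inr h :: 'a + 'b" w rule: syllable_mult_cases) auto

lemma syllable_mult_Inl_Inl:
  assumes "g \<in> carrier G" "g' \<in> carrier G" "w \<in> reduced_words G H"
  shows "syllable_mult G H (Inl g) (syllable_mult G H (Inl g') w) =
         syllable_mult G H (Inl (g \<otimes>\<^bsub>G\<^esub> g')) w"
proof (cases "w = [] \<or> \<not> isl (hd w)")
  case True
  then show ?thesis using assms
    by (auto simp: syllable_mult_Inl_neq)
next
  case False
  then obtain k v where w: "w = Inl k # v" by (cases w) (auto simp: isl_def)
  with assms have k: "k \<in> carrier G" "k \<noteq> \<one>\<^bsub>G\<^esub>" "v = [] \<or> \<not> isl (hd v)"
    by (auto simp: reduced_words_Cons)
  have "g \<otimes>\<^bsub>G\<^esub> g' \<otimes>\<^bsub>G\<^esub> k = g" if "g' \<otimes>\<^bsub>G\<^esub> k = \<one>\<^bsub>G\<^esub>"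
    using that assms k by (simp add: G.m_assoc)
  then show ?thesis using assms k
    by (auto simp: w syllable_mult_Inl_neq G.m_assoc)
qed

lemma syllable_mult_Inr_Inr:
  assumes "h \<in> carrier H" "h' \<in> carrier H" "w \<in> reduced_words G H"
  shows "syllable_mult G H (Inr h) (syllable_mult G H (Inr h') w) =
         syllable_mult G H (Inr (h \<otimes>\<^bsub>H\<^esub> h')) w"
proof (cases "w = [] \<or> isl (hd w)")
  case True
  then show ?thesis using assms
    by (auto simp: syllable_mult_Inr_neq)
next
  case False
  then obtain k v where w: "w = Inr k # v" by (cases w; cases "hd w") auto
  with assms have k: "k \<in> carrier H" "k \<noteq> \<one>\<^bsub>H\<^esub>" "v = [] \<or> isl (hd v)"
    by (auto simp: reduced_words_Cons)
  have "h \<otimes>\<^bsub>H\<^esub> h' \<otimes>\<^bsub>H\<^esub> k = h" if "h' \<otimes>\<^bsub>H\<^esub> k = \<one>\<^bsub>H\<^esub>"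
    using that assms k by (simp add: H.m_assoc)
  then show ?thesis using assms k
    by (auto simp: w syllable_mult_Inr_neq H.m_assoc)
qed

lemma free_product_mult_closed:
  assumes "u \<in> reduced_words G H" "v \<in> reduced_words G H"
  shows "foldr (syllable_mult G H) u v \<in> reduced_words G H"
  using assms(1)
  by (induction u) (auto simp: assms(2) reduced_words_Cons intro!: syllable_mult_closed)

lemma foldr_syllable_mult_assoc:
  assumes "x \<in> carrier G <+> carrier H" "v \<in> reduced_words G H" "w \<in> reduced_words G H"
  shows "foldr (syllable_mult G H) (syllable_mult G H x v) w =
         syllable_mult G H x (foldr (syllable_mult G H) v w)"
proof (cases x v rule: syllable_mult_cases)
  case (Inl g g' v')
  with assms have v': "v' \<in> reduced_words G H" "g \<in> carrier G" "g' \<in> carrier G"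
    by (auto simp: reduced_words_Cons)
  let ?z = "foldr (syllable_mult G H) v' w"
  have z: "?z \<in> reduced_words G H"
    using v' assms by (intro free_product_mult_closed)
  show ?thesis
    using syllable_mult_Inl_Inl[OF v'(2,3) z] syllable_mult_one(1)[OF z] Inl by auto
next
  case (Inr h h' v')
  with assms have v': "v' \<in> reduced_words G H" "h \<in> carrier H" "h' \<in> carrier H"
    by (auto simp: reduced_words_Cons)
  let ?z = "foldr (syllable_mult G H) v' w"
  have z: "?z \<in> reduced_words G H"
    using v' assms by (intro free_product_mult_closed)
  show ?thesis
    using syllable_mult_Inr_Inr[OF v'(2,3) z] syllable_mult_one(2)[OF z] Inr by auto
next
  case neq
  show ?thesis
    using syllable_mult_one[OF free_product_mult_closed[OF assms(2,3)]] by (auto simp: neq(1))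
qed

lemma free_product_l_inv_ex:
  assumes "u \<in> reduced_words G H"
  shows "\<exists>v\<in>reduced_words G H. foldr (syllable_mult G H) v u = []"
proof -
  let ?i = "map_sum (m_inv G) (m_inv H)"
  have "foldr (syllable_mult G H) (map ?i (rev u)) u = []"
    using assms
  proof (induction u)
    case (Cons x u)
    moreover have "syllable_mult G H (?i x) (x # u) = u"
      using Cons.prems by (cases x) (auto simp: reduced_words_Cons)
    ultimately show ?case by (simp add: reduced_words_Cons)
  qed simp
  moreover have "map ?i (rev u) \<in> reduced_words G H"
  proof -
    have "isl (?i x) = isl x" for x by (cases x) auto
    moreover have "successively (\<lambda>x y. isl y \<noteq> isl x) u"
      by (rule successively_mono[of "\<lambda>x y. isl x \<noteq> isl y"])
         (use assms in \<open>simp_all add: reduced_words_def\<close>)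
    ultimately have "successively (\<lambda>x y. isl x \<noteq> isl y) (map ?i (rev u))"
      by (simp only: successively_map successively_rev)
    moreover have "?i x \<in> (carrier G <+> carrier H) - {Inl \<one>\<^bsub>G\<^esub>, Inr \<one>\<^bsub>H\<^esub>}"
      if "x \<in> (carrier G <+> carrier H) - {Inl \<one>\<^bsub>G\<^esub>, Inr \<one>\<^bsub>H\<^esub>}" for x
      using that by (cases x) auto
    then have "map ?i (rev u) \<in> lists ((carrier G <+> carrier H) - {Inl \<one>\<^bsub>G\<^esub>, Inr \<one>\<^bsub>H\<^esub>})"
      using assms by (simp add: reduced_words_def in_lists_conv_set del: Diff_iff)
    ultimately show ?thesis by (simp add: reduced_words_def)
  qed
  ultimately show ?thesis by (intro bexI[of _ "map ?i (rev u)"])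
qed

lemma free_product_mult_assoc:
  assumes "u \<in> reduced_words G H" "v \<in> reduced_words G H" "w \<in> reduced_words G H"
  shows "foldr (syllable_mult G H) (foldr (syllable_mult G H) u v) w =
         foldr (syllable_mult G H) u (foldr (syllable_mult G H) v w)"
  using assms(1)
proof (induction u)
  case (Cons x u)
  then have xu: "x \<in> carrier G <+> carrier H" "u \<in> reduced_words G H"
    by (simp_all add: reduced_words_Cons)
  show ?case
    using foldr_syllable_mult_assoc[OF xu(1) free_product_mult_closed[OF xu(2) assms(2)] assms(3)]
      Cons.IH[OF xu(2)]
    by simp
qed simp

lemma free_product_group: "group (free_product G H)"
proof (rule groupI)
  fix u v w
  assume "u \<in> carrier (free_product G H)" "v \<in> carrier (free_product G H)"
    "w \<in> carrier (free_product G H)"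
  then show "u \<otimes>\<^bsub>free_product G H\<^esub> v \<otimes>\<^bsub>free_product G H\<^esub> w =
        u \<otimes>\<^bsub>free_product G H\<^esub> (v \<otimes>\<^bsub>free_product G H\<^esub> w)"
    by (simp add: free_product_def free_product_mult_assoc)
next
  fix u
  assume "u \<in> carrier (free_product G H)"
  then show "\<exists>v\<in>carrier (free_product G H). v \<otimes>\<^bsub>free_product G H\<^esub> u = \<one>\<^bsub>free_product G H\<^esub>"
    using free_product_l_inv_ex by (simp add: free_product_def)
qed (simp_all add: free_product_def reduced_words_Nil free_product_mult_closed)

lemma free_product_Inl_hom: "(\<lambda>x. syllable_mult G H (Inl x) []) \<in> hom G (free_product G H)"
  by (rule homI) (auto simp: free_product_def reduced_words_Nil reduced_words_Cons)

lemma free_product_Inr_hom: "(\<lambda>y. syllable_mult G H (Inr y) []) \<in> hom H (free_product G H)"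
  by (rule homI) (auto simp: free_product_def reduced_words_Nil reduced_words_Cons)

lemma free_product_universal_exists:
  assumes "group K" "f \<in> hom G K" "h \<in> hom H K"
  shows "\<exists>\<phi> \<in> hom (free_product G H) K.
           (\<forall>x\<in>carrier G. \<phi> (syllable_mult G H (Inl x) []) = f x) \<and>
           (\<forall>y\<in>carrier H. \<phi> (syllable_mult G H (Inr y) []) = h y)"
proof -
  interpret K: group K by fact
  interpret f: group_hom G K f using assms by unfold_locales
  interpret h: group_hom H K h using assms by unfold_locales
  define val where "val = case_sum f h"
  define \<phi> where "\<phi> = (\<lambda>w. foldr (\<lambda>x k. val x \<otimes>\<^bsub>K\<^esub> k) w \<one>\<^bsub>K\<^esub>)"
  have val: "val x \<in> carrier K" if "x \<in> carrier G <+> carrier H" for x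
    using that by (auto simp: val_def)
  have \<phi>: "\<phi> w \<in> carrier K" if "w \<in> reduced_words G H" for w
    using that by (induction w) (auto simp: \<phi>_def reduced_words_Cons val_def)
  have act: "\<phi> (syllable_mult G H x w) = val x \<otimes>\<^bsub>K\<^esub> \<phi> w"
    if x: "x \<in> carrier G <+> carrier H" and w: "w \<in> reduced_words G H" for x w
  proof (cases x w rule: syllable_mult_cases)
    case (Inl g g' v)
    with x w have v: "v \<in> reduced_words G H" "g \<in> carrier G" "g' \<in> carrier G"
      by (auto simp: reduced_words_Cons)
    have "f g \<otimes>\<^bsub>K\<^esub> (f g' \<otimes>\<^bsub>K\<^esub> \<phi> v) = f (g \<otimes>\<^bsub>G\<^esub> g') \<otimes>\<^bsub>K\<^esub> \<phi> v"
      using v \<phi> by (simp add: K.m_assoc)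
    then show ?thesis using Inl v \<phi>[OF v(1)]
      by (auto simp: \<phi>_def val_def simp del: f.hom_mult)
  next
    case (Inr g g' v)
    with x w have v: "v \<in> reduced_words G H" "g \<in> carrier H" "g' \<in> carrier H"
      by (auto simp: reduced_words_Cons)
    have "h g \<otimes>\<^bsub>K\<^esub> (h g' \<otimes>\<^bsub>K\<^esub> \<phi> v) = h (g \<otimes>\<^bsub>H\<^esub> g') \<otimes>\<^bsub>K\<^esub> \<phi> v"
      using v \<phi> by (simp add: K.m_assoc)
    then show ?thesis using Inr v \<phi>[OF v(1)]
      by (auto simp: \<phi>_def val_def simp del: h.hom_mult)
  next
    case neq
    then show ?thesis using \<phi>[OF w] by (auto simp: \<phi>_def val_def)
  qed
  have "\<phi> (foldr (syllable_mult G H) u v) = \<phi> u \<otimes>\<^bsub>K\<^esub> \<phi> v"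
    if u: "u \<in> reduced_words G H" and v: "v \<in> reduced_words G H" for u v
    using u
  proof (induction u)
    case Nil
    then show ?case using \<phi>[OF v] by (simp add: \<phi>_def)
  next
    case (Cons x u)
    then have xu: "x \<in> carrier G <+> carrier H" "u \<in> reduced_words G H"
      by (simp_all add: reduced_words_Cons)
    have "\<phi> (foldr (syllable_mult G H) (x # u) v) = val x \<otimes>\<^bsub>K\<^esub> (\<phi> u \<otimes>\<^bsub>K\<^esub> \<phi> v)"
      using xu v Cons.IH by (simp add: act free_product_mult_closed)
    also have "\<dots> = val x \<otimes>\<^bsub>K\<^esub> \<phi> u \<otimes>\<^bsub>K\<^esub> \<phi> v"
      using xu v by (simp add: K.m_assoc val \<phi>)
    finally show ?case by (simp add: \<phi>_def)
  qed
  then have "\<phi> \<in> hom (free_product G H) K"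
    by (intro homI) (auto simp: free_product_def \<phi>)
  moreover have "\<phi> (syllable_mult G H (Inl x) []) = f x" if "x \<in> carrier G" for x
    using that by (auto simp: \<phi>_def val_def)
  moreover have "\<phi> (syllable_mult G H (Inr y) []) = h y" if "y \<in> carrier H" for y
    using that by (auto simp: \<phi>_def val_def)
  ultimately show ?thesis by blast
qed

lemma free_product_universal_unique:
  assumes "group K" "\<phi> \<in> hom (free_product G H) K" "\<psi> \<in> hom (free_product G H) K"
    and "\<And>x. x \<in> carrier G \<Longrightarrow>
      \<phi> (syllable_mult G H (Inl x) []) = \<psi> (syllable_mult G H (Inl x) [])"
    and "\<And>y. y \<in> carrier H \<Longrightarrow>
      \<phi> (syllable_mult G H (Inr y) []) = \<psi> (syllable_mult G H (Inr y) [])"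
    and "w \<in> carrier (free_product G H)"
  shows "\<phi> w = \<psi> w"
  using assms(6)
proof (induction w)
  case Nil
  interpret \<phi>: group_hom "free_product G H" K \<phi>
    using assms by (simp add: group_hom_def group_hom_axioms_def free_product_group)
  interpret \<psi>: group_hom "free_product G H" K \<psi>
    using assms by (simp add: group_hom_def group_hom_axioms_def free_product_group)
  show ?case using \<phi>.hom_one \<psi>.hom_one by (simp add: free_product_def)
next
  case (Cons x w)
  then have xw: "x # w \<in> reduced_words G H" by (simp add: free_product_def)
  then have w: "w \<in> carrier (free_product G H)" and x: "[x] \<in> carrier (free_product G H)"
    by (auto simp: free_product_def reduced_words_Cons reduced_words_Nil)
  have eq: "x # w = [x] \<otimes>\<^bsub>free_product G H\<^esub> w"
    using xw by (cases x)
      (auto simp: free_product_def reduced_words_Cons syllable_mult_Inl_neq syllable_mult_Inr_neq)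
  have "\<phi> [x] = \<psi> [x]"
    using xw assms(4,5) by (cases x) (force simp: reduced_words_Cons)+
  then show ?case
    using assms(2,3) w x Cons.IH by (simp add: eq hom_mult)
qed

end

end

theory Submission
  imports Defs
begin

text \<open>
  Normal forms of the free product are concatenations of normal forms of nontrivial elements,
  alternately from the two factors. In a product of two reduced words \<open>p s\<close> and \<open>s\<^sup>-\<^sup>1 q\<close>, the part
  \<open>s\<close> cancels against \<open>s\<^sup>-\<^sup>1\<close>, and at most one syllable at the end of \<open>p\<close> is multiplied with one
  at the beginning of \<open>q\<close>. So the multiplication table is generated by a context-free grammar
  whose right-hand sides are taken from the multiplication tables of the factors, with \<open>#\<^sub>1\<close>
  replaced by a nonterminal for cancelling pairs and \<open>#\<^sub>2\<close> by one for the common suffix \<open>q\<close>, followed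
  by an intersection with a regular language. ET0L languages are closed under such nested
  substitutions and under rational transductions.
\<close>

section \<open>Table steps\<close>

text \<open>The grammar exists because the third word is written backwards. With
  \<open>u = p g s\<close>, \<open>v = s^-1 g' q\<close> and \<open>w = p (g g') q\<close>, the
  table word is \<open>p g s #1 s^-1 g' q #2 q^rev (g g')^rev p^rev\<close>. The copies of
  \<open>p\<close> stand at the two ends, those of \<open>q\<close> enclose \<open>#2\<close>, and
  \<open>s\<close>, \<open>s^-1\<close> enclose \<open>#1\<close>, so all dependencies nest. The
  triple \<open>g\<close>, \<open>g'\<close>, \<open>g g'\<close> is an entry of the table of one
  factor. Cancelling pairs come from the same tables, as the entries whose third word represents the
  identity.

  The obstacle on the ET0L side is synchronisation: a step rewrites all symbols with a single table,
  so a system cannot be run at one occurrence while the rest of the word stays. Waiting has to be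
  built into every table, and statements about a part of a word must keep track of the tables
  applied.

  The regular filter rests on two choices: the parity of a letter names its factor, and the
  representative of the identity, which may be a nonempty word, is removed from the
  syllables.\<close>

lemma table_step_Nil [simp]: "table_step T [] v \<longleftrightarrow> v = []"
  by (auto simp: table_step_def)

lemma table_step_Cons:
  "table_step T (c # u) v \<longleftrightarrow> (\<exists>x v'. (c, x) \<in> T \<and> v = x @ v' \<and> table_step T u v')"
  by (fastforce simp: table_step_def list_all2_Cons1)

lemma table_step_ConsI: "(c, x) \<in> T \<Longrightarrow> table_step T u v \<Longrightarrow> table_step T (c # u) (x @ v)"
  by (auto simp: table_step_Cons)

lemma table_step_append:
  "table_step T (u @ v) w \<longleftrightarrow> (\<exists>w1 w2. w = w1 @ w2 \<and> table_step T u w1 \<and> table_step T v w2)"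
proof (induction u arbitrary: w)
  case (Cons c u)
  show ?case by (simp add: table_step_Cons Cons.IH) (metis append.assoc)
qed simp

lemma table_step_mono: "table_step T u v \<Longrightarrow> T \<subseteq> T' \<Longrightarrow> table_step T' u v"
  by (induction u arbitrary: v) (auto simp: table_step_Cons)

lemma table_step_lists: "table_step T u v \<Longrightarrow> T \<subseteq> V \<times> lists V \<Longrightarrow> v \<in> lists V"
  by (induction u arbitrary: v) (fastforce simp: table_step_Cons)+

section \<open>Derivations and the sequence of tables they use\<close>

definition multi_step :: "('v \<times> 'v list) set set \<Rightarrow> 'v list \<Rightarrow> 'v list \<Rightarrow> bool" where
  "multi_step \<T> u v \<longleftrightarrow> (\<exists>T\<in>\<T>. table_step T u v)"

lemma et0l_step_eq: "et0l_step E = multi_step (tables E)"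
  by (simp add: fun_eq_iff et0l_step_def multi_step_def)

text \<open>Both parts of a concatenated word undergo the same tables in the same order, so a
  derivation splits along the word only while this sequence is kept fixed. The reflexive transitive
  closure of \<open>multi_step\<close> forgets it.\<close>

fun derivs :: "('v \<times> 'v list) set list \<Rightarrow> 'v list \<Rightarrow> 'v list \<Rightarrow> bool" where
  "derivs [] u v \<longleftrightarrow> u = v"
| "derivs (T # \<tau>) u v \<longleftrightarrow> (\<exists>w. table_step T u w \<and> derivs \<tau> w v)"

lemma multi_steps_derivs: "(multi_step \<T>)\<^sup>*\<^sup>* u v \<Longrightarrow> \<exists>\<tau>\<in>lists \<T>. derivs \<tau> u v"
proof (induction rule: converse_rtranclp_induct)
  case base
  show ?case by (intro bexI[of _ "[]"]) auto
next
  case (step u w)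
  then obtain T \<tau> where "T \<in> \<T>" "table_step T u w" "\<tau> \<in> lists \<T>" "derivs \<tau> w v"
    by (auto simp: multi_step_def)
  then show ?case by (intro bexI[of _ "T # \<tau>"]) auto
qed

lemma derivs_append:
  "derivs \<tau> (u @ v) w \<longleftrightarrow> (\<exists>w1 w2. w = w1 @ w2 \<and> derivs \<tau> u w1 \<and> derivs \<tau> v w2)"
proof (induction \<tau> arbitrary: u v)
  case (Cons T \<tau>)
  show ?case by (simp add: table_step_append) (metis Cons.IH)
qed auto

lemma derivs_Cons:
  "derivs \<tau> (c # u) w \<longleftrightarrow> (\<exists>w1 w2. w = w1 @ w2 \<and> derivs \<tau> [c] w1 \<and> derivs \<tau> u w2)"
  using derivs_append[of \<tau> "[c]" u] by simp

lemma derivs_Nil [simp]: "derivs \<tau> [] w \<longleftrightarrow> w = []"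
  by (induction \<tau>) auto

text \<open>
  Tables need not contain a rule for every symbol here: a fresh dead symbol, which never disappears,
  supplies the missing ones.
\<close>

lemma ET0L_I:
  fixes h :: "'s \<Rightarrow> 'v"
  assumes V: "finite V" "S \<in> V" and \<T>: "finite \<T>" "\<T> \<noteq> {}"
    and T: "\<And>T. T \<in> \<T> \<Longrightarrow> finite T" "\<And>T. T \<in> \<T> \<Longrightarrow> T \<subseteq> V \<times> lists V"
    and h: "inj h"
  shows "{w. (multi_step \<T>)\<^sup>*\<^sup>* [S] (map h w)} \<in> ET0L"
proof -
  obtain idx :: "'v \<Rightarrow> nat" where idx: "inj_on idx V"
    using finite_imp_inj_to_nat_seg[OF V(1)] by blast
  \<comment> \<open>The symbols \<open>h a\<close> must become the terminals \<open>Inl a\<close>.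
    All others go to the right summand, where \<open>Suc\<close> keeps \<open>Inr 0\<close> free for
    \<open>dead\<close>.\<close>
  define f :: "'v \<Rightarrow> 's + nat" where
    "f v = (if v \<in> range h then Inl (inv_into UNIV h v) else Inr (Suc (idx v)))" for v
  define dead :: "'s + nat" where "dead = Inr 0"
  have fh [simp]: "f (h a) = Inl a" for a using h by (simp add: f_def)
  have f_Inl: "v = h a" if "f v = Inl a" for v a
    using that h by (auto simp: f_def f_inv_into_f split: if_splits)
  have f: "inj_on f V"
    using idx h by (auto simp: inj_on_def f_def split: if_splits)
  have dead: "f v \<noteq> dead" "dead \<noteq> f v" for v by (auto simp: f_def dead_def)
  \<comment> \<open>Every symbol may turn into \<open>dead\<close>, even one with rules of its own,
    and \<open>dead\<close> only reproduces itself. This is harmless because a word containing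
    \<open>dead\<close> never becomes terminal.\<close>
  define cmp where
    "cmp T = (\<lambda>(c, x). (f c, map f x)) ` T \<union> insert dead (f ` V) \<times> {[dead]}" for T
  define E where "E = \<lparr>symbols = insert dead (f ` V), terminals = Inl ` {a. h a \<in> V},
     start_word = [f S], tables = cmp ` \<T>\<rparr>"
  have "finite {a. h a \<in> V}" using finite_vimageI[OF V(1) h] by (simp add: vimage_def)
  have E: "is_et0l_system E"
    unfolding is_et0l_system_def
  proof (intro conjI ballI)
    show "terminals E \<subseteq> symbols E"
      by (auto simp: E_def) (metis fh imageI)
    fix T' assume "T' \<in> tables E"
    then obtain T0 where T0: "T0 \<in> \<T>" "T' = cmp T0" by (auto simp: E_def)
    show "finite T'" using T(1)[OF T0(1)] V by (simp add: T0 cmp_def)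
    show "T' \<subseteq> symbols E \<times> lists (symbols E)"
      using T(2)[OF T0(1)] by (fastforce simp: T0 cmp_def E_def)
    show "\<exists>x. (c, x) \<in> T'" if "c \<in> symbols E" for c
      using that by (auto simp: T0 cmp_def E_def)
  qed (use V \<T> in \<open>simp_all add: E_def\<close>)
  have fwd: "table_step (cmp T) (map f u) (map f v)" if "table_step T u v" for T u v
    using that
  proof (induction u arbitrary: v)
    case (Cons c u)
    then obtain x v' where *: "(c, x) \<in> T" "v = x @ v'" "table_step T u v'"
      by (auto simp: table_step_Cons)
    moreover have "(f c, map f x) \<in> cmp T" using *(1) by (auto simp: cmp_def intro!: image_eqI[of _ _ "(c,x)"])
    ultimately show ?case using Cons.IH[of v'] by (auto simp: table_step_Cons)
  qed simp
  \<comment> \<open>\<open>f\<close> is only known to be injective on \<open>V\<close>, so the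
    symbol to which a rule belongs is recovered for words over \<open>V\<close>; \<open>inV\<close>
    supplies this for derivable words.\<close>
  have bwd: "\<exists>v'. v = map f v' \<and> table_step T u v'"
    if "table_step (cmp T) (map f u) v" "u \<in> lists V" "dead \<notin> set v" "T \<in> \<T>" for T u v
    using that(1-3)
  proof (induction u arbitrary: v)
    case (Cons c u)
    then obtain x v' where *: "(f c, x) \<in> cmp T" "v = x @ v'" "table_step (cmp T) (map f u) v'"
      by (auto simp: table_step_Cons)
    with Cons.prems obtain c' x' where x': "f c = f c'" "x = map f x'" "(c', x') \<in> T"
      by (auto simp: cmp_def)
    then have "c = c'" using f Cons.prems T(2)[OF that(4)] by (auto simp: inj_on_def)
    moreover obtain v'' where "v' = map f v''" "table_step T u v''"
      using Cons.IH[of v'] * Cons.prems by auto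
    ultimately have "(c, x') \<in> T" "table_step T u v''" "v = map f (x' @ v'')"
      using x' * by simp_all
    then show ?case unfolding table_step_Cons by blast
  qed simp
  have dd: "dead \<in> set v" if "table_step (cmp T) u v" "dead \<in> set u" for T u v
    using that
  proof (induction u arbitrary: v)
    case (Cons c u)
    then obtain x v' where *: "(c, x) \<in> cmp T" "v = x @ v'" "table_step (cmp T) u v'"
      by (auto simp: table_step_Cons)
    show ?case
    proof (cases "c = dead")
      case True
      then have "x = [dead]" using * dead by (auto simp: cmp_def)
      then show ?thesis using * by simp
    next
      case False
      then show ?thesis using * Cons by auto
    qed
  qed simp
  have inV: "w \<in> lists V" if "(multi_step \<T>)\<^sup>*\<^sup>* [S] w" for w
    using that
  proof (induction rule: rtranclp_induct)
    case (step y z)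
    then show ?case using T(2) table_step_lists unfolding multi_step_def by blast
  qed (use V in simp)
  have fwds: "(et0l_step E)\<^sup>*\<^sup>* [f S] (map f w)" if "(multi_step \<T>)\<^sup>*\<^sup>* [S] w" for w
    using that
  proof (induction rule: rtranclp_induct)
    case (step y z)
    then obtain T where "T \<in> \<T>" "table_step T y z" by (auto simp: multi_step_def)
    then have "et0l_step E (map f y) (map f z)"
      using fwd by (auto simp: et0l_step_def E_def)
    with step show ?case by simp
  qed simp
  have bwds: "\<exists>w'. w = map f w' \<and> (multi_step \<T>)\<^sup>*\<^sup>* [S] w'"
    if "(et0l_step E)\<^sup>*\<^sup>* [f S] w" "dead \<notin> set w" for w
    using that
  proof (induction rule: rtranclp_induct)
    case base
    show ?case by (intro exI[of _ "[S]"]) simp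
  next
    case (step y z)
    then obtain T where T: "T \<in> \<T>" "table_step (cmp T) y z"
      by (auto simp: et0l_step_def E_def)
    with step obtain y' where y': "y = map f y'" "(multi_step \<T>)\<^sup>*\<^sup>* [S] y'" using dd by blast
    then obtain z' where "z = map f z'" "table_step T y' z'"
      using bwd[of T y' z] T inV[OF y'(2)] step.prems by blast
    moreover from this have "multi_step \<T> y' z'" using T by (auto simp: multi_step_def)
    then have "(multi_step \<T>)\<^sup>*\<^sup>* [S] z'" using y'(2) by simp
    ultimately show ?case by blast
  qed
  have "et0l_generated E = map Inl ` {w. (multi_step \<T>)\<^sup>*\<^sup>* [S] (map h w)}" (is "?A = ?B")
  proof
    show "?A \<subseteq> ?B"
    proof
      fix w assume w: "w \<in> ?A"
      then have steps: "(et0l_step E)\<^sup>*\<^sup>* [f S] w" and set: "set w \<subseteq> range Inl"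
        unfolding et0l_generated_def E_def by auto
      from set have "dead \<notin> set w" by (auto simp: dead_def)
      with bwds[OF steps] obtain w' where w': "w = map f w'" "(multi_step \<T>)\<^sup>*\<^sup>* [S] w'" by blast
      have "\<exists>w1. map f w' = map Inl w1 \<and> w' = map h w1" if "set (map f w') \<subseteq> range Inl" for w'
        using that
      proof (induction w')
        case (Cons b w')
        then obtain a w1 where "f b = Inl a" "map f w' = map Inl w1" "w' = map h w1" by auto
        then show ?case using f_Inl by (intro exI[of _ "a # w1"]) simp
      qed simp
      then show "w \<in> ?B" using w' set by blast
    qed
    show "?B \<subseteq> ?A"
    proof
      fix w assume "w \<in> ?B"
      then obtain w1 where w1: "w = map Inl w1" "(multi_step \<T>)\<^sup>*\<^sup>* [S] (map h w1)" by blast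
      have "map f (map h w1) = w" using w1(1) by simp
      then have "(et0l_step E)\<^sup>*\<^sup>* [f S] w" using fwds[OF w1(2)] by simp
      moreover have "w \<in> lists (terminals E)"
        using w1(1) inV[OF w1(2)] by (simp add: E_def in_lists_conv_set)
      ultimately show "w \<in> ?A" unfolding et0l_generated_def by (simp add: E_def)
    qed
  qed
  moreover have "terminals E \<subseteq> range Inl" by (auto simp: E_def)
  ultimately show ?thesis using E by (auto simp: ET0L_def)
qed


section \<open>Rational transductions\<close>

text \<open>Every transition consumes exactly one input letter and may write any word, so states can
  be attached to the boundaries between input letters.\<close>

fun trun :: "('q \<times> 's \<times> 't list \<times> 'q) set \<Rightarrow> 'q \<Rightarrow> 's list \<Rightarrow> 't list \<Rightarrow> 'q \<Rightarrow> bool" where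
  "trun \<Delta> p [] v q \<longleftrightarrow> v = [] \<and> p = q"
| "trun \<Delta> p (a # w) v q \<longleftrightarrow> (\<exists>x v' r. (p, a, x, r) \<in> \<Delta> \<and> v = x @ v' \<and> trun \<Delta> r w v' q)"

text \<open>The symbol \<open>Tri p c q\<close> guesses that the transducer moves from \<open>p\<close> to \<open>q\<close> on what becomes of \<open>c\<close>.\<close>

datatype ('q, 'c, 't) trans_symbol = Start | Tri 'q 'c 'q | Out 't

text \<open>The triple construction known from intersecting context-free with regular languages:
  each letter carries the guessed states before and after it, and neighbouring guesses must
  agree.\<close>

fun path :: "'q set \<Rightarrow> 'q \<Rightarrow> 'c list \<Rightarrow> 'q \<Rightarrow> ('q, 'c, 't) trans_symbol list \<Rightarrow> bool" where
  "path Q p [] q U \<longleftrightarrow> U = [] \<and> p = q"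
| "path Q p (c # u) q U \<longleftrightarrow> (\<exists>r U'. r \<in> Q \<and> U = Tri p c r # U' \<and> path Q r u q U')"

lemma path_append:
  "path Q p (u @ v) q U \<longleftrightarrow> (\<exists>r U1 U2. U = U1 @ U2 \<and> path Q p u r U1 \<and> path Q r v q U2)"
proof (induction u arbitrary: p U)
  case (Cons c u)
  show ?case by (simp add: Cons.IH) (metis append_Cons)
qed simp

lemma path_in: "path Q p u q U \<Longrightarrow> p \<in> Q \<Longrightarrow> q \<in> Q"
  by (induction u arbitrary: p U) auto

text \<open>All guesses for the interior of a right-hand side are allowed. A rule that erases
  \<open>c\<close> lifts only to triples with \<open>p = q\<close>, so some triples may be left
  without a rule; \<open>ET0L_I\<close> permits such tables.\<close>

definition lift_table ::
  "'q set \<Rightarrow> ('c \<times> 'c list) set \<Rightarrow>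
     (('q, 'c, 't) trans_symbol \<times> ('q, 'c, 't) trans_symbol list) set" where
  "lift_table Q T = {(Tri p c q, U) | p c q U. p \<in> Q \<and> q \<in> Q \<and> (\<exists>x. (c, x) \<in> T \<and> path Q p x q U)}"

lemma path_set:
  assumes "path Q p u q U" "p \<in> Q" "set u \<subseteq> V"
  shows "set U \<subseteq> (\<lambda>(p, c, q). Tri p c q) ` (Q \<times> V \<times> Q)"
  using assms
proof (induction u arbitrary: p U)
  case (Cons c u)
  then obtain r U' where r: "r \<in> Q" "U = Tri p c r # U'" "path Q r u q U'" by auto
  moreover have "Tri p c r \<in> (\<lambda>(p, c, q). Tri p c q) ` (Q \<times> V \<times> Q)"
    using Cons.prems r(1) by (intro image_eqI[of _ _ "(p, c, r)"]) auto
  ultimately show ?case using Cons.IH[OF r(3,1)] Cons.prems by simp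
qed simp

lemma length_path: "path Q p u q U \<Longrightarrow> length U = length u"
  by (induction u arbitrary: p U) auto

lemma finite_path:
  fixes Q :: "'q set" and u :: "'c list"
  assumes "finite Q" "p \<in> Q"
  shows "finite {U :: ('q, 'c, 't) trans_symbol list. path Q p u q U}"
proof (rule finite_subset)
  let ?V = "(\<lambda>(p, c, q). Tri p c q :: ('q, 'c, 't) trans_symbol) ` (Q \<times> set u \<times> Q)"
  show "{U. path Q p u q U} \<subseteq> {U. set U \<subseteq> ?V \<and> length U = length u}"
  proof clarify
    fix U :: "('q, 'c, 't) trans_symbol list"
    assume U: "path Q p u q U"
    show "set U \<subseteq> ?V \<and> length U = length u"
      using path_set[OF U assms(2) subset_refl] length_path[OF U] by simp
  qed
  show "finite {U. set U \<subseteq> ?V \<and> length U = length u}"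
    by (intro finite_lists_length_eq) (use assms in auto)
qed

lemma finite_lift_table:
  fixes Q :: "'q set" and T :: "('c \<times> 'c list) set"
  assumes "finite Q" "finite T"
  shows "finite (lift_table Q T :: (('q, 'c, 't) trans_symbol \<times> _) set)"
proof -
  have "(lift_table Q T :: (('q, 'c, 't) trans_symbol \<times> _) set) =
    (\<Union>p\<in>Q. \<Union>q\<in>Q. \<Union>(c, x)\<in>T. Pair (Tri p c q) ` {U. path Q p x q U})" (is "_ = ?A")
  proof (intro Set.set_eqI iffI)
    fix z :: "('q, 'c, 't) trans_symbol \<times> _" assume "z \<in> lift_table Q T"
    then obtain p c q x U where "z = (Tri p c q, U)" "p \<in> Q" "q \<in> Q" "(c, x) \<in> T" "path Q p x q U"
      unfolding lift_table_def by blast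
    then show "z \<in> ?A" by blast
  next
    fix z assume "z \<in> ?A"
    then show "z \<in> lift_table Q T" unfolding lift_table_def by blast
  qed
  moreover have "finite \<dots>" using assms by (intro finite_UN_I) (auto intro!: finite_path)
  ultimately show ?thesis by simp
qed

text \<open>Guessing states commutes with rewriting. The states attached to a letter are the end
  points of the path over its replacement, so a path over the new word yields one over the old word
  by keeping the states at the boundaries between replacements.\<close>

lemma lift_table_step:
  assumes "p \<in> Q"
  shows "(\<exists>U. path Q p u q U \<and> table_step (lift_table Q T) U U') \<longleftrightarrow>
         (\<exists>u'. table_step T u u' \<and> path Q p u' q U')"
  using assms
proof (induction u arbitrary: p U')
  case (Cons c u)
  have "(\<exists>U. path Q p (c # u) q U \<and> table_step (lift_table Q T) U U') \<longleftrightarrow>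
        (\<exists>r x U1 U2. r \<in> Q \<and> (c, x) \<in> T \<and> path Q p x r U1 \<and> U' = U1 @ U2 \<and>
           (\<exists>U. path Q r u q U \<and> table_step (lift_table Q T) U U2))" (is "?L = ?R")
  proof
    assume ?L
    then obtain r U where r: "r \<in> Q" "path Q r u q U" "table_step (lift_table Q T) (Tri p c r # U) U'"
      by auto
    then obtain U1 U2 where "(Tri p c r, U1) \<in> lift_table Q T" "U' = U1 @ U2"
      "table_step (lift_table Q T) U U2" unfolding table_step_Cons by blast
    moreover from this obtain x where "(c, x) \<in> T" "path Q p x r U1"
      unfolding lift_table_def by blast
    ultimately show ?R using r by blast
  next
    assume ?R
    then obtain r x U1 U2 U where *: "r \<in> Q" "(c, x) \<in> T" "path Q p x r U1" "U' = U1 @ U2"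
      "path Q r u q U" "table_step (lift_table Q T) U U2" by blast
    have "(Tri p c r, U1) \<in> lift_table Q T" using * Cons.prems unfolding lift_table_def by blast
    then have "table_step (lift_table Q T) (Tri p c r # U) U'"
      using * unfolding table_step_Cons by blast
    then show ?L using *(1,5) by (intro exI[of _ "Tri p c r # U"]) simp
  qed
  also have "\<dots> \<longleftrightarrow> (\<exists>r x U1 U2. r \<in> Q \<and> (c, x) \<in> T \<and> path Q p x r U1 \<and> U' = U1 @ U2 \<and>
           (\<exists>u'. table_step T u u' \<and> path Q r u' q U2))"
    using Cons.IH by (metis (no_types, lifting))
  also have "\<dots> \<longleftrightarrow> (\<exists>x u'. (c, x) \<in> T \<and> table_step T u u' \<and> path Q p (x @ u') q U')"
    using path_in[OF _ Cons.prems] unfolding path_append by blast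
  also have "\<dots> \<longleftrightarrow> (\<exists>u'. table_step T (c # u) u' \<and> path Q p u' q U')"
    unfolding table_step_Cons by blast
  finally show ?case .
qed auto

lemma lift_table_steps:
  assumes "p \<in> Q"
  shows "(\<exists>U. path Q p u q U \<and> (multi_step (lift_table Q ` \<T>))\<^sup>*\<^sup>* U U') \<longleftrightarrow>
         (\<exists>u'. (multi_step \<T>)\<^sup>*\<^sup>* u u' \<and> path Q p u' q U')" (is "?L \<longleftrightarrow> ?R")
proof
  have *: "(\<exists>U. path Q p u q U \<and> multi_step (lift_table Q ` \<T>) U U') \<longleftrightarrow>
        (\<exists>u'. multi_step \<T> u u' \<and> path Q p u' q U')" for u U'
    using lift_table_step[OF assms] unfolding multi_step_def by blast
  {
    assume ?L
    then obtain U where "(multi_step (lift_table Q ` \<T>))\<^sup>*\<^sup>* U U'" "path Q p u q U" by blast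
    then show ?R
    proof (induction rule: rtranclp_induct)
      case (step Y Z)
      then obtain y where "(multi_step \<T>)\<^sup>*\<^sup>* u y" "path Q p y q Y" by blast
      moreover obtain z where "multi_step \<T> y z" "path Q p z q Z"
        using * step(2) calculation(2) by blast
      ultimately show ?case by (meson rtranclp.rtrancl_into_rtrancl)
    qed blast
  }
  assume ?R
  then obtain u' where "(multi_step \<T>)\<^sup>*\<^sup>* u u'" "path Q p u' q U'" by blast
  then show ?L
  proof (induction arbitrary: U' rule: rtranclp_induct)
    case (step y z)
    then obtain Y where "multi_step (lift_table Q ` \<T>) Y U'" "path Q p y q Y" using * by blast
    with step.IH show ?case by (meson rtranclp.rtrancl_into_rtrancl)
  qed blast
qed

text \<open>Guesses are checked only here, all in one step. Triples over \<open>Inr\<close> symbols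
  have no rule, so a word that still contains one is blocked.\<close>

definition out_table ::
  "('q \<times> 's \<times> 't list \<times> 'q) set \<Rightarrow>
     (('q, 's + 'd, 't) trans_symbol \<times> ('q, 's + 'd, 't) trans_symbol list) set" where
  "out_table \<Delta> = {(Tri p (Inl a) q, map Out v) | p a v q. (p, a, v, q) \<in> \<Delta>}"

lemma out_table_step:
  assumes "\<And>p a v q. (p, a, v, q) \<in> \<Delta> \<Longrightarrow> q \<in> Q"
  shows "(\<exists>U. path Q p u q U \<and> table_step (out_table \<Delta>) U V) \<longleftrightarrow>
         (\<exists>w v. u = map Inl w \<and> V = map Out v \<and> trun \<Delta> p w v q)"
proof (induction u arbitrary: p V)
  case Nil
  show ?case by auto
next
  case (Cons c u)
  have "(\<exists>U. path Q p (c # u) q U \<and> table_step (out_table \<Delta>) U V) \<longleftrightarrow>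
        (\<exists>r a x V2. c = Inl a \<and> (p, a, x, r) \<in> \<Delta> \<and> V = map Out x @ V2 \<and>
           (\<exists>U. path Q r u q U \<and> table_step (out_table \<Delta>) U V2))" (is "?L = ?R")
  proof
    assume ?L
    then obtain r U where r: "path Q r u q U" "table_step (out_table \<Delta>) (Tri p c r # U) V"
      by auto
    then obtain V1 V2 where "(Tri p c r, V1) \<in> out_table \<Delta>" "V = V1 @ V2"
      "table_step (out_table \<Delta>) U V2" unfolding table_step_Cons by blast
    moreover from this obtain a x where "c = Inl a" "(p, a, x, r) \<in> \<Delta>" "V1 = map Out x"
      unfolding out_table_def by blast
    ultimately show ?R using r(1) by blast
  next
    assume ?R
    then obtain r a x V2 U where *: "c = Inl a" "(p, a, x, r) \<in> \<Delta>" "V = map Out x @ V2"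
      "path Q r u q U" "table_step (out_table \<Delta>) U V2" by blast
    have "(Tri p c r, map Out x) \<in> out_table \<Delta>" using * unfolding out_table_def by blast
    then have "table_step (out_table \<Delta>) (Tri p c r # U) V"
      using * unfolding table_step_Cons by blast
    then show ?L using * assms by (intro exI[of _ "Tri p c r # U"]) auto
  qed
  also have "\<dots> \<longleftrightarrow> (\<exists>w v. c # u = map Inl w \<and> V = map Out v \<and> trun \<Delta> p w v q)" (is "?L = ?R")
  proof
    assume ?L
    then obtain r a x V2 w v where "c = Inl a" "(p, a, x, r) \<in> \<Delta>" "V = map Out x @ V2"
      "u = map Inl w" "V2 = map Out v" "trun \<Delta> r w v q" unfolding Cons.IH by blast
    then show ?R by (intro exI[of _ "a # w"] exI[of _ "x @ v"]) auto
  next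
    assume ?R
    then obtain w v where wv: "c # u = map Inl w" "V = map Out v" "trun \<Delta> p w v q"
      by (elim exE conjE) (rule that)
    then obtain a w' where w': "w = a # w'" "c = Inl a" "u = map Inl w'" by (cases w) auto
    then obtain x v' r where "(p, a, x, r) \<in> \<Delta>" "v = x @ v'" "trun \<Delta> r w' v' q" using wv(3) by auto
    then show ?L unfolding Cons.IH using w' wv(2) by (metis map_append)
  qed
  finally show ?case .
qed

text \<open>The new system guesses an end state and a path over the start word, follows a derivation
  of \<open>E\<close> on triples, and finishes with one application of the output table, which
  compares every triple with \<open>\<Delta>\<close>.\<close>

theorem ET0L_transduce:
  fixes L :: "'s list set" and \<Delta> :: "('q \<times> 's \<times> 't list \<times> 'q) set"
  assumes L: "L \<in> ET0L" and \<Delta>: "finite \<Delta>" and F: "finite F"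
  shows "{v. \<exists>w\<in>L. \<exists>q\<in>F. trun \<Delta> q0 w v q} \<in> ET0L" (is "?M \<in> _")
proof -
  from L obtain E :: "('s + nat) et0l_system" where E: "is_et0l_system E"
    "et0l_generated E = map Inl ` L"
    unfolding ET0L_def by blast
  define Q where "Q = insert q0 F \<union> (\<lambda>(p, a, v, q). p) ` \<Delta> \<union> (\<lambda>(p, a, v, q). q) ` \<Delta>"
  have Q: "finite Q" "q0 \<in> Q" using \<Delta> F by (auto simp: Q_def)
  have Q\<Delta>: "p \<in> Q" "q \<in> Q" if "(p, a, v, q) \<in> \<Delta>" for p a v q 
    using image_eqI[of p "\<lambda>(p, a, v, q). p", OF _ that]
      image_eqI[of q "\<lambda>(p, a, v, q). q", OF _ that] by (simp_all add: Q_def)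
  \<comment> \<open>A symbol \<open>Inl a\<close> of \<open>E\<close> may be a nonterminal. Words
    containing it are derivable but not generated, so the output table must not read it.\<close>
  let ?\<Delta> = "{(p, a, v, q) \<in> \<Delta>. Inl a \<in> terminals E}"
  define start :: "(('q, 's + nat, 't) trans_symbol \<times> ('q, 's + nat, 't) trans_symbol list) set" where
    "start = {(Start, U) | U. \<exists>q\<in>F. path Q q0 (start_word E) q U}"
  let ?lift = "lift_table Q ` tables E :: (('q, 's + nat, 't) trans_symbol \<times> ('q, 's + nat, 't) trans_symbol list) set set"
  define \<T> where "\<T> = insert start (insert (out_table ?\<Delta>) ?lift)"
  define \<A> where "\<A> = (\<lambda>(p, a, v, q). a) ` \<Delta>"
  define \<B> where "\<B> = (\<Union>(p, a, v, q) \<in> \<Delta>. set v)"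
  define V where "V = insert Start ((\<lambda>(p, c, q). Tri p c q) ` (Q \<times> (symbols E \<union> Inl ` \<A>) \<times> Q) \<union> Out ` \<B>)"
  have gen: "map Inl w \<in> lists (terminals E) \<and> (multi_step (tables E))\<^sup>*\<^sup>* (start_word E) (map Inl w)
       \<longleftrightarrow> w \<in> L" for w
  proof -
    have "map Inl w \<in> et0l_generated E \<longleftrightarrow> w \<in> L"
      unfolding E(2) by (rule inj_image_mem_iff) simp
    then show ?thesis by (simp add: et0l_generated_def et0l_step_eq)
  qed

  have trun_iff: "trun ?\<Delta> p w v q \<longleftrightarrow> trun \<Delta> p w v q \<and> map Inl w \<in> lists (terminals E)" for p w v q
    by (induction w arbitrary: p v) auto
  have wf: "T \<subseteq> symbols E \<times> lists (symbols E)" "finite T" if "T \<in> tables E" for T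
    using E(1) that by (auto simp: is_et0l_system_def)
  have TriV: "Tri p c q \<in> V" if "p \<in> Q" "q \<in> Q" "c \<in> symbols E \<union> Inl ` \<A>" for p c q
    unfolding V_def using that by (intro insertI2 UnI1 image_eqI[of _ _ "(p, c, q)"]) auto
  have OutV: "Out b \<in> V" if "b \<in> \<B>" for b using that by (simp add: V_def)
  have tri: "U \<in> lists V" if "path Q p u q U" "p \<in> Q" "u \<in> lists (symbols E)" for p u q U
    using path_set[OF that(1,2), of "symbols E"] that(3) by (auto simp: V_def)
  have "{w. (multi_step \<T>)\<^sup>*\<^sup>* [Start] (map Out w)} \<in> ET0L"
  proof (rule ET0L_I[where V = V])
    show "finite V"
      using E(1) \<Delta> Q by (auto simp: V_def \<A>_def \<B>_def is_et0l_system_def)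
    show "Start \<in> V" by (simp add: V_def)
    show "finite \<T>" "\<T> \<noteq> {}" using E(1) by (auto simp: \<T>_def is_et0l_system_def)
    show "inj Out" by (auto simp: inj_def)
    fix T assume "T \<in> \<T>"
    then consider "T = start" | "T = out_table ?\<Delta>" | T' where "T' \<in> tables E" "T = lift_table Q T'"
      by (auto simp: \<T>_def)
    then have "finite T \<and> T \<subseteq> V \<times> lists V"
    proof cases
      case 1
      have "start = (\<Union>q\<in>F. Pair Start ` {U. path Q q0 (start_word E) q U})"
        by (auto simp: start_def)
      then have "finite start" using F Q by (auto intro!: finite_path)
      moreover have "start \<subseteq> V \<times> lists V"
        using tri[of q0 "start_word E"] E(1) Q(2)
        by (auto simp: start_def is_et0l_system_def) (auto simp: V_def)
      ultimately show ?thesis using 1 by simp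
    next
      case 2
      have T: "T \<subseteq> (\<lambda>(p, a, v, q). (Tri p (Inl a) q, map Out v)) ` \<Delta>"
        unfolding 2 out_table_def by force
      have "(Tri p (Inl a) q, map Out v) \<in> V \<times> lists V" if "(p, a, v, q) \<in> \<Delta>" for p a v q
      proof -
        have "a \<in> \<A>" unfolding \<A>_def by (rule image_eqI[OF _ that]) simp
        moreover have "set v \<subseteq> \<B>" using that unfolding \<B>_def by blast
        ultimately show ?thesis using Q\<Delta>[OF that] TriV OutV by fastforce
      qed
      then have "T \<subseteq> V \<times> lists V" unfolding 2 out_table_def by blast
      then show ?thesis using \<Delta> T finite_subset by blast
    next
      case 3
      have "T \<subseteq> V \<times> lists V"
      proof
        fix z assume "z \<in> T"
        then obtain p c q x U where *: "z = (Tri p c q, U)" "p \<in> Q" "q \<in> Q" "(c, x) \<in> T'"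
          "path Q p x q U" unfolding 3 lift_table_def by blast
        then have "c \<in> symbols E" "x \<in> lists (symbols E)" using wf[OF 3(1)] by auto
        then show "z \<in> V \<times> lists V" using * tri[of p x q U] TriV by simp
      qed
      then show ?thesis using 3 finite_lift_table[OF Q(1) wf(2)] by simp
    qed
    then show "finite T" "T \<subseteq> V \<times> lists V" by auto
  qed
  also have "{w. (multi_step \<T>)\<^sup>*\<^sup>* [Start] (map Out w)} = ?M"
  proof (intro Set.set_eqI iffI)
    fix v assume "v \<in> ?M"
    then obtain w q where w: "w \<in> L" "q \<in> F" "trun \<Delta> q0 w v q" by auto
    then obtain U :: "('q, 's + nat, 't) trans_symbol list" where
      U: "path Q q0 (map Inl w) q U" "table_step (out_table ?\<Delta>) U (map Out v)"
      using out_table_step[of ?\<Delta> Q q0 "map Inl w" q "map Out v"] Q\<Delta> trun_iff gen by blast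
    then obtain U0 where U0: "path Q q0 (start_word E) q U0" "(multi_step ?lift)\<^sup>*\<^sup>* U0 U"
      using lift_table_steps[OF Q(2), of "start_word E" q "tables E" U] gen w(1) by blast
    have "(multi_step \<T>)\<^sup>*\<^sup>* U0 U"
      using U0(2) by (rule rtranclp_mono[THEN predicate2D, rotated]) (auto simp: multi_step_def \<T>_def)
    moreover have "multi_step \<T> [Start] U0"
      using U0(1) w(2) by (auto simp: multi_step_def \<T>_def start_def table_step_Cons)
    moreover have "multi_step \<T> U (map Out v)" using U(2) by (auto simp: multi_step_def \<T>_def)
    ultimately have "(multi_step \<T>)\<^sup>*\<^sup>* [Start] (map Out v)" by simp
    then show "v \<in> {w. (multi_step \<T>)\<^sup>*\<^sup>* [Start] (map Out w)}" by simp
  next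
    fix v assume "v \<in> {w. (multi_step \<T>)\<^sup>*\<^sup>* [Start] (map Out w)}"
    \<comment> \<open>A derivation passes through three phases: the start symbol, paths over words
      derivable in \<open>E\<close>, and output. \<open>mid\<close> is the invariant of the
      second.\<close>
    define mid where "mid U \<longleftrightarrow> (\<exists>u. \<exists>q\<in>F. (multi_step (tables E))\<^sup>*\<^sup>* (start_word E) u \<and> path Q q0 u q U)"
      for U :: "('q, 's + nat, 't) trans_symbol list"
    \<comment> \<open>The last two phases overlap in the empty word, which is at once a path and an
      output. Then \<open>E\<close> derives the empty word, and the empty run already ends in
      \<open>q0 = q\<close>.\<close>
    have Nil_M: "v \<in> ?M" if "mid (map Out v)" for v
    proof -
      from that obtain u q where u: "q \<in> F" "(multi_step (tables E))\<^sup>*\<^sup>* (start_word E) u"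
        "path Q q0 u q (map Out v)" by (auto simp: mid_def)
      then have "u = []" "v = []" "q0 = q" by (cases u; force)+
      then show ?thesis using u gen[of "[]"] by force
    qed
    \<comment> \<open>Output symbols have no rule in any table, so after the output step only the
      empty word can be rewritten, and only to itself.\<close>
    have stuck: "table_step T U U' \<longleftrightarrow> U = [] \<and> U' = []"
      if "\<And>c x. c \<in> set U \<Longrightarrow> (c, x) \<notin> T" for T :: "(('q, 's + nat, 't) trans_symbol \<times> _) set" and U U'
      using that by (cases U) (auto simp: table_step_Cons)
    have "v \<in> ?M" if "(multi_step \<T>)\<^sup>*\<^sup>* [Start] V" "V = map Out v" for V
      using that
    proof -
      have "V = [Start] \<or> mid V \<or> (\<exists>v\<in>?M. V = map Out v)"
        using that(1)
      proof (induction rule: rtranclp_induct)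
        case (step Y Z)
        then obtain T where T: "T \<in> \<T>" "table_step T Y Z" by (auto simp: multi_step_def)
        consider "T = start" | "T = out_table ?\<Delta>" | T' where "T' \<in> tables E" "T = lift_table Q T'"
          using T(1) by (auto simp: \<T>_def)
        note Tcases = this
        from step.IH show ?case
        proof (elim disjE)
          assume Y: "Y = [Start]"
          from Tcases show ?thesis
          proof cases
            case 1
            then show ?thesis using T Y by (auto simp: start_def table_step_Cons mid_def)
          qed (use T Y in \<open>auto simp: out_table_def lift_table_def table_step_Cons\<close>)
        next
          assume Y: "mid Y"
          then obtain u q where u: "(multi_step (tables E))\<^sup>*\<^sup>* (start_word E) u" "q \<in> F"
            "path Q q0 u q Y" by (auto simp: mid_def)
          from Tcases show ?thesis
          proof cases
            case 1
            then show ?thesis using T Y u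
              by (cases u) (auto simp: start_def table_step_Cons)
          next
            case 2
            then obtain w v where "u = map Inl w" "Z = map Out v" "trun ?\<Delta> q0 w v q"
              using out_table_step[of ?\<Delta> Q q0 u q Z] T(2) u(3) Q\<Delta> by blast
            moreover from this have "w \<in> L" using gen[of w] u(1) trun_iff by blast
            ultimately show ?thesis using u(2) trun_iff by blast
          next
            case 3
            then obtain u' where "table_step T' u u'" "path Q q0 u' q Z"
              using lift_table_step[OF Q(2), of u q T' Z] T(2) u(3) by blast
            moreover from this have "multi_step (tables E) u u'"
              using 3(1) by (auto simp: multi_step_def)
            then have "(multi_step (tables E))\<^sup>*\<^sup>* (start_word E) u'" using u(1) by simp
            ultimately have "mid Z" using u(2) unfolding mid_def by blast
            then show ?thesis by blast
          qed
        next
          assume "\<exists>v\<in>?M. Y = map Out v"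
          then obtain v where v: "v \<in> ?M" "Y = map Out v" by blast
          have "(c, x) \<notin> T" if "c \<in> set Y" for c x
            using Tcases that v(2) by cases (auto simp: start_def out_table_def lift_table_def)
          then have "Y = [] \<and> Z = []" using T(2) stuck by blast
          then show ?thesis using v by blast
        qed
      qed simp
      then show ?thesis using Nil_M that(2) by (auto simp: inj_map_eq_map inj_def)
    qed
    then show "v \<in> ?M" using \<open>v \<in> {w. _ w}\<close> by blast
  qed
  finally show ?thesis .
qed


section \<open>Nested substitution\<close>

text \<open>Lets \<open>gen\<close> occur under \<open>table_step\<close> in its own introduction
  rule.\<close>

lemma table_step_gen_mono [mono]:
  "(\<And>c w. P c w \<longrightarrow> P' c w) \<Longrightarrow> table_step {(c, w). P c w} u v \<longrightarrow> table_step {(c, w). P' c w} u v"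
  by (auto elim: table_step_mono)

text \<open>
  A pair \<open>(X, L)\<close> in \<open>P\<close> stands for the rules rewriting the nonterminal \<open>X\<close> to a word of \<open>L\<close>, and
  \<open>gen P c w\<close> says that the terminal word \<open>w\<close> is derivable from the symbol \<open>c\<close>.
\<close>

inductive gen :: "('n \<times> ('n + 's) list set) set \<Rightarrow> 'n + 's \<Rightarrow> ('n + 's) list \<Rightarrow> bool" for P where
  terminal: "gen P (Inr a) [Inr a]"
| rule: "(X, L) \<in> P \<Longrightarrow> t \<in> L \<Longrightarrow> table_step {(c, w). gen P c w} t w \<Longrightarrow> gen P (Inl X) w"

text \<open>
  While the system of a rule \<open>r\<close> rewrites the symbols \<open>Run r d\<close>, all symbols \<open>Idle c\<close> wait. Several
  occurrences of a nonterminal may also run simultaneously; this produces nothing new, as each of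
  them still performs a derivation of the system.
\<close>

datatype ('c, 'r, 'd) gram_symbol = Idle 'c | Run 'r 'd

text \<open>Rules are processed one at a time: \<open>start\<close> opens runs, the tables
  \<open>run r T\<close> advance them, \<open>stop r\<close> closes them, and idle symbols have a
  waiting rule in every table. If symbols of two different rules are running together, no table can
  rewrite both and the derivation is stuck.\<close>

theorem ET0L_grammar:
  fixes P :: "('n \<times> ('n + 's) list set) set"
  assumes P: "finite P" "\<And>X L. (X, L) \<in> P \<Longrightarrow> L \<in> ET0L"
  shows "{w. gen P (Inl S) (map Inr w)} \<in> ET0L"
proof -
  have "\<forall>r\<in>P. \<exists>E :: (('n + 's) + nat) et0l_system.
     is_et0l_system E \<and> terminals E \<subseteq> range Inl \<and> et0l_generated E = map Inl ` snd r"
    using P(2) by (force simp: ET0L_def)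
  then obtain E :: "_ \<Rightarrow> (('n + 's) + nat) et0l_system" where
    E: "\<And>r. r \<in> P \<Longrightarrow> is_et0l_system (E r)" "\<And>r. r \<in> P \<Longrightarrow> terminals (E r) \<subseteq> range Inl"
       "\<And>r. r \<in> P \<Longrightarrow> et0l_generated (E r) = map Inl ` snd r"
    by metis
  let ?h = "Idle \<circ> Inr :: 's \<Rightarrow> ('n + 's, 'n \<times> ('n + 's) list set, ('n + 's) + nat) gram_symbol"
  \<comment> \<open>Only finitely many symbols ever occur idle: the start symbol, the left-hand
    sides, and what the rule systems can output. The types \<open>'n\<close> and \<open>'s\<close>
    themselves may be infinite.\<close>
  define \<Gamma> where "\<Gamma> = insert (Inl S) (Inl ` fst ` P \<union> (\<Union>r\<in>P. {c. Inl c \<in> terminals (E r)}))"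
  define V where "V = Idle ` \<Gamma> \<union> (\<Union>r\<in>P. Run r ` symbols (E r))"
  define idle :: "(('n + 's, 'n \<times> ('n + 's) list set, ('n + 's) + nat) gram_symbol \<times>
      ('n + 's, 'n \<times> ('n + 's) list set, ('n + 's) + nat) gram_symbol list) set"
    where "idle = (\<lambda>c. (Idle c, [Idle c])) ` \<Gamma>"
  define start where
    "start = idle \<union> (\<lambda>r. (Idle (Inl (fst r)), map (Run r) (start_word (E r)))) ` P"
  define run where "run r T = idle \<union> (\<lambda>(c, x). (Run r c, map (Run r) x)) ` T" for r T
  \<comment> \<open>Only terminals of \<open>E r\<close> have a closing rule, so all open runs of
    \<open>r\<close> must have become terminal when \<open>stop r\<close> is applied.\<close>
  define stop where "stop r = idle \<union> (\<lambda>c. (Run r (Inl c), [Idle c])) ` {c. Inl c \<in> terminals (E r)}" for r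
  define \<T> where "\<T> = insert start (stop ` P \<union> (\<Union>r\<in>P. run r ` tables (E r)))"
  have fin: "finite {c. Inl c \<in> terminals (E r)}" if "r \<in> P" for r
    using finite_vimageI[of "terminals (E r)" Inl] E(1)[OF that] finite_subset
    by (auto simp: is_et0l_system_def vimage_def)
  have sub: "{c. Inl c \<in> terminals (E r)} \<subseteq> \<Gamma>" "Inl (fst r) \<in> \<Gamma>" if "r \<in> P" for r
    using that by (auto simp: \<Gamma>_def)
  have \<Gamma>: "finite \<Gamma>" using fin P(1) by (auto simp: \<Gamma>_def)
  have wf: "start_word (E r) \<in> lists (symbols (E r))" "terminals (E r) \<subseteq> symbols (E r)"
      "T \<in> tables (E r) \<Longrightarrow> finite T"
      "T \<in> tables (E r) \<Longrightarrow> T \<subseteq> symbols (E r) \<times> lists (symbols (E r))" if "r \<in> P" for r T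
    using E(1)[OF that] unfolding is_et0l_system_def by blast+
  have IdleV: "Idle c \<in> V" if "c \<in> \<Gamma>" for c using that by (simp add: V_def)
  have RunV: "Run r c \<in> V" if "r \<in> P" "c \<in> symbols (E r)" for r c
    using that unfolding V_def by blast
  have "{w. (multi_step \<T>)\<^sup>*\<^sup>* [Idle (Inl S)] (map ?h w)} \<in> ET0L"
  proof (rule ET0L_I[where V = V])
    show "finite V" using E(1) \<Gamma> P(1) by (auto simp: V_def is_et0l_system_def)
    show "Idle (Inl S) \<in> V" by (simp add: V_def \<Gamma>_def)
    show "finite \<T>" "\<T> \<noteq> {}" using E(1) P(1) by (auto simp: \<T>_def is_et0l_system_def)
    show "inj ?h" by (auto simp: inj_def)
    have idle: "finite idle" "idle \<subseteq> V \<times> lists V" using \<Gamma> by (auto simp: idle_def V_def)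
    fix T assume "T \<in> \<T>"
    then consider "T = start" | r where "r \<in> P" "T = stop r"
      | r T' where "r \<in> P" "T' \<in> tables (E r)" "T = run r T'" by (auto simp: \<T>_def)
    then have "finite T \<and> T \<subseteq> V \<times> lists V"
    proof cases
      case 1
      have "map (Run r) (start_word (E r)) \<in> lists V" if "r \<in> P" for r
        using wf(1)[OF that] RunV[OF that] by (auto simp: in_lists_conv_set)
      then have "start \<subseteq> V \<times> lists V" using idle(2) IdleV[OF sub(2)] unfolding start_def by blast
      moreover have "finite start" using idle(1) P(1) by (simp add: start_def)
      ultimately show ?thesis using 1 by simp
    next
      case 2
      have "Run r (Inl c) \<in> V \<and> [Idle c] \<in> lists V" if "Inl c \<in> terminals (E r)" for c
        using that RunV[OF 2(1)] wf(2)[OF 2(1)] IdleV sub(1)[OF 2(1)] by auto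
      then have "stop r \<subseteq> V \<times> lists V" using idle(2) unfolding stop_def by blast
      moreover have "finite (stop r)" using idle(1) fin[OF 2(1)] by (simp add: stop_def)
      ultimately show ?thesis using 2(2) by simp
    next
      case 3
      have "Run r c \<in> V \<and> map (Run r) x \<in> lists V" if "(c, x) \<in> T'" for c x
      proof -
        have "c \<in> symbols (E r)" "set x \<subseteq> symbols (E r)" using wf(4)[OF 3(1,2)] that by auto
        then show ?thesis using RunV[OF 3(1)] by (simp add: in_lists_conv_set subset_iff)
      qed
      then have "run r T' \<subseteq> V \<times> lists V" using idle(2) unfolding run_def by auto
      moreover have "finite (run r T')" using idle(1) wf(3)[OF 3(1,2)] by (simp add: run_def)
      ultimately show ?thesis using 3(3) by simp
    qed
    then show "finite T" "T \<subseteq> V \<times> lists V" by auto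
  qed
  also have "{w. (multi_step \<T>)\<^sup>*\<^sup>* [Idle (Inl S)] (map ?h w)} = {w. gen P (Inl S) (map Inr w)}"
  proof (intro Set.set_eqI iffI; unfold mem_Collect_eq)
    fix w assume "(multi_step \<T>)\<^sup>*\<^sup>* [Idle (Inl S)] (map ?h w)"
    then obtain \<tau> where \<tau>: "\<tau> \<in> lists \<T>" "derivs \<tau> [Idle (Inl S)] (map ?h w)"
      using multi_steps_derivs by blast
    \<comment> \<open>Induction on the sequence of tables, for idle and running symbols at once. For
      a running word, \<open>t\<close> is the word in which its run will end; the tables after that
      expand the letters of \<open>t\<close>.\<close>
    have "(\<forall>c w. derivs \<tau> [Idle c] (map ?h w) \<longrightarrow> gen P c (map Inr w)) \<and>
       (\<forall>r\<in>P. \<forall>\<beta> w. derivs \<tau> (map (Run r) \<beta>) (map ?h w) \<longrightarrow>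
          (\<exists>t. (et0l_step (E r))\<^sup>*\<^sup>* \<beta> (map Inl t) \<and> map Inl t \<in> lists (terminals (E r)) \<and>
             table_step {(c, w). gen P c w} t (map Inr w)))"
      using \<tau>(1)
    proof (induction \<tau>)
      case Nil
      show ?case
      proof (intro conjI allI ballI impI)
        fix c w assume "derivs [] [Idle c] (map ?h w)"
        then show "gen P c (map Inr w)" by (cases w) (auto intro: gen.intros)
      next
        fix r \<beta> w assume "derivs [] (map (Run r) \<beta>) (map ?h w)"
        then have "\<beta> = []" "w = []" by (cases \<beta>; cases w; auto)+
        then show "\<exists>t. (et0l_step (E r))\<^sup>*\<^sup>* \<beta> (map Inl t) \<and> map Inl t \<in> lists (terminals (E r)) \<and>
             table_step {(c, w). gen P c w} t (map Inr w)" by (intro exI[of _ "[]"]) simp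
      qed
    next
      case (Cons T \<tau>)
      then have T: "T \<in> \<T>" by simp
      note IH1 = Cons.IH[THEN conjunct1, rule_format]
      note IH2 = Cons.IH[THEN conjunct2, rule_format]
      \<comment> \<open>The letters of \<open>t\<close> are expanded simultaneously by the same
        \<open>\<tau>\<close>, yet each of them satisfies the induction hypothesis
        separately.\<close>
      have word: "table_step {(c, w). gen P c w} t (map Inr w)"
        if "derivs \<tau> (map Idle t) (map ?h w)" for t w
        using that
      proof (induction t arbitrary: w)
        case (Cons c t)
        then obtain w1 w2 where *: "map ?h w = w1 @ w2" "derivs \<tau> [Idle c] w1"
          "derivs \<tau> (map Idle t) w2" 
          using Cons.prems derivs_Cons[of \<tau> "Idle c" "map Idle t" "map ?h w"] unfolding list.map by blast
        then obtain v1 v2 where v: "w = v1 @ v2" "w1 = map ?h v1" "w2 = map ?h v2"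
          unfolding map_eq_append_conv by blast
        then have "gen P c (map Inr v1)" "table_step {(c, w). gen P c w} t (map Inr v2)"
          using IH1[of c v1] Cons.IH[of v2] * by (auto simp only:)
        then show ?case using v(1) by (auto simp: table_step_Cons)
      qed simp
      show ?case
      proof (intro conjI allI ballI impI)
        fix c w assume "derivs (T # \<tau>) [Idle c] (map ?h w)"
        then obtain x where x: "(Idle c, x) \<in> T" "derivs \<tau> x (map ?h w)"
          by (auto simp: table_step_Cons)
        then consider "x = [Idle c]"
          | r where "r \<in> P" "c = Inl (fst r)" "x = map (Run r) (start_word (E r))"
          using T by (auto simp: \<T>_def start_def stop_def run_def idle_def)
        then show "gen P c (map Inr w)"
        proof cases
          case 1
          then show ?thesis using x IH1 by simp
        next
          case 2
          then obtain t where t: "(et0l_step (E r))\<^sup>*\<^sup>* (start_word (E r)) (map Inl t)"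
            "map Inl t \<in> lists (terminals (E r))" "table_step {(c, w). gen P c w} t (map Inr w)"
            using IH2[of r "start_word (E r)" w] x(2) Cons.prems by auto
          then have "map Inl t \<in> et0l_generated (E r)" by (simp add: et0l_generated_def)
          then have "t \<in> snd r" unfolding E(3)[OF 2(1)] by (auto simp: inj_map_eq_map)
          then show ?thesis using t(3) 2 by (auto intro: gen.rule[of "fst r" "snd r"])
        qed
      next
        fix r \<beta> w assume r: "r \<in> P" and *: "derivs (T # \<tau>) (map (Run r) \<beta>) (map ?h w)"
        then obtain \<beta>' where \<beta>': "table_step T (map (Run r) \<beta>) \<beta>'" "derivs \<tau> \<beta>' (map ?h w)"
          by auto
        \<comment> \<open>Only the tables belonging to \<open>r\<close> have rules for
          \<open>Run r\<close> symbols, so any other table forces \<open>\<beta> = []\<close>, and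
          then \<open>w = []\<close>.\<close>
        consider "\<beta> = []" "w = []" | T' where "T' \<in> tables (E r)" "T = run r T'"
          | "T = stop r"
        proof -
          note result = that
          have empty: thesis if "\<And>c x. (Run r c, x) \<notin> T"
          proof (rule result(1))
            show "\<beta> = []" using \<beta>'(1) that by (cases \<beta>) (auto simp: table_step_Cons)
            then show "w = []" using * by simp
          qed
          consider "T = start" | r' where "T = stop r'" | r' T' where "T' \<in> tables (E r')" "T = run r' T'"
            using T by (auto simp: \<T>_def)
          then show thesis
          proof cases
            case 1
            then show thesis by (intro empty) (auto simp: start_def idle_def)
          next
            case 2
            then show thesis
              using result(3) by (cases "r' = r") (auto intro!: empty simp: stop_def idle_def)
          next
            case 3
            then show thesis
              using result(2) by (cases "r' = r") (auto intro!: empty simp: run_def idle_def)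
          qed
        qed
        then show "\<exists>t. (et0l_step (E r))\<^sup>*\<^sup>* \<beta> (map Inl t) \<and> map Inl t \<in> lists (terminals (E r)) \<and>
             table_step {(c, w). gen P c w} t (map Inr w)"
        proof cases
          case 1
          then show ?thesis by (intro exI[of _ "[]"]) simp
        next
          case 2
          have "\<exists>x. \<beta>' = map (Run r) x \<and> table_step T' \<beta> x"
            using \<beta>'(1)
          proof (induction \<beta> arbitrary: \<beta>')
            case (Cons c \<beta>)
            then obtain x v where "(c, x) \<in> T'" "\<beta>' = map (Run r) x @ v"
              "table_step T (map (Run r) \<beta>) v"
              by (auto simp: table_step_Cons 2 run_def idle_def)
            moreover then obtain y where "v = map (Run r) y" "table_step T' \<beta> y"
              using Cons.IH by blast
            ultimately show ?case by (intro exI[of _ "x @ y"]) (simp add: table_step_ConsI)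
          qed simp
          then obtain x where x: "\<beta>' = map (Run r) x" "et0l_step (E r) \<beta> x"
            using 2 by (auto simp: et0l_step_def)
          then show ?thesis
            using IH2[OF r, of x w] \<beta>'(2) by (blast intro: converse_rtranclp_into_rtranclp)
        next
          case 3
          have "\<exists>t. \<beta> = map Inl t \<and> \<beta>' = map Idle t \<and> map Inl t \<in> lists (terminals (E r))"
            using \<beta>'(1)
          proof (induction \<beta> arbitrary: \<beta>')
            case (Cons c \<beta>)
            then obtain d v where "c = Inl d" "Inl d \<in> terminals (E r)" "\<beta>' = Idle d # v"
              "table_step T (map (Run r) \<beta>) v"
              by (auto simp: table_step_Cons 3 stop_def idle_def)
            moreover then obtain t where "\<beta> = map Inl t" "v = map Idle t"
              "map Inl t \<in> lists (terminals (E r))"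
              using Cons.IH by blast
            ultimately show ?case by (intro exI[of _ "d # t"]) auto
          qed simp
          then show ?thesis using word \<beta>'(2) by blast
        qed
      qed
    qed
    then show "gen P (Inl S) (map Inr w)" using \<tau>(2) by blast
  next
    fix w assume w: "gen P (Inl S) (map Inr w)"
    have idle_step: "table_step T (map Idle x) (map Idle x)" if "T \<in> \<T>" "x \<in> lists \<Gamma>" for T x
    proof -
      have "table_step idle (map Idle x) (map Idle x)"
        using that(2) by (induction x) (auto simp: table_step_Cons idle_def intro!: image_eqI)
      then show ?thesis
        by (rule table_step_mono) (use that in \<open>auto simp: \<T>_def start_def stop_def run_def\<close>)
    qed
    \<comment> \<open>In this direction the simulation is sequential: one occurrence is expanded
      while the idle symbols around it wait.\<close>
    have ctx: "(multi_step \<T>)\<^sup>*\<^sup>* (map Idle x @ u @ map Idle y) (map Idle x @ v @ map Idle y)"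
      if "(multi_step \<T>)\<^sup>*\<^sup>* u v" "x \<in> lists \<Gamma>" "y \<in> lists \<Gamma>" for u v x y
      using that(1)
    proof (induction rule: rtranclp_induct)
      case (step v v')
      then have "multi_step \<T> (map Idle x @ v @ map Idle y) (map Idle x @ v' @ map Idle y)"
        using idle_step that(2,3) unfolding multi_step_def table_step_append by blast
      with step show ?case by simp
    qed simp
    \<comment> \<open>The first conjunct ensures that the result is able to wait later.
      \<open>gen\<close> also relates terminals outside \<open>\<Gamma>\<close> to themselves, hence
      the premise \<open>c \<in> \<Gamma>\<close> wherever \<open>Q\<close> is claimed.\<close>
    define Q where "Q c w \<longleftrightarrow> w \<in> lists \<Gamma> \<and> (multi_step \<T>)\<^sup>*\<^sup>* [Idle c] (map Idle w)" for c w
    have word: "w \<in> lists \<Gamma> \<and> (multi_step \<T>)\<^sup>*\<^sup>* (map Idle t) (map Idle w)"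
      if "table_step {(c, w). c \<in> \<Gamma> \<longrightarrow> Q c w} t w" "t \<in> lists \<Gamma>" for t w
      using that
    proof (induction t arbitrary: w)
      case (Cons c t)
      then obtain w1 w2 where *: "Q c w1" "w = w1 @ w2" "w2 \<in> lists \<Gamma>"
         "(multi_step \<T>)\<^sup>*\<^sup>* (map Idle t) (map Idle w2)"
        by (auto simp: table_step_Cons)
      have "(multi_step \<T>)\<^sup>*\<^sup>* (map Idle (c # t)) (map Idle w1 @ map Idle t)"
        using ctx[of "[Idle c]" "map Idle w1" "[]" t] * Cons.prems by (auto simp: Q_def)
      also have "(multi_step \<T>)\<^sup>*\<^sup>* \<dots> (map Idle w1 @ map Idle w2)"
        using ctx[OF *(4), of w1 "[]"] * by (auto simp: Q_def)
      finally show ?case using * by (auto simp: Q_def)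
    qed simp
    have "c \<in> \<Gamma> \<longrightarrow> Q c w" if "gen P c w" for c w
      using that
    proof induction
      case (rule X L t w)
      let ?r = "(X, L)"
      have "map Inl t \<in> et0l_generated (E ?r)" using E(3)[OF rule(1)] rule(2) by simp
      then have t: "map Inl t \<in> lists (terminals (E ?r))"
        "(et0l_step (E ?r))\<^sup>*\<^sup>* (start_word (E ?r)) (map Inl t)" by (auto simp: et0l_generated_def)
      have t\<Gamma>: "t \<in> lists \<Gamma>" using t(1) sub(1)[OF rule(1)] by (auto simp: in_lists_conv_set)
      have w: "w \<in> lists \<Gamma> \<and> (multi_step \<T>)\<^sup>*\<^sup>* (map Idle t) (map Idle w)"
      proof (rule word[OF _ t\<Gamma>])
        show "table_step {(c, w). c \<in> \<Gamma> \<longrightarrow> Q c w} t w"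
          by (rule table_step_mono[OF rule(3)]) auto
      qed
      have "multi_step \<T> [Idle (Inl X)] (map (Run ?r) (start_word (E ?r)))"
      proof -
        have "(Idle (Inl X), map (Run ?r) (start_word (E ?r))) \<in> start"
          unfolding start_def by (intro UnI2 image_eqI[OF _ rule(1)]) simp
        then have "table_step start [Idle (Inl X)] (map (Run ?r) (start_word (E ?r)))"
          by (simp add: table_step_Cons)
        then show ?thesis unfolding multi_step_def \<T>_def by blast
      qed
      also have "(multi_step \<T>)\<^sup>*\<^sup>* \<dots> (map (Run ?r) (map Inl t))"
        using t(2)
      proof (induction rule: rtranclp_induct)
        case (step y z)
        then obtain T where T: "T \<in> tables (E ?r)" "table_step T y z" by (auto simp: et0l_step_def)
        from T(2) have "table_step (run ?r T) (map (Run ?r) y) (map (Run ?r) z)"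
        proof (induction y arbitrary: z)
          case (Cons c y)
          then obtain x v where "(c, x) \<in> T" "z = x @ v" "table_step T y v"
            by (auto simp: table_step_Cons)
          moreover then have "(Run ?r c, map (Run ?r) x) \<in> run ?r T"
            by (force simp: run_def)
          ultimately show ?case using Cons.IH[of v] by (simp add: table_step_ConsI)
        qed simp
        then have "multi_step \<T> (map (Run ?r) y) (map (Run ?r) z)"
          using T(1) rule(1) unfolding multi_step_def \<T>_def by blast
        with step show ?case by simp
      qed simp
      also have "multi_step \<T> (map (Run ?r) (map Inl t)) (map Idle t)"
      proof -
        have "table_step (stop ?r) (map (Run ?r) (map Inl t)) (map Idle t)"
          using t(1) by (induction t) (auto simp: table_step_Cons stop_def)
        then show ?thesis using rule(1) unfolding multi_step_def \<T>_def by blast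
      qed
      also note w[THEN conjunct2]
      finally show ?case using w by (simp add: Q_def)
    qed (auto simp: Q_def)
    then have "Q (Inl S) (map Inr w)" using w by (auto simp: \<Gamma>_def)
    then show "(multi_step \<T>)\<^sup>*\<^sup>* [Idle (Inl S)] (map ?h w)" by (simp add: Q_def)
  qed
  finally show ?thesis .
qed


section \<open>Regular languages\<close>

text \<open>The automata below have pairs or constructor terms as states; an injection of the finite
  state set into the natural numbers brings them into the required form.\<close>

lemma regular_languageI:
  fixes Q :: "'q set"
  assumes "finite A" "finite Q" "q0 \<in> Q" and \<delta>: "\<And>q a. q \<in> Q \<Longrightarrow> a \<in> A \<Longrightarrow> \<delta> q a \<in> Q"
  shows "regular_language A {w \<in> lists A. foldl \<delta> q0 w \<in> F}"
proof -
  obtain f :: "'q \<Rightarrow> nat" where f: "inj_on f Q"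
    using finite_imp_inj_to_nat_seg[OF assms(2)] by blast
  define \<delta>' where "\<delta>' n a = f (\<delta> (inv_into Q f n) a)" for n a
  have run: "foldl \<delta> q w \<in> Q \<and> foldl \<delta>' (f q) w = f (foldl \<delta> q w)" if "w \<in> lists A" "q \<in> Q" for w q
    using that by (induction w arbitrary: q) (simp_all add: \<delta>'_def f \<delta>)
  have "foldl \<delta>' (f q0) w \<in> f ` (F \<inter> Q) \<longleftrightarrow> foldl \<delta> q0 w \<in> F" if "w \<in> lists A" for w
    using run[OF that assms(3)] inj_on_image_mem_iff[OF f] by auto
  then have "{w \<in> lists A. foldl \<delta> q0 w \<in> F} = {w \<in> lists A. foldl \<delta>' (f q0) w \<in> f ` (F \<inter> Q)}"
    by blast
  moreover have "\<forall>q\<in>f ` Q. \<forall>a\<in>A. \<delta>' q a \<in> f ` Q" using f \<delta> by (auto simp: \<delta>'_def)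
  moreover have "finite (f ` Q)" "f q0 \<in> f ` Q" "f ` (F \<inter> Q) \<subseteq> f ` Q" using assms by auto
  ultimately show ?thesis unfolding regular_language_def using assms(1) by blast
qed

text \<open>Serves to delete the representative of the identity, which is not a syllable. The
  automaton additionally stores a bounded prefix of its input.\<close>

lemma regular_language_remove:
  assumes "regular_language A L"
  shows "regular_language A (L - {e})"
proof -
  from assms obtain Q :: "nat set" and q0 \<delta> F where
    *: "finite A" "finite Q" "q0 \<in> Q" "\<forall>q\<in>Q. \<forall>a\<in>A. \<delta> q a \<in> Q" "L = {w \<in> lists A. foldl \<delta> q0 w \<in> F}"
    unfolding regular_language_def by blast
  \<comment> \<open>One letter more than \<open>e\<close> has: a shorter prefix could not tell
    \<open>e\<close> from its proper extensions.\<close>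
  let ?n = "Suc (length e)"
  let ?W = "{w. set w \<subseteq> A \<and> length w \<le> ?n}"
  define \<epsilon> where "\<epsilon> = (\<lambda>(q, w) a. (\<delta> q a, take ?n (w @ [a])))"
  have run: "foldl \<epsilon> (q, []) w = (foldl \<delta> q w, take ?n w)" for q w
  proof (induction w rule: rev_induct)
    case (snoc a w)
    have "take n (take n w @ [a]) = take n (w @ [a])" for n
      by (cases "n \<le> length w") auto
    moreover have "foldl \<epsilon> (q, []) (w @ [a]) = (\<delta> (foldl \<delta> q w) a, take ?n (take ?n w @ [a]))"
      by (simp only: foldl_append foldl.simps snoc.IH) (simp only: \<epsilon>_def prod.case)
    ultimately show ?case by (simp only: foldl_append foldl.simps)
  qed simp
  have e: "take ?n w = e \<longleftrightarrow> w = e" for w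
  proof
    assume t: "take ?n w = e"
    then have "length (take ?n w) = length e" by simp
    then have "length w = length e" by (simp add: min_def split: if_splits)
    with t show "w = e" by simp
  qed simp
  have "regular_language A {w \<in> lists A. foldl \<epsilon> (q0, []) w \<in> {(q, w). q \<in> F \<and> w \<noteq> e}}"
  proof (rule regular_languageI)
    show "finite A" by fact
    show "finite (Q \<times> ?W)" using * finite_lists_length_le by blast
    show "(q0, []) \<in> Q \<times> ?W" using * by simp
    show "\<epsilon> q a \<in> Q \<times> ?W" if "q \<in> Q \<times> ?W" "a \<in> A" for q a
    proof -
      from that(1) obtain p w where q: "q = (p, w)" "p \<in> Q" "set w \<subseteq> A" by blast
      have "set (take ?n (w @ [a])) \<subseteq> A" using set_take_subset[of ?n "w @ [a]"] q(3) that(2) by auto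
      moreover have "\<delta> p a \<in> Q" using * q(2) that(2) by blast
      moreover have "\<epsilon> q a = (\<delta> p a, take ?n (w @ [a]))" by (simp only: q(1) \<epsilon>_def prod.case)
      moreover have "length (take ?n (w @ [a])) \<le> ?n" by simp
      ultimately show ?thesis by (simp only: mem_Times_iff fst_conv snd_conv mem_Collect_eq)
    qed
  qed
  also have "{w \<in> lists A. foldl \<epsilon> (q0, []) w \<in> {(q, w). q \<in> F \<and> w \<noteq> e}} = L - {e}"
    by (auto simp: run * e)
  finally show ?thesis .
qed

section \<open>Normal forms of the free product\<close>

text \<open>Doubling makes the two alphabets disjoint within the natural numbers, so that a letter
  reveals its factor by its parity.\<close>

fun syllable_word :: "('a \<Rightarrow> nat list) \<Rightarrow> ('b \<Rightarrow> nat list) \<Rightarrow> 'a + 'b \<Rightarrow> nat list" where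
  "syllable_word r1 r2 (Inl g) = map (\<lambda>n. 2 * n) (r1 g)"
| "syllable_word r1 r2 (Inr h) = map (\<lambda>n. 2 * n + 1) (r2 h)"

definition nf :: "('a \<Rightarrow> nat list) \<Rightarrow> ('b \<Rightarrow> nat list) \<Rightarrow> ('a + 'b) list \<Rightarrow> nat list" where
  "nf r1 r2 w = concat (map (syllable_word r1 r2) w)"

lemma nf_simps [simp]:
  "nf r1 r2 [] = []" "nf r1 r2 (x # w) = syllable_word r1 r2 x @ nf r1 r2 w"
  "nf r1 r2 (v @ w) = nf r1 r2 v @ nf r1 r2 w"
  by (simp_all add: nf_def)

section \<open>Automaton for alternating sequences of syllables\<close>

datatype fp_state = Init | Left nat | Right nat | Fail

text \<open>As syllables are nonempty and alternate, their boundaries are exactly the changes of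
  parity. At such a change the automaton requires the finished syllable to be accepted and starts
  the other component afresh; \<open>Fail\<close> is the sink for rejected syllables.\<close>

lemma regular_language_nf:
  fixes r1 :: "'a \<Rightarrow> nat list" and r2 :: "'b \<Rightarrow> nat list"
  assumes A: "regular_language A (r1 ` C)" "[] \<notin> r1 ` C" and B: "regular_language B (r2 ` D)" "[] \<notin> r2 ` D"
  shows "regular_language ((\<lambda>n. 2 * n) ` A \<union> (\<lambda>n. 2 * n + 1) ` B)
     (nf r1 r2 ` {w \<in> lists (C <+> D). successively (\<lambda>x y. isl x \<noteq> isl y) w})"
    (is "regular_language ?A (_ ` ?R)")
proof -
  obtain Q1 :: "nat set" and q1 \<delta>1 F1 where
    1: "finite A" "finite Q1" "q1 \<in> Q1" "\<forall>q\<in>Q1. \<forall>a\<in>A. \<delta>1 q a \<in> Q1"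
       "r1 ` C = {w \<in> lists A. foldl \<delta>1 q1 w \<in> F1}"
    using A unfolding regular_language_def by blast
  obtain Q2 :: "nat set" and q2 \<delta>2 F2 where
    2: "finite B" "finite Q2" "q2 \<in> Q2" "\<forall>q\<in>Q2. \<forall>a\<in>B. \<delta>2 q a \<in> Q2"
       "r2 ` D = {w \<in> lists B. foldl \<delta>2 q2 w \<in> F2}"
    using B unfolding regular_language_def by blast
  define \<delta>L where "\<delta>L s a = (case s of Init \<Rightarrow> Left (\<delta>1 q1 a) | Left q \<Rightarrow> Left (\<delta>1 q a)
     | Right q \<Rightarrow> if q \<in> F2 then Left (\<delta>1 q1 a) else Fail | Fail \<Rightarrow> Fail)" for s a
  define \<delta>R where "\<delta>R s a = (case s of Init \<Rightarrow> Right (\<delta>2 q2 a) | Right q \<Rightarrow> Right (\<delta>2 q a)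
     | Left q \<Rightarrow> if q \<in> F1 then Right (\<delta>2 q2 a) else Fail | Fail \<Rightarrow> Fail)" for s a
  define \<delta> where "\<delta> s n = (if even n then \<delta>L s (n div 2) else \<delta>R s (n div 2))" for s and n :: nat
  let ?Q = "insert Init (insert Fail (Left ` Q1 \<union> Right ` Q2))"
  \<comment> \<open>\<open>Init\<close> accepts because the empty sequence of syllables has the
    empty normal form.\<close>
  let ?F = "insert Init (Left ` F1 \<union> Right ` F2)"
  have R_snoc: "w @ [x] \<in> ?R \<longleftrightarrow> w \<in> ?R \<and> x \<in> C <+> D \<and> (w = [] \<or> isl (last w) \<noteq> isl x)" for w x
    by (auto simp: successively_append_iff)
  have "regular_language ?A {w \<in> lists ?A. foldl \<delta> Init w \<in> ?F}"
  proof (rule regular_languageI)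
    show "finite ?A" "finite ?Q" "Init \<in> ?Q" using 1 2 by auto
    show "\<delta> s a \<in> ?Q" if "s \<in> ?Q" "a \<in> ?A" for s a
      using that 1(3,4) 2(3,4) by (auto simp: \<delta>_def \<delta>L_def \<delta>R_def)
  qed
  also have "{w \<in> lists ?A. foldl \<delta> Init w \<in> ?F} = nf r1 r2 ` ?R"
  proof
    \<comment> \<open>In state \<open>Left q\<close> the input consists of complete syllables
      \<open>r\<close>, the last of them not from the first factor, and a part \<open>v\<close> of
      the current syllable, on which the first automaton has reached \<open>q\<close>;
      \<open>Right q\<close> is symmetric.\<close>
    define Inv where "Inv s w = (case s of Init \<Rightarrow> w = []
      | Left q \<Rightarrow> (\<exists>r v. r \<in> ?R \<and> (r = [] \<or> \<not> isl (last r)) \<and> v \<in> lists A \<and>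
                     w = nf r1 r2 r @ map (\<lambda>n. 2 * n) v \<and> q = foldl \<delta>1 q1 v)
      | Right q \<Rightarrow> (\<exists>r v. r \<in> ?R \<and> (r = [] \<or> isl (last r)) \<and> v \<in> lists B \<and>
                     w = nf r1 r2 r @ map (\<lambda>n. 2 * n + 1) v \<and> q = foldl \<delta>2 q2 v)
      | Fail \<Rightarrow> True)" for s w
    have acc1: "\<exists>r'\<in>?R. isl (last r') \<and> r' \<noteq> [] \<and> w = nf r1 r2 r'" if "Inv (Left q) w" "q \<in> F1" for q w
    proof -
      from that obtain r v where r: "r \<in> ?R" "r = [] \<or> \<not> isl (last r)" "v \<in> lists A"
        "w = nf r1 r2 r @ map (\<lambda>n. 2 * n) v" "q = foldl \<delta>1 q1 v" by (auto simp: Inv_def)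
      then have "v \<in> r1 ` C" using that(2) unfolding 1(5) by simp
      then obtain g where "g \<in> C" "v = r1 g" by auto
      then show ?thesis using r R_snoc[of r "Inl g"] by (intro bexI[of _ "r @ [Inl g]"]) auto
    qed
    have acc2: "\<exists>r'\<in>?R. \<not> isl (last r') \<and> r' \<noteq> [] \<and> w = nf r1 r2 r'" if "Inv (Right q) w" "q \<in> F2" for q w
    proof -
      from that obtain r v where r: "r \<in> ?R" "r = [] \<or> isl (last r)" "v \<in> lists B"
        "w = nf r1 r2 r @ map (\<lambda>n. 2 * n + 1) v" "q = foldl \<delta>2 q2 v" by (auto simp: Inv_def)
      then have "v \<in> r2 ` D" using that(2) unfolding 2(5) by simp
      then obtain g where "g \<in> D" "v = r2 g" by auto
      then show ?thesis using r R_snoc[of r "Inr g"] by (intro bexI[of _ "r @ [Inr g]"]) auto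
    qed
    have Left_I: "Inv (Left (foldl \<delta>1 q1 v)) (nf r1 r2 r @ map (\<lambda>n. 2 * n) v)"
      if "r \<in> ?R" "r = [] \<or> \<not> isl (last r)" "v \<in> lists A" for r v
      unfolding Inv_def fp_state.case using that by blast
    have Right_I: "Inv (Right (foldl \<delta>2 q2 v)) (nf r1 r2 r @ map (\<lambda>n. 2 * n + 1) v)"
      if "r \<in> ?R" "r = [] \<or> isl (last r)" "v \<in> lists B" for r v
      unfolding Inv_def fp_state.case using that by blast
    have Inv_run: "Inv (foldl \<delta> Init w) w" if "w \<in> lists ?A" for w
      using that
    proof (induction w rule: rev_induct)
      case Nil
      show ?case by (simp add: Inv_def)
    next
      case (snoc n w)
      let ?s = "foldl \<delta> Init w"
      have IH: "Inv ?s w" and n: "n \<in> ?A" using snoc by auto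
      from n show ?case
      proof
        assume "n \<in> (\<lambda>n. 2 * n) ` A"
        then obtain a where a: "a \<in> A" "n = 2 * a" by auto
        have "Inv (\<delta>L ?s a) (w @ [n])"
        proof (cases ?s)
          case Init
          then show ?thesis using IH Left_I[of "[]" "[a]"] a by (simp add: \<delta>L_def Inv_def[of Init])
        next
          case (Left q)
          then obtain r v where r: "r \<in> ?R" "r = [] \<or> \<not> isl (last r)" "v \<in> lists A"
            "w = nf r1 r2 r @ map (\<lambda>n. 2 * n) v" "q = foldl \<delta>1 q1 v" using IH by (auto simp: Inv_def)
          then show ?thesis using Left_I[of r "v @ [a]"] a Left by (simp add: \<delta>L_def)
        next
          case (Right q)
          show ?thesis
          proof (cases "q \<in> F2")
            case True
            then obtain r where "r \<in> ?R" "\<not> isl (last r)" "w = nf r1 r2 r"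
              using acc2[of q w] IH Right by auto
            then show ?thesis using Left_I[of r "[a]"] a Right True by (simp add: \<delta>L_def)
          qed (simp add: \<delta>L_def Inv_def Right)
        qed (simp add: \<delta>L_def Inv_def)
        moreover have "foldl \<delta> Init (w @ [n]) = \<delta>L ?s a" using a by (simp add: \<delta>_def[of ?s])
        ultimately show ?thesis by simp
      next
        assume "n \<in> (\<lambda>n. 2 * n + 1) ` B"
        then obtain a where a: "a \<in> B" "n = 2 * a + 1" by auto
        have "Inv (\<delta>R ?s a) (w @ [n])"
        proof (cases ?s)
          case Init
          then show ?thesis using IH Right_I[of "[]" "[a]"] a by (simp add: \<delta>R_def Inv_def[of Init])
        next
          case (Right q)
          then obtain r v where r: "r \<in> ?R" "r = [] \<or> isl (last r)" "v \<in> lists B"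
            "w = nf r1 r2 r @ map (\<lambda>n. 2 * n + 1) v" "q = foldl \<delta>2 q2 v" using IH by (auto simp: Inv_def)
          then show ?thesis using Right_I[of r "v @ [a]"] a Right by (simp add: \<delta>R_def)
        next
          case (Left q)
          show ?thesis
          proof (cases "q \<in> F1")
            case True
            then obtain r where "r \<in> ?R" "isl (last r)" "w = nf r1 r2 r"
              using acc1[of q w] IH Left by auto
            then show ?thesis using Right_I[of r "[a]"] a Left True by (simp add: \<delta>R_def)
          qed (simp add: \<delta>R_def Inv_def Left)
        qed (simp add: \<delta>R_def Inv_def)
        moreover have "foldl \<delta> Init (w @ [n]) = \<delta>R ?s a" using a by (simp add: \<delta>_def[of ?s])
        ultimately show ?thesis by simp
      qed
    qed
    show "{w \<in> lists ?A. foldl \<delta> Init w \<in> ?F} \<subseteq> nf r1 r2 ` ?R"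
    proof
      fix w assume w: "w \<in> {w \<in> lists ?A. foldl \<delta> Init w \<in> ?F}"
      then have I: "Inv (foldl \<delta> Init w) w" using Inv_run by simp
      from w consider "foldl \<delta> Init w = Init" | q where "q \<in> F1" "foldl \<delta> Init w = Left q"
        | q where "q \<in> F2" "foldl \<delta> Init w = Right q" by auto
      then show "w \<in> nf r1 r2 ` ?R"
      proof cases
        case 1
        then show ?thesis using I by (auto simp: Inv_def intro!: image_eqI[of _ _ "[]"])
      next
        case 2
        then show ?thesis using I acc1[of q w] by auto
      next
        case 3
        then show ?thesis using I acc2[of q w] by auto
      qed
    qed
    have foldL: "foldl \<delta> (Left q) (map (\<lambda>n. 2 * n) v) = Left (foldl \<delta>1 q v)" for q v
      by (induction v arbitrary: q) (simp_all add: \<delta>_def \<delta>L_def)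
    have foldR: "foldl \<delta> (Right q) (map (\<lambda>n. 2 * n + 1) v) = Right (foldl \<delta>2 q v)" for q v
      by (induction v arbitrary: q) (simp_all add: \<delta>_def \<delta>R_def)
    show "nf r1 r2 ` ?R \<subseteq> {w \<in> lists ?A. foldl \<delta> Init w \<in> ?F}"
    proof (rule image_subsetI)
      fix r assume "r \<in> ?R"
      then have "nf r1 r2 r \<in> lists ?A \<and>
        (if r = [] then foldl \<delta> Init (nf r1 r2 r) = Init
         else foldl \<delta> Init (nf r1 r2 r) \<in> (if isl (last r) then Left ` F1 else Right ` F2))"
      proof (induction r rule: rev_induct)
        case (snoc x r)
        let ?s = "foldl \<delta> Init (nf r1 r2 r)"
        have r: "r \<in> ?R" "x \<in> C <+> D" "r = [] \<or> isl (last r) \<noteq> isl x" using snoc.prems[unfolded R_snoc] by iprover+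
        then have IH: "nf r1 r2 r \<in> lists ?A"
          "?s = Init \<and> r = [] \<or> r \<noteq> [] \<and> ?s \<in> (if isl (last r) then Left ` F1 else Right ` F2)"
          using snoc.IH by (auto split: if_splits)
        from r(2) show ?case
        proof (elim PlusE)
          fix g assume g: "g \<in> C" "x = Inl g"
          then have "r1 g \<in> r1 ` C" by simp
          then have w: "r1 g \<in> lists A" "foldl \<delta>1 q1 (r1 g) \<in> F1" "r1 g \<noteq> []" using A(2) unfolding 1(5) by auto
          have "?s = Init \<or> ?s \<in> Right ` F2" using IH(2) r(3) g by auto
          then have "foldl \<delta> ?s (map (\<lambda>n. 2 * n) (r1 g)) = Left (foldl \<delta>1 q1 (r1 g))"
            using w(3) foldL by (cases "r1 g") (auto simp: \<delta>_def \<delta>L_def)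
          then show ?thesis using w g IH by auto
        next
          fix g assume g: "g \<in> D" "x = Inr g"
          then have "r2 g \<in> r2 ` D" by simp
          then have w: "r2 g \<in> lists B" "foldl \<delta>2 q2 (r2 g) \<in> F2" "r2 g \<noteq> []" using B(2) unfolding 2(5) by auto
          have "?s = Init \<or> ?s \<in> Left ` F1" using IH(2) r(3) g by auto
          then have "foldl \<delta> ?s (map (\<lambda>n. 2 * n + 1) (r2 g)) = Right (foldl \<delta>2 q2 (r2 g))"
            using w(3) foldR by (cases "r2 g") (auto simp: \<delta>_def \<delta>R_def)
          then show ?thesis using w g IH by auto
        qed
      qed simp
      then show "nf r1 r2 r \<in> {w \<in> lists ?A. foldl \<delta> Init w \<in> ?F}"
        by (auto split: if_splits)
    qed
  qed
  finally show ?thesis .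
qed


section \<open>Closure properties\<close>

lemma ET0L_singleton: "{w} \<in> ET0L"
proof -
  let ?T = "{{(None, map Some w)}}"
  have reach: "u = [None] \<or> u = map Some w" if "(multi_step ?T)\<^sup>*\<^sup>* [None] u" for u
    using that
  proof (induction rule: rtranclp_induct)
    case (step y z)
    then show ?case by (cases w) (auto simp: multi_step_def table_step_Cons)
  qed simp
  have "multi_step ?T [None] (map Some w)" by (simp add: multi_step_def table_step_Cons)
  then have "(multi_step ?T)\<^sup>*\<^sup>* [None] (map Some w)" by simp
  then have "{u. (multi_step ?T)\<^sup>*\<^sup>* [None] (map Some u)} = {w}"
    using reach[of "map Some _"] by (fastforce simp: inj_map_eq_map Cons_eq_map_conv map_eq_Cons_conv)
  moreover have "{u. (multi_step ?T)\<^sup>*\<^sup>* [None] (map Some u)} \<in> ET0L"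
    by (rule ET0L_I[where V = "insert None (Some ` set w)"]) (auto simp: inj_def)
  ultimately show ?thesis by simp
qed

text \<open>A homomorphism is a transducer with one state; restricting it to \<open>\<Sigma>\<close>
  keeps the set of transitions finite.\<close>

lemma ET0L_hom:
  assumes "L \<in> ET0L" "L \<subseteq> lists \<Sigma>" "finite \<Sigma>"
  shows "(\<lambda>w. concat (map h w)) ` L \<in> ET0L"
proof -
  let ?\<Delta> = "(\<lambda>a. ((), a, h a, ())) ` \<Sigma>"
  have *: "trun ?\<Delta> () w v () \<longleftrightarrow> w \<in> lists \<Sigma> \<and> v = concat (map h w)" for w v
    by (induction w arbitrary: v) auto
  have "{v. \<exists>w\<in>L. \<exists>q\<in>{()}. trun ?\<Delta> () w v q} \<in> ET0L"
    using assms by (intro ET0L_transduce) auto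
  also have "{v. \<exists>w\<in>L. \<exists>q\<in>{()}. trun ?\<Delta> () w v q} = (\<lambda>w. concat (map h w)) ` L"
    using assms(2) by (auto simp: *)
  finally show ?thesis .
qed

section \<open>Table words and their regular filter\<close>

definition table_word :: "'a list \<Rightarrow> 'a list \<Rightarrow> 'a list \<Rightarrow> 'a table_symbol list" where
  "table_word u v w = map Letter u @ [Hash1] @ map Letter v @ [Hash2] @ map Letter (rev w)"

lemma mult_table_eq:
  "mult_table G \<pi> R = {table_word u v w | u v w. u \<in> R \<and> v \<in> R \<and> w \<in> R \<and> \<pi> u \<otimes>\<^bsub>G\<^esub> \<pi> v = \<pi> w}"
  by (simp add: mult_table_def table_word_def)

lemma map_Letter_eq_iff:
  "map Letter u @ Hash1 # x = map Letter u' @ Hash1 # x' \<longleftrightarrow> u = u' \<and> x = x'"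
  "map Letter u @ Hash2 # x = map Letter u' @ Hash2 # x' \<longleftrightarrow> u = u' \<and> x = x'"
proof -
  show "map Letter u @ Hash1 # x = map Letter u' @ Hash1 # x' \<longleftrightarrow> u = u' \<and> x = x'"
  proof (induction u arbitrary: u')
    case Nil then show ?case by (cases u') auto
  next
    case (Cons a u) then show ?case by (cases u') auto
  qed
  show "map Letter u @ Hash2 # x = map Letter u' @ Hash2 # x' \<longleftrightarrow> u = u' \<and> x = x'"
  proof (induction u arbitrary: u')
    case Nil then show ?case by (cases u') auto
  next
    case (Cons a u) then show ?case by (cases u') auto
  qed
qed

lemma table_word_eq_iff: "table_word u v w = table_word u' v' w' \<longleftrightarrow> u = u' \<and> v = v' \<and> w = w'"
  by (auto simp: table_word_def map_Letter_eq_iff inj_map_eq_map inj_def)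

text \<open>A transducer that copies its input realises the intersection. The first component of a
  state tells which of the three words is being read.\<close>

lemma ET0L_Int_table_words:
  fixes A :: "'a set"
  assumes L: "L \<in> ET0L" and R: "regular_language A R"
  shows "L \<inter> {table_word u v w | u v w. u \<in> R \<and> v \<in> R \<and> w \<in> R} \<in> ET0L"
proof -
  from R obtain Q :: "nat set" and q0 \<delta> F where
    *: "finite A" "finite Q" "q0 \<in> Q" "F \<subseteq> Q" "\<And>q a. q \<in> Q \<Longrightarrow> a \<in> A \<Longrightarrow> \<delta> q a \<in> Q"
       "R = {w \<in> lists A. foldl \<delta> q0 w \<in> F}"
    unfolding regular_language_def by blast
  \<comment> \<open>The third word is written backwards, so after \<open>Hash2\<close> the automaton
    runs in reverse: it guesses an accepting state \<open>p\<close>, moves from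
    \<open>\<delta> q a\<close> to \<open>q\<close>, and must arrive at \<open>q0\<close>.\<close>
  define \<Delta> :: "((nat \<times> nat) \<times> 'a table_symbol \<times> 'a table_symbol list \<times> nat \<times> nat) set"
    where "\<Delta> = (\<lambda>(q, a). ((0 :: nat, q), Letter a, [Letter a], (0, \<delta> q a))) ` (Q \<times> A)
    \<union> (\<lambda>q. ((0, q), Hash1, [Hash1], (1, q0))) ` F
    \<union> (\<lambda>(q, a). ((1, q), Letter a, [Letter a], (1, \<delta> q a))) ` (Q \<times> A)
    \<union> (\<lambda>(q, p). ((1, q), Hash2, [Hash2], (2, p))) ` (F \<times> F)
    \<union> (\<lambda>(q, a). ((2, \<delta> q a), Letter a, [Letter a], (2, q))) ` (Q \<times> A)"
  have finite_\<Delta>: "finite \<Delta>" using * finite_subset[OF *(4,2)] by (simp add: \<Delta>_def)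
  have \<Delta>2: "((2, p), c, x, s) \<in> \<Delta> \<longleftrightarrow>
      (\<exists>a\<in>A. \<exists>q\<in>Q. c = Letter a \<and> \<delta> q a = p \<and> x = [Letter a] \<and> s = (2, q))" for p c x s
    by (auto simp: \<Delta>_def)
  have \<Delta>1: "((1, p), c, x, s) \<in> \<Delta> \<longleftrightarrow>
      (\<exists>a\<in>A. p \<in> Q \<and> c = Letter a \<and> x = [Letter a] \<and> s = (1, \<delta> p a)) \<or>
      (p \<in> F \<and> c = Hash2 \<and> x = [Hash2] \<and> (\<exists>q\<in>F. s = (2, q)))" for p c x s
    by (auto simp: \<Delta>_def)
  have \<Delta>0: "((0, p), c, x, s) \<in> \<Delta> \<longleftrightarrow>
      (\<exists>a\<in>A. p \<in> Q \<and> c = Letter a \<and> x = [Letter a] \<and> s = (0, \<delta> p a)) \<or>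
      (p \<in> F \<and> c = Hash1 \<and> x = [Hash1] \<and> s = (1, q0))" for p c x s
    by (auto simp: \<Delta>_def)
  have run: "foldl \<delta> q w \<in> Q" if "w \<in> lists A" "q \<in> Q" for w q
    using that by (induction w arbitrary: q) (auto simp: *)
  have t2: "trun \<Delta> (2, p) t v (2, q0) \<longleftrightarrow>
      v = t \<and> (\<exists>w\<in>lists A. t = map Letter (rev w) \<and> foldl \<delta> q0 w = p)" for p t v
  proof (induction t arbitrary: p v)
    case (Cons c t)
    have "trun \<Delta> (2, p) (c # t) v (2, q0) \<longleftrightarrow>
        (\<exists>a\<in>A. \<exists>q\<in>Q. \<exists>v'. c = Letter a \<and> \<delta> q a = p \<and> v = Letter a # v' \<and> trun \<Delta> (2, q) t v' (2, q0))"
      unfolding trun.simps \<Delta>2 by fastforce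
    also have "\<dots> \<longleftrightarrow> v = c # t \<and> (\<exists>w\<in>lists A. c # t = map Letter (rev w) \<and> foldl \<delta> q0 w = p)"
      (is "?L \<longleftrightarrow> ?R")
    proof
      assume ?L
      then obtain a q v' where a: "a \<in> A" "c = Letter a" "\<delta> q a = p" "v = Letter a # v'"
        and tr: "trun \<Delta> (2, q) t v' (2, q0)" by blast
      from tr[unfolded Cons.IH] obtain w where "w \<in> lists A" "t = map Letter (rev w)"
        "foldl \<delta> q0 w = q" "v' = t" by blast
      then show ?R using a by (intro conjI bexI[of _ "w @ [a]"]) auto
    next
      assume ?R
      then obtain w where w: "w \<in> lists A" "c # t = map Letter (rev w)" "foldl \<delta> q0 w = p"
        "v = c # t" by (elim conjE bexE) (rule that)
      from w(2) have "w \<noteq> []" by auto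
      then obtain w' a where "w = w' @ [a]" by (meson rev_exhaust)
      then show ?L using w run[of w' q0] *(3)
        unfolding Cons.IH by (intro bexI[of _ a] bexI[of _ "foldl \<delta> q0 w'"]) auto
    qed
    finally show ?case .
  qed auto
  have t1: "trun \<Delta> (1, p) t x (2, q0) \<longleftrightarrow> x = t \<and> (\<exists>v\<in>lists A. \<exists>w\<in>R.
      t = map Letter v @ [Hash2] @ map Letter (rev w) \<and> foldl \<delta> p v \<in> F)" if "p \<in> Q" for p t x
    using that
  proof (induction t arbitrary: p x)
    case (Cons c t)
    show ?case
    proof (cases c)
      case (Letter a)
      have "trun \<Delta> (1, p) (c # t) x (2, q0) \<longleftrightarrow>
        (a \<in> A \<and> (\<exists>x'. x = Letter a # x' \<and> trun \<Delta> (1, \<delta> p a) t x' (2, q0)))"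
        using Cons.prems unfolding trun.simps \<Delta>1 Letter by fastforce
      also have "\<dots> \<longleftrightarrow> x = c # t \<and> (a \<in> A \<and> (\<exists>v\<in>lists A. \<exists>w\<in>R.
          t = map Letter v @ [Hash2] @ map Letter (rev w) \<and> foldl \<delta> (\<delta> p a) v \<in> F))"
        using Cons.IH[OF *(5)[OF Cons.prems]] Letter by blast
      also have "\<dots> \<longleftrightarrow> x = c # t \<and> (\<exists>v\<in>lists A. \<exists>w\<in>R.
          c # t = map Letter v @ [Hash2] @ map Letter (rev w) \<and> foldl \<delta> p v \<in> F)"
        (is "_ \<and> ?L \<longleftrightarrow> _ \<and> ?R")
      proof -
        have "?L \<longleftrightarrow> ?R"
        proof
          assume ?L
          then obtain v w where "a \<in> A" "v \<in> lists A" "w \<in> R" "t = map Letter v @ [Hash2] @ map Letter (rev w)"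
            "foldl \<delta> (\<delta> p a) v \<in> F" by blast
          then show ?R using Letter by (intro bexI[of _ "a # v"] bexI[of _ w]) auto
        next
          assume ?R
          then obtain v w where v: "v \<in> lists A" "w \<in> R" "c # t = map Letter v @ [Hash2] @ map Letter (rev w)"
            "foldl \<delta> p v \<in> F" by (elim conjE bexE) (rule that)
          then obtain v' where "v = a # v'" using Letter by (cases v) auto
          then show ?L using v Letter by auto
        qed
        then show ?thesis by blast
      qed
      finally show ?thesis .
    next
      case Hash1
      then show ?thesis
        unfolding trun.simps \<Delta>1 by (auto simp: Cons_eq_append_conv Cons_eq_map_conv)
    next
      case Hash2
      have "trun \<Delta> (1, p) (c # t) x (2, q0) \<longleftrightarrow>
        (p \<in> F \<and> (\<exists>x'. x = Hash2 # x' \<and> (\<exists>q\<in>F. trun \<Delta> (2, q) t x' (2, q0))))"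
        unfolding trun.simps \<Delta>1 Hash2 by fastforce
      also have "\<dots> \<longleftrightarrow> x = c # t \<and> p \<in> F \<and> (\<exists>w\<in>R. t = map Letter (rev w))"
        unfolding t2 *(6) Hash2 by auto
      also have "p \<in> F \<and> (\<exists>w\<in>R. t = map Letter (rev w)) \<longleftrightarrow> (\<exists>v\<in>lists A. \<exists>w\<in>R.
          c # t = map Letter v @ [Hash2] @ map Letter (rev w) \<and> foldl \<delta> p v \<in> F)" (is "?L \<longleftrightarrow> ?R")
      proof
        assume ?L
        then obtain w where w: "p \<in> F" "w \<in> R" "t = map Letter (rev w)" by (elim conjE bexE) (rule that)
        show ?R using w Hash2 by (intro bexI[of _ "[]"] bexI[OF _ w(2)]) auto
      next
        assume ?R
        then obtain v w where v: "v \<in> lists A" "w \<in> R" "c # t = map Letter v @ [Hash2] @ map Letter (rev w)"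
            "foldl \<delta> p v \<in> F" by (elim conjE bexE) (rule that)
        then have "v = []" using Hash2 by (cases v) auto
        then show ?L using v by auto
      qed
      finally show ?thesis .
    qed
  qed auto
  have t0: "trun \<Delta> (0, p) t x (2, q0) \<longleftrightarrow> x = t \<and> (\<exists>u\<in>lists A. \<exists>v\<in>R. \<exists>w\<in>R.
      t = table_word u v w \<and> foldl \<delta> p u \<in> F)" if "p \<in> Q" for p t x
    using that
  proof (induction t arbitrary: p x)
    case Nil
    then show ?case by (auto simp: table_word_def)
  next
    case (Cons c t)
    show ?case
    proof (cases c)
      case (Letter a)
      have "trun \<Delta> (0, p) (c # t) x (2, q0) \<longleftrightarrow>
        (a \<in> A \<and> (\<exists>x'. x = Letter a # x' \<and> trun \<Delta> (0, \<delta> p a) t x' (2, q0)))"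
        using Cons.prems unfolding trun.simps \<Delta>0 Letter by fastforce
      also have "\<dots> \<longleftrightarrow> x = c # t \<and> (a \<in> A \<and> (\<exists>u\<in>lists A. \<exists>v\<in>R. \<exists>w\<in>R.
          t = table_word u v w \<and> foldl \<delta> (\<delta> p a) u \<in> F))"
        using Cons.IH[OF *(5)[OF Cons.prems]] Letter by blast
      also have "\<dots> \<longleftrightarrow> x = c # t \<and> (\<exists>u\<in>lists A. \<exists>v\<in>R. \<exists>w\<in>R. c # t = table_word u v w \<and> foldl \<delta> p u \<in> F)"
        (is "_ \<and> ?L \<longleftrightarrow> _ \<and> ?R")
      proof -
        have "?L \<longleftrightarrow> ?R"
        proof
          assume ?L
          then obtain u v w where "a \<in> A" "u \<in> lists A" "v \<in> R" "w \<in> R" "t = table_word u v w"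
            "foldl \<delta> (\<delta> p a) u \<in> F" by blast
          then show ?R using Letter
            by (intro bexI[of _ "a # u"] bexI[of _ v] bexI[of _ w]) (auto simp: table_word_def)
        next
          assume ?R
          then obtain u v w where u: "u \<in> lists A" "v \<in> R" "w \<in> R" "c # t = table_word u v w"
            "foldl \<delta> p u \<in> F" by (elim conjE bexE) (rule that)
          then obtain u' where "u = a # u'" using Letter by (cases u) (auto simp: table_word_def)
          then show ?L using u Letter by (auto simp: table_word_def)
        qed
        then show ?thesis by blast
      qed
      finally show ?thesis .
    next
      case Hash2
      then show ?thesis
        unfolding trun.simps \<Delta>0 by (auto simp: table_word_def Cons_eq_append_conv Cons_eq_map_conv)
    next
      case Hash1
      have "trun \<Delta> (0, p) (c # t) x (2, q0) \<longleftrightarrow>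
        (p \<in> F \<and> (\<exists>x'. x = Hash1 # x' \<and> trun \<Delta> (1, q0) t x' (2, q0)))"
        unfolding trun.simps \<Delta>0 Hash1 by fastforce
      also have "\<dots> \<longleftrightarrow> x = c # t \<and> p \<in> F \<and> (\<exists>v\<in>R. \<exists>w\<in>R. t = map Letter v @ [Hash2] @ map Letter (rev w))"
        unfolding t1[OF *(3)] Hash1 using *(6) by blast
      also have "p \<in> F \<and> (\<exists>v\<in>R. \<exists>w\<in>R. t = map Letter v @ [Hash2] @ map Letter (rev w)) \<longleftrightarrow>
          (\<exists>u\<in>lists A. \<exists>v\<in>R. \<exists>w\<in>R. c # t = table_word u v w \<and> foldl \<delta> p u \<in> F)" (is "?L \<longleftrightarrow> ?R")
      proof
        assume ?L
        then obtain v w where w: "p \<in> F" "v \<in> R" "w \<in> R"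
          "t = map Letter v @ [Hash2] @ map Letter (rev w)" by (elim conjE bexE) (rule that)
        show ?R using w Hash1
          by (intro bexI[of _ "[]"] bexI[OF _ w(2)] bexI[OF _ w(3)]) (auto simp: table_word_def)
      next
        assume ?R
        then obtain u v w where u: "u \<in> lists A" "v \<in> R" "w \<in> R" "c # t = table_word u v w"
            "foldl \<delta> p u \<in> F" by (elim conjE bexE) (rule that)
        then have "u = []" using Hash1 by (cases u) (auto simp: table_word_def)
        then show ?L using u by (auto simp: table_word_def)
      qed
      finally show ?thesis .
    qed
  qed
  have "{x. \<exists>t\<in>L. \<exists>q\<in>{(2, q0)}. trun \<Delta> (0, q0) t x q} \<in> ET0L"
    using finite_\<Delta> by (intro ET0L_transduce L) auto
  also have "{x. \<exists>t\<in>L. \<exists>q\<in>{(2, q0)}. trun \<Delta> (0, q0) t x q} =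
      L \<inter> {table_word u v w | u v w. u \<in> R \<and> v \<in> R \<and> w \<in> R}"
    unfolding bex_simps(5) singleton_iff t0[OF *(3)] by (auto simp: t0[OF *(3)] *(6))
  finally show ?thesis .
qed


section \<open>A grammar for the multiplication table of the free product\<close>

datatype nonterm = Product | Cancel | Copy

type_synonym rule_symbol = "nonterm + nat table_symbol"

definition letters :: "(nat \<Rightarrow> nat) \<Rightarrow> nat list \<Rightarrow> rule_symbol list" where
  "letters f u = map (\<lambda>n. Inr (Letter (f n))) u"

lemma letters_simps [simp]:
  "letters f [] = []" "letters f (n # u) = Inr (Letter (f n)) # letters f u"
  "letters f (u @ v) = letters f u @ letters f v"
  by (simp_all add: letters_def)

definition product_rules ::
  "('g, 'm) monoid_scheme \<Rightarrow> (nat list \<Rightarrow> 'g) \<Rightarrow> nat list set \<Rightarrow> (nat \<Rightarrow> nat) \<Rightarrow> rule_symbol list set" where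
  "product_rules G \<pi> R f = {letters f u @ [Inl Cancel] @ letters f v @ [Inl Copy] @ letters f (rev w) | u v w.
     u \<in> R \<and> v \<in> R \<and> w \<in> R \<and> \<pi> u \<otimes>\<^bsub>G\<^esub> \<pi> v = \<pi> w}"

definition cancel_rules ::
  "('g, 'm) monoid_scheme \<Rightarrow> (nat list \<Rightarrow> 'g) \<Rightarrow> nat list set \<Rightarrow> (nat \<Rightarrow> nat) \<Rightarrow> rule_symbol list set" where
  "cancel_rules G \<pi> R f = {letters f u @ [Inl Cancel] @ letters f v | u v.
     u \<in> R \<and> v \<in> R \<and> \<pi> u \<otimes>\<^bsub>G\<^esub> \<pi> v = \<one>\<^bsub>G\<^esub>}"

lemma ET0L_product_rules:
  assumes "finite A" "R \<subseteq> lists A" "mult_table G \<pi> R \<in> ET0L"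
  shows "product_rules G \<pi> R f \<in> ET0L"
proof -
  define h :: "nat table_symbol \<Rightarrow> rule_symbol list" where
    "h s = [case s of Letter n \<Rightarrow> Inr (Letter (f n)) | Hash1 \<Rightarrow> Inl Cancel | Hash2 \<Rightarrow> Inl Copy]" for s
  have "mult_table G \<pi> R \<subseteq> lists (insert Hash1 (insert Hash2 (Letter ` A)))"
  proof
    fix t assume "t \<in> mult_table G \<pi> R"
    then obtain u v w where "u \<in> R" "v \<in> R" "w \<in> R" "t = table_word u v w"
      unfolding mult_table_eq by blast
    moreover from this have "u \<in> lists A" "v \<in> lists A" "w \<in> lists A" using assms(2) by blast+
    ultimately show "t \<in> lists (insert Hash1 (insert Hash2 (Letter ` A)))"
      by (auto simp: table_word_def)
  qed
  then have image: "(\<lambda>w. concat (map h w)) ` mult_table G \<pi> R \<in> ET0L"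
    by (rule ET0L_hom[OF assms(3)]) (use assms(1) in simp)
  have "concat (map h (map Letter u)) = letters f u" for u
    by (induction u) (simp_all add: h_def)
  then have h_table: "concat (map h (table_word u v w)) =
      letters f u @ [Inl Cancel] @ letters f v @ [Inl Copy] @ letters f (rev w)" for u v w
    by (simp add: table_word_def del: map_map) (simp add: h_def)
  have "(\<lambda>w. concat (map h w)) ` mult_table G \<pi> R = {concat (map h (table_word u v w)) | u v w.
      u \<in> R \<and> v \<in> R \<and> w \<in> R \<and> \<pi> u \<otimes>\<^bsub>G\<^esub> \<pi> v = \<pi> w}"
    unfolding mult_table_eq by blast
  also have "\<dots> = product_rules G \<pi> R f" unfolding product_rules_def h_table ..
  finally show ?thesis using image by simp
qed

text \<open>Pairs with trivial product are the table entries whose third word is the representative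
  \<open>e\<close> of the identity. A single fixed word can be checked and erased with finitely many
  states.\<close>

lemma ET0L_cancel_rules:
  assumes "finite A" "R \<subseteq> lists A" "mult_table G \<pi> R \<in> ET0L" and e: "e \<in> R" "\<pi> e = \<one>\<^bsub>G\<^esub>"
  shows "cancel_rules G \<pi> R f \<in> ET0L"
proof -
  define n where "n = length e"
  \<comment> \<open>State \<open>Suc n\<close> copies; state \<open>k \<le> n\<close> expects the remaining input \<open>rev (take k e)\<close> and erases it.\<close>
  define \<Delta> :: "(nat \<times> nat table_symbol \<times> rule_symbol list \<times> nat) set" where
    "\<Delta> = (\<lambda>a. (Suc n, Letter a, [Inr (Letter (f a))], Suc n)) ` A
      \<union> {(Suc n, Hash1, [Inl Cancel], Suc n), (Suc n, Hash2, [], n)}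
      \<union> (\<lambda>k. (Suc k, Letter (e ! k), [], k)) ` {..<n}"
  have start: "(Suc n, c, x, s) \<in> \<Delta> \<longleftrightarrow> (\<exists>a\<in>A. c = Letter a \<and> x = [Inr (Letter (f a))] \<and> s = Suc n) \<or>
      c = Hash1 \<and> x = [Inl Cancel] \<and> s = Suc n \<or> c = Hash2 \<and> x = [] \<and> s = n" for c x s
    by (auto simp: \<Delta>_def)
  have low: "(k, c, x, s) \<in> \<Delta> \<longleftrightarrow> (k = Suc s \<and> c = Letter (e ! s) \<and> x = [])" if "k \<le> n" for k c x s
    using that by (auto simp: \<Delta>_def)
  have tail: "trun \<Delta> k (map Letter (rev w)) x 0 \<longleftrightarrow> x = [] \<and> w = take k e" if "k \<le> n" for k w x
    using that
  proof (induction k arbitrary: w x)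
    case 0
    then show ?case by (cases "rev w") (auto simp: low)
  next
    case (Suc k)
    show ?case
    proof (cases w rule: rev_cases)
      case Nil
      then show ?thesis using Suc.prems by (auto simp: n_def)
    next
      case (snoc v a)
      have "trun \<Delta> (Suc k) (map Letter (rev w)) x 0 \<longleftrightarrow>
          a = e ! k \<and> trun \<Delta> k (map Letter (rev v)) x 0"
        using Suc.prems by (auto simp: snoc low)
      then show ?thesis using Suc by (auto simp: snoc take_Suc_conv_app_nth n_def)
    qed
  qed
  have copy: "trun \<Delta> (Suc n) (map Letter u @ t) x q \<longleftrightarrow> (\<exists>y. x = letters f u @ y \<and> trun \<Delta> (Suc n) t y q)"
    if "u \<in> lists A" for u t x q
    using that by (induction u arbitrary: x) (auto simp: start)
  have run: "trun \<Delta> (Suc n) (table_word u v w) x 0 \<longleftrightarrow>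
      x = letters f u @ [Inl Cancel] @ letters f v \<and> w = e" if "u \<in> lists A" "v \<in> lists A" for u v w x
    using that by (auto simp: table_word_def copy start tail) (simp add: n_def)+
  have "finite \<Delta>" using assms(1) by (simp add: \<Delta>_def)
  then have "{x. \<exists>t\<in>mult_table G \<pi> R. \<exists>q\<in>{0}. trun \<Delta> (Suc n) t x q} \<in> ET0L"
    by (intro ET0L_transduce assms(3)) auto
  also have "{x. \<exists>t\<in>mult_table G \<pi> R. \<exists>q\<in>{0}. trun \<Delta> (Suc n) t x q} = cancel_rules G \<pi> R f"
  proof (intro Set.set_eqI iffI)
    fix x assume "x \<in> {x. \<exists>t\<in>mult_table G \<pi> R. \<exists>q\<in>{0}. trun \<Delta> (Suc n) t x q}"
    then obtain u v w where *: "u \<in> R" "v \<in> R" "w \<in> R" "\<pi> u \<otimes>\<^bsub>G\<^esub> \<pi> v = \<pi> w"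
      "trun \<Delta> (Suc n) (table_word u v w) x 0" unfolding mult_table_eq by blast
    then have "x = letters f u @ [Inl Cancel] @ letters f v \<and> w = e"
      using run assms(2) by blast
    then show "x \<in> cancel_rules G \<pi> R f" using * e unfolding cancel_rules_def by auto
  next
    fix x assume "x \<in> cancel_rules G \<pi> R f"
    then obtain u v where *: "u \<in> R" "v \<in> R" "\<pi> u \<otimes>\<^bsub>G\<^esub> \<pi> v = \<one>\<^bsub>G\<^esub>"
      "x = letters f u @ [Inl Cancel] @ letters f v" unfolding cancel_rules_def by blast
    then have "trun \<Delta> (Suc n) (table_word u v e) x 0" using run assms(2) by blast
    moreover have "table_word u v e \<in> mult_table G \<pi> R" using *(1-3) e unfolding mult_table_eq by fastforce
    ultimately show "x \<in> {x. \<exists>t\<in>mult_table G \<pi> R. \<exists>q\<in>{0}. trun \<Delta> (Suc n) t x q}" by blast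
  qed
  finally show ?thesis .
qed


section \<open>The free product\<close>

context
  fixes G :: "('a, 'm) monoid_scheme" and H :: "('b, 'n) monoid_scheme"
  assumes G: "group G" and H: "group H"
begin

interpretation G: group G by (rule G)
interpretation H: group H by (rule H)

abbreviation inverse_word :: "('a + 'b) list \<Rightarrow> ('a + 'b) list" where
  "inverse_word s \<equiv> map (map_sum (m_inv G) (m_inv H)) (rev s)"

text \<open>Induction on \<open>r1\<close>, prepending a letter \<open>x\<close>. It can interact
  with the product only if all letters after it in \<open>r1\<close> have cancelled, that is
  \<open>p = []\<close>. Then \<open>x\<close> either cancels as well and joins \<open>s\<close>, or
  merges with a syllable of \<open>r2\<close>; after a merge no further letter interacts.\<close>

lemma reduced_product_cases:
  assumes "r1 \<in> reduced_words G H" "r2 \<in> reduced_words G H"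
  obtains (cancel) p s q where "r1 = p @ s" "r2 = inverse_word s @ q"
      "foldr (syllable_mult G H) r1 r2 = p @ q"
    | (Inl) p s q g g' where "r1 = p @ Inl g # s" "r2 = inverse_word s @ Inl g' # q"
      "foldr (syllable_mult G H) r1 r2 = p @ Inl (g \<otimes>\<^bsub>G\<^esub> g') # q"
    | (Inr) p s q h h' where "r1 = p @ Inr h # s" "r2 = inverse_word s @ Inr h' # q"
      "foldr (syllable_mult G H) r1 r2 = p @ Inr (h \<otimes>\<^bsub>H\<^esub> h') # q"
proof -
  let ?P = "\<lambda>r1. (\<exists>p s q. r1 = p @ s \<and> r2 = inverse_word s @ q \<and> foldr (syllable_mult G H) r1 r2 = p @ q)"
  let ?Q = "\<lambda>r1. (\<exists>p s q g g'. r1 = p @ Inl g # s \<and> r2 = inverse_word s @ Inl g' # q \<and>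
     foldr (syllable_mult G H) r1 r2 = p @ Inl (g \<otimes>\<^bsub>G\<^esub> g') # q)"
  let ?R = "\<lambda>r1. (\<exists>p s q h h'. r1 = p @ Inr h # s \<and> r2 = inverse_word s @ Inr h' # q \<and>
     foldr (syllable_mult G H) r1 r2 = p @ Inr (h \<otimes>\<^bsub>H\<^esub> h') # q)"
  have "?P r1 \<or> ?Q r1 \<or> ?R r1"
    using assms(1)
  proof (induction r1)
    case Nil
    show ?case by (intro disjI1 exI[of _ "[]"] exI[of _ r2]) simp
  next
    case (Cons x r1)
    then have x: "x \<in> (carrier G <+> carrier H) - {Inl \<one>\<^bsub>G\<^esub>, Inr \<one>\<^bsub>H\<^esub>}" "r1 \<in> reduced_words G H"
      "r1 = [] \<or> isl x \<noteq> isl (hd r1)" by (simp_all only: reduced_words_Cons[OF G H])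
    have keep: "syllable_mult G H x w = x # w" if "w = [] \<or> isl x \<noteq> isl (hd w)" for w
    proof (cases x)
      case (Inl g)
      then show ?thesis using that x(1) syllable_mult_Inl_neq[OF G H, of w g] by auto
    next
      case (Inr g)
      then show ?thesis using that x(1) syllable_mult_Inr_neq[OF G H, of w g] by auto
    qed
    from Cons.IH[OF x(2)] consider (P) "?P r1" | (Q) "?Q r1" | (R) "?R r1" by blast
    then show ?case
    proof cases
      case P
      then obtain p s q where *: "r1 = p @ s" "r2 = inverse_word s @ q"
        "foldr (syllable_mult G H) r1 r2 = p @ q" by blast
      show ?thesis
      proof (cases "p @ q = [] \<or> isl x \<noteq> isl (hd (p @ q))")
        case True
        then have "foldr (syllable_mult G H) (x # r1) r2 = (x # p) @ q" using keep * by simp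
        then have "?P (x # r1)"
          using * by (intro exI[of _ "x # p"] exI[of _ s] exI[of _ q]) simp
        then show ?thesis by blast
      next
        case False
        \<comment> \<open>If \<open>p\<close> were nonempty, its first letter would be that of
          \<open>r1\<close>, which comes from the other factor than \<open>x\<close>.\<close>
        then have p: "p = []" using x(3) * by (cases p) auto
        then obtain y q' where q: "q = y # q'" "isl x = isl y" using False by (cases q) auto
        have q_red: "y # q' \<in> reduced_words G H"
          using free_product_mult_closed[OF G H x(2) assms(2)] *(3) p q by simp
        show ?thesis
        proof (cases x)
          case (Inl g)
          then obtain g' where y: "y = Inl g'" using q(2) by (cases y) auto
          have g: "g \<in> carrier G" "g' \<in> carrier G"
            using x(1) q_red Inl y by (auto simp: reduced_words_Cons[OF G H])
          show ?thesis
          proof (cases "g \<otimes>\<^bsub>G\<^esub> g' = \<one>\<^bsub>G\<^esub>")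
            case True
            then have "g' = inv\<^bsub>G\<^esub> g" using g G.inv_equality G.inv_comm by metis
            then have "r2 = inverse_word (x # s) @ q'" using * q y Inl by simp
            moreover have "foldr (syllable_mult G H) (x # r1) r2 = [] @ q'"
              using *(3) p q y Inl True by simp
            moreover have "x # r1 = [] @ (x # s)" using * p by simp
            ultimately have "?P (x # r1)" by blast
            then show ?thesis by blast
          next
            case False
            then have "foldr (syllable_mult G H) (x # r1) r2 = [] @ Inl (g \<otimes>\<^bsub>G\<^esub> g') # q'"
              using *(3) p q y Inl by simp
            moreover have "x # r1 = [] @ Inl g # s" using * p Inl by simp
            moreover have "r2 = inverse_word s @ Inl g' # q'" using * q y by simp
            ultimately have "?Q (x # r1)" by blast
            then show ?thesis by blast
          qed
        next
          case (Inr g)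
          then obtain g' where y: "y = Inr g'" using q(2) by (cases y) auto
          have g: "g \<in> carrier H" "g' \<in> carrier H"
            using x(1) q_red Inr y by (auto simp: reduced_words_Cons[OF G H])
          show ?thesis
          proof (cases "g \<otimes>\<^bsub>H\<^esub> g' = \<one>\<^bsub>H\<^esub>")
            case True
            then have "g' = inv\<^bsub>H\<^esub> g" using g H.inv_equality H.inv_comm by metis
            then have "r2 = inverse_word (x # s) @ q'" using * q y Inr by simp
            moreover have "foldr (syllable_mult G H) (x # r1) r2 = [] @ q'"
              using *(3) p q y Inr True by simp
            moreover have "x # r1 = [] @ (x # s)" using * p by simp
            ultimately have "?P (x # r1)" by blast
            then show ?thesis by blast
          next
            case False
            then have "foldr (syllable_mult G H) (x # r1) r2 = [] @ Inr (g \<otimes>\<^bsub>H\<^esub> g') # q'"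
              using *(3) p q y Inr by simp
            moreover have "x # r1 = [] @ Inr g # s" using * p Inr by simp
            moreover have "r2 = inverse_word s @ Inr g' # q'" using * q y by simp
            ultimately have "?R (x # r1)" by blast
            then show ?thesis by blast
          qed
        qed
      qed
    next
      case Q
      then obtain p s q g g' where *: "r1 = p @ Inl g # s" "r2 = inverse_word s @ Inl g' # q"
        "foldr (syllable_mult G H) r1 r2 = p @ Inl (g \<otimes>\<^bsub>G\<^esub> g') # q" by blast
      \<comment> \<open>The merged syllable lies in the same factor as \<open>Inl g\<close>, so
        \<open>x\<close> alternates with the product just as it does with \<open>r1\<close>.\<close>
      have "isl x \<noteq> isl (hd (p @ Inl (g \<otimes>\<^bsub>G\<^esub> g') # q))" using x(3) * by (cases p) auto
      then have "foldr (syllable_mult G H) (x # r1) r2 = (x # p) @ Inl (g \<otimes>\<^bsub>G\<^esub> g') # q"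
        using keep * by simp
      moreover have "x # r1 = (x # p) @ Inl g # s" using * by simp
      ultimately have "?Q (x # r1)" using *(2) by blast
      then show ?thesis by blast
    next
      case R
      then obtain p s q g g' where *: "r1 = p @ Inr g # s" "r2 = inverse_word s @ Inr g' # q"
        "foldr (syllable_mult G H) r1 r2 = p @ Inr (g \<otimes>\<^bsub>H\<^esub> g') # q" by blast
      have "isl x \<noteq> isl (hd (p @ Inr (g \<otimes>\<^bsub>H\<^esub> g') # q))" using x(3) * by (cases p) auto
      then have "foldr (syllable_mult G H) (x # r1) r2 = (x # p) @ Inr (g \<otimes>\<^bsub>H\<^esub> g') # q"
        using keep * by simp
      moreover have "x # r1 = (x # p) @ Inr g # s" using * by simp
      ultimately have "?R (x # r1)" using *(2) by blast
      then show ?thesis by blast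
    qed
  qed
  then show thesis
    by (elim disjE exE conjE) (rule cancel Inl Inr, assumption, assumption, assumption)+
qed

end


section \<open>Generators and normal forms of the free product\<close>

locale tabled_pair =
  fixes G :: "('a, 'm) monoid_scheme" and H :: "('b, 'n) monoid_scheme"
    and A B :: "nat set" and \<pi>1 \<pi>2 R1 R2
  assumes G: "group G" and H: "group H"
    and A: "finite A" "\<pi>1 \<in> hom (word_monoid A) G" "\<pi>1 [] = \<one>\<^bsub>G\<^esub>" "normal_forms G A \<pi>1 R1"
      "mult_table G \<pi>1 R1 \<in> ET0L"
    and B: "finite B" "\<pi>2 \<in> hom (word_monoid B) H" "\<pi>2 [] = \<one>\<^bsub>H\<^esub>" "normal_forms H B \<pi>2 R2"
      "mult_table H \<pi>2 R2 \<in> ET0L"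
begin

sublocale G: group G by (rule G)
sublocale H: group H by (rule H)

abbreviation K where "K \<equiv> free_product G H"

sublocale K: group K by (rule free_product_group[OF G H])

abbreviation (input) f1 :: "nat \<Rightarrow> nat" where "f1 \<equiv> \<lambda>n. 2 * n"
abbreviation (input) f2 :: "nat \<Rightarrow> nat" where "f2 \<equiv> \<lambda>n. 2 * n + 1"

definition AB :: "nat set" where "AB = f1 ` A \<union> f2 ` B"

definition val :: "nat \<Rightarrow> 'a + 'b" where
  "val n = (if even n then Inl (\<pi>1 [n div 2]) else Inr (\<pi>2 [n div 2]))"

text \<open>Letters may represent the identity, and neighbouring letters may belong to the same
  factor. Multiplying by one letter after the other with \<open>syllable_mult\<close> keeps the
  value reduced in all cases.\<close>

definition \<pi> :: "nat list \<Rightarrow> ('a + 'b) list" where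
  "\<pi> w = foldr (\<lambda>n. syllable_mult G H (val n)) w []"

definition rep1 where "rep1 g = (THE w. w \<in> R1 \<and> \<pi>1 w = g)"
definition rep2 where "rep2 h = (THE w. w \<in> R2 \<and> \<pi>2 w = h)"

abbreviation NF where "NF \<equiv> nf rep1 rep2"

lemma R1: "R1 \<subseteq> lists A" and R2: "R2 \<subseteq> lists B"
  using A(4) B(4) by (auto simp: normal_forms_def regular_language_def)

lemma rep1:
  assumes "g \<in> carrier G"
  shows "rep1 g \<in> R1" "\<pi>1 (rep1 g) = g" "w \<in> R1 \<Longrightarrow> \<pi>1 w = g \<Longrightarrow> rep1 g = w"
proof -
  have *: "\<exists>!w. w \<in> R1 \<and> \<pi>1 w = g" using A(4) assms unfolding normal_forms_def by blast
  from theI'[OF *] show "rep1 g \<in> R1" "\<pi>1 (rep1 g) = g" by (simp_all add: rep1_def)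
  show "w \<in> R1 \<Longrightarrow> \<pi>1 w = g \<Longrightarrow> rep1 g = w" unfolding rep1_def using the1_equality[OF *] by blast
qed

lemma rep2:
  assumes "h \<in> carrier H"
  shows "rep2 h \<in> R2" "\<pi>2 (rep2 h) = h" "w \<in> R2 \<Longrightarrow> \<pi>2 w = h \<Longrightarrow> rep2 h = w"
proof -
  have *: "\<exists>!w. w \<in> R2 \<and> \<pi>2 w = h" using B(4) assms unfolding normal_forms_def by blast
  from theI'[OF *] show "rep2 h \<in> R2" "\<pi>2 (rep2 h) = h" by (simp_all add: rep2_def)
  show "w \<in> R2 \<Longrightarrow> \<pi>2 w = h \<Longrightarrow> rep2 h = w" unfolding rep2_def using the1_equality[OF *] by blast
qed

lemma pi1_closed: "w \<in> lists A \<Longrightarrow> \<pi>1 w \<in> carrier G"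
  and pi1_append: "u \<in> lists A \<Longrightarrow> v \<in> lists A \<Longrightarrow> \<pi>1 (u @ v) = \<pi>1 u \<otimes>\<^bsub>G\<^esub> \<pi>1 v"
  using A(2) by (auto simp: hom_def word_monoid_def)

lemma pi2_closed: "w \<in> lists B \<Longrightarrow> \<pi>2 w \<in> carrier H"
  and pi2_append: "u \<in> lists B \<Longrightarrow> v \<in> lists B \<Longrightarrow> \<pi>2 (u @ v) = \<pi>2 u \<otimes>\<^bsub>H\<^esub> \<pi>2 v"
  using B(2) by (auto simp: hom_def word_monoid_def)

lemma val_closed: "n \<in> AB \<Longrightarrow> val n \<in> carrier G <+> carrier H"
  using pi1_closed pi2_closed by (auto simp: val_def AB_def)

lemma pi_closed: "w \<in> lists AB \<Longrightarrow> \<pi> w \<in> carrier K"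
  by (induction w)
    (auto simp: \<pi>_def free_product_def reduced_words_Nil[OF G H] intro!: syllable_mult_closed[OF G H] val_closed)

lemma pi_append:
  assumes "u \<in> lists AB" "v \<in> lists AB"
  shows "\<pi> (u @ v) = \<pi> u \<otimes>\<^bsub>K\<^esub> \<pi> v"
  using assms(1)
proof (induction u)
  case Nil
  then show ?case by (simp add: \<pi>_def free_product_def)
next
  case (Cons n u)
  then have nu: "n \<in> AB" "u \<in> lists AB" by auto
  have "syllable_mult G H (val n) (foldr (syllable_mult G H) (\<pi> u) (\<pi> v)) =
      foldr (syllable_mult G H) (syllable_mult G H (val n) (\<pi> u)) (\<pi> v)"
  proof (rule foldr_syllable_mult_assoc[OF G H, symmetric])
    show "val n \<in> carrier G <+> carrier H" "\<pi> u \<in> reduced_words G H" "\<pi> v \<in> reduced_words G H"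
      using val_closed[OF nu(1)] pi_closed[OF nu(2)] pi_closed[OF assms(2)]
      by (simp_all add: free_product_def)
  qed
  then show ?case using Cons by (simp add: \<pi>_def free_product_def)
qed

lemma lists_f1: "u \<in> lists A \<Longrightarrow> map f1 u \<in> lists AB"
  and lists_f2: "v \<in> lists B \<Longrightarrow> map f2 v \<in> lists AB"
  by (auto simp: AB_def)

lemma pi_f1: "u \<in> lists A \<Longrightarrow> \<pi> (map f1 u) = syllable_mult G H (Inl (\<pi>1 u)) []"
proof (induction u)
  case Nil
  then show ?case by (simp add: \<pi>_def A(3))
next
  case (Cons n u)
  then have "\<pi> (map f1 (n # u)) = syllable_mult G H (Inl (\<pi>1 [n])) (syllable_mult G H (Inl (\<pi>1 u)) [])"
    by (simp add: \<pi>_def val_def)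
  also have "\<dots> = syllable_mult G H (Inl (\<pi>1 [n] \<otimes>\<^bsub>G\<^esub> \<pi>1 u)) []"
    using Cons.prems by (intro syllable_mult_Inl_Inl[OF G H] pi1_closed reduced_words_Nil[OF G H]) auto
  also have "\<pi>1 [n] \<otimes>\<^bsub>G\<^esub> \<pi>1 u = \<pi>1 (n # u)"
    using pi1_append[of "[n]" u] Cons.prems by simp
  finally show ?case .
qed

lemma pi_f2: "u \<in> lists B \<Longrightarrow> \<pi> (map f2 u) = syllable_mult G H (Inr (\<pi>2 u)) []"
proof (induction u)
  case Nil
  then show ?case by (simp add: \<pi>_def B(3))
next
  case (Cons n u)
  then have "\<pi> (map f2 (n # u)) = syllable_mult G H (Inr (\<pi>2 [n])) (syllable_mult G H (Inr (\<pi>2 u)) [])"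
    by (simp add: \<pi>_def val_def)
  also have "\<dots> = syllable_mult G H (Inr (\<pi>2 [n] \<otimes>\<^bsub>H\<^esub> \<pi>2 u)) []"
    using Cons.prems by (intro syllable_mult_Inr_Inr[OF G H] pi2_closed reduced_words_Nil[OF G H]) auto
  also have "\<pi>2 [n] \<otimes>\<^bsub>H\<^esub> \<pi>2 u = \<pi>2 (n # u)"
    using pi2_append[of "[n]" u] Cons.prems by simp
  finally show ?case .
qed

text \<open>Carries equations from the table of the first factor over to \<open>K\<close>, because
  the embedding is a homomorphism.\<close>

lemma pi_f1_mult:
  assumes "u \<in> lists A" "v \<in> lists A"
  shows "\<pi> (map f1 u) \<otimes>\<^bsub>K\<^esub> \<pi> (map f1 v) = syllable_mult G H (Inl (\<pi>1 u \<otimes>\<^bsub>G\<^esub> \<pi>1 v)) []"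
  unfolding pi_f1[OF assms(1)] pi_f1[OF assms(2)]
  using hom_mult[OF free_product_Inl_hom[OF G H] pi1_closed[OF assms(1)] pi1_closed[OF assms(2)]] ..

lemma pi_f2_mult:
  assumes "u \<in> lists B" "v \<in> lists B"
  shows "\<pi> (map f2 u) \<otimes>\<^bsub>K\<^esub> \<pi> (map f2 v) = syllable_mult G H (Inr (\<pi>2 u \<otimes>\<^bsub>H\<^esub> \<pi>2 v)) []"
  unfolding pi_f2[OF assms(1)] pi_f2[OF assms(2)]
  using hom_mult[OF free_product_Inr_hom[OF G H] pi2_closed[OF assms(1)] pi2_closed[OF assms(2)]] ..

lemma NF_closed: "set r \<subseteq> carrier G <+> carrier H \<Longrightarrow> NF r \<in> lists AB"
proof (induction r)
  case (Cons x r)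
  have "syllable_word rep1 rep2 x \<in> lists AB"
  proof (cases x)
    case (Inl g)
    then have "rep1 g \<in> lists A" using Cons.prems rep1(1)[of g] R1 by auto
    then show ?thesis using lists_f1 Inl by simp
  next
    case (Inr h)
    then have "rep2 h \<in> lists B" using Cons.prems rep2(1)[of h] R2 by auto
    then show ?thesis using lists_f2[of "rep2 h"] Inr by simp
  qed
  then show ?case using Cons by simp
qed simp

lemma reduced_carrier: "r \<in> reduced_words G H \<Longrightarrow> set r \<subseteq> carrier G <+> carrier H"
  by (auto simp: reduced_words_def)

text \<open>A nontrivial syllable \<open>x\<close> evaluates to \<open>[x]\<close>, and alternation
  prevents merging. Since \<open>NF\<close> is thus a section of \<open>\<pi>\<close>, both the
  surjectivity of \<open>\<pi>\<close> and the uniqueness of normal forms follow.\<close>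

lemma pi_NF: "r \<in> reduced_words G H \<Longrightarrow> \<pi> (NF r) = r"
proof (induction r)
  case Nil
  then show ?case by (simp add: \<pi>_def)
next
  case (Cons x r)
  then have r: "r \<in> reduced_words G H" "set r \<subseteq> carrier G <+> carrier H"
    "x \<in> carrier G <+> carrier H" "x \<notin> {Inl \<one>\<^bsub>G\<^esub>, Inr \<one>\<^bsub>H\<^esub>}" "r = [] \<or> isl x \<noteq> isl (hd r)"
    using reduced_carrier[of r] by (simp_all add: reduced_words_Cons[OF G H])
  have x: "syllable_word rep1 rep2 x \<in> lists AB" using NF_closed[of "[x]"] r(3) by simp
  have "\<pi> (syllable_word rep1 rep2 x) = [x]"
  proof (cases x)
    case (Inl g)
    then have g: "g \<in> carrier G" "g \<noteq> \<one>\<^bsub>G\<^esub>" using r(3,4) by auto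
    then have "\<pi> (map f1 (rep1 g)) = [Inl g]"
      using pi_f1[of "rep1 g"] rep1(1,2)[of g] R1 by auto
    then show ?thesis using Inl by simp
  next
    case (Inr g)
    then have g: "g \<in> carrier H" "g \<noteq> \<one>\<^bsub>H\<^esub>" using r(3,4) by auto
    then have "\<pi> (map f2 (rep2 g)) = [Inr g]"
      using pi_f2[of "rep2 g"] rep2(1,2)[of g] R2 by auto
    then show ?thesis using Inr by simp
  qed
  then have "\<pi> (NF (x # r)) = syllable_mult G H x r"
    using Cons.IH[OF r(1)] pi_append[OF x NF_closed[OF r(2)]] by (simp add: free_product_def)
  also have "\<dots> = x # r"
    using r(4,5) by (cases x)
     (auto simp: syllable_mult_Inl_neq[OF G H] syllable_mult_Inr_neq[OF G H])
  finally show ?case .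
qed

lemma pi_epi: "\<pi> \<in> epi (word_monoid AB) K"
proof -
  have "\<pi> ` lists AB = carrier K"
  proof
    show "\<pi> ` lists AB \<subseteq> carrier K" using pi_closed by blast
    show "carrier K \<subseteq> \<pi> ` lists AB"
    proof
      fix r assume "r \<in> carrier K"
      then have "r \<in> reduced_words G H" by (simp add: free_product_def)
      then show "r \<in> \<pi> ` lists AB"
        using pi_NF NF_closed reduced_carrier by (intro image_eqI[of _ _ "NF r"]) auto
    qed
  qed
  then show ?thesis using pi_closed pi_append by (auto simp: epi_def hom_def word_monoid_def)
qed

text \<open>Reduced words have no trivial syllables, so the representatives of the identities have
  to leave \<open>R1\<close> and \<open>R2\<close> before the languages are combined.\<close>

lemma normal_forms_free_product: "normal_forms K AB \<pi> (NF ` reduced_words G H)"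
proof -
  have 1: "rep1 ` (carrier G - {\<one>\<^bsub>G\<^esub>}) = R1 - {rep1 \<one>\<^bsub>G\<^esub>}"
  proof -
    have \<pi>: "\<pi>1 w \<in> carrier G" if "w \<in> R1" for w using pi1_closed R1 that by blast
    have rep: "rep1 (\<pi>1 w) = w" if "w \<in> R1" for w using rep1(3)[OF \<pi>] that by blast
    show ?thesis
    proof (intro Set.set_eqI iffI)
      fix w assume "w \<in> rep1 ` (carrier G - {\<one>\<^bsub>G\<^esub>})"
      then obtain g where "g \<in> carrier G" "g \<noteq> \<one>\<^bsub>G\<^esub>" "w = rep1 g" by blast
      then show "w \<in> R1 - {rep1 \<one>\<^bsub>G\<^esub>}" using rep1(1,2) G.one_closed by (metis DiffI singletonD)
    next
      fix w assume w: "w \<in> R1 - {rep1 \<one>\<^bsub>G\<^esub>}"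
      then have "\<pi>1 w \<noteq> \<one>\<^bsub>G\<^esub>" using w rep by (metis DiffE singletonI)
      then show "w \<in> rep1 ` (carrier G - {\<one>\<^bsub>G\<^esub>})"
        using w \<pi> rep by (intro image_eqI[of _ _ "\<pi>1 w"]) auto
    qed
  qed
  have 2: "rep2 ` (carrier H - {\<one>\<^bsub>H\<^esub>}) = R2 - {rep2 \<one>\<^bsub>H\<^esub>}"
  proof -
    have \<pi>: "\<pi>2 w \<in> carrier H" if "w \<in> R2" for w using pi2_closed R2 that by blast
    have rep: "rep2 (\<pi>2 w) = w" if "w \<in> R2" for w using rep2(3)[OF \<pi>] that by blast
    show ?thesis
    proof (intro Set.set_eqI iffI)
      fix w assume "w \<in> rep2 ` (carrier H - {\<one>\<^bsub>H\<^esub>})"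
      then obtain g where "g \<in> carrier H" "g \<noteq> \<one>\<^bsub>H\<^esub>" "w = rep2 g" by blast
      then show "w \<in> R2 - {rep2 \<one>\<^bsub>H\<^esub>}" using rep2(1,2) H.one_closed by (metis DiffI singletonD)
    next
      fix w assume w: "w \<in> R2 - {rep2 \<one>\<^bsub>H\<^esub>}"
      then have "\<pi>2 w \<noteq> \<one>\<^bsub>H\<^esub>" using w rep by (metis DiffE singletonI)
      then show "w \<in> rep2 ` (carrier H - {\<one>\<^bsub>H\<^esub>})"
        using w \<pi> rep by (intro image_eqI[of _ _ "\<pi>2 w"]) auto
    qed
  qed
  have "regular_language AB (NF ` {w \<in> lists ((carrier G - {\<one>\<^bsub>G\<^esub>}) <+> (carrier H - {\<one>\<^bsub>H\<^esub>})).
      successively (\<lambda>x y. isl x \<noteq> isl y) w})"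
    unfolding AB_def
  proof (rule regular_language_nf)
    show "regular_language A (rep1 ` (carrier G - {\<one>\<^bsub>G\<^esub>}))"
      unfolding 1 using A(4) by (intro regular_language_remove) (simp add: normal_forms_def)
    show "regular_language B (rep2 ` (carrier H - {\<one>\<^bsub>H\<^esub>}))"
      unfolding 2 using B(4) by (intro regular_language_remove) (simp add: normal_forms_def)
    \<comment> \<open>The empty word evaluates to the identity, so it cannot represent a nontrivial
      element. This makes every syllable nonempty.\<close>
    show "[] \<notin> rep1 ` (carrier G - {\<one>\<^bsub>G\<^esub>})" using rep1(2) A(3) by force
    show "[] \<notin> rep2 ` (carrier H - {\<one>\<^bsub>H\<^esub>})" using rep2(2) B(3) by force
  qed
  also have "(carrier G - {\<one>\<^bsub>G\<^esub>}) <+> (carrier H - {\<one>\<^bsub>H\<^esub>}) =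
      (carrier G <+> carrier H) - {Inl \<one>\<^bsub>G\<^esub>, Inr \<one>\<^bsub>H\<^esub>}" by auto
  finally have "regular_language AB (NF ` reduced_words G H)" by (simp only: reduced_words_def)
  moreover have "\<exists>!w. w \<in> NF ` reduced_words G H \<and> \<pi> w = r" if "r \<in> carrier K" for r
    using that pi_NF by (intro ex1I[of _ "NF r"]) (auto simp: free_product_def)
  ultimately show ?thesis by (simp add: normal_forms_def)
qed

end


section \<open>Grammar rules, their soundness and completeness\<close>

context tabled_pair begin

text \<open>
  The grammar overgenerates: \<open>Product\<close> yields only correct products, but of words that need not be
  normal forms.
\<close>

definition rules :: "(nonterm \<times> rule_symbol list set) set" where
  "rules =
     {Product} \<times> ({product_rules G \<pi>1 R1 f1, product_rules H \<pi>2 R2 f2, {[Inl Cancel, Inl Copy]}} \<union>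
       (\<lambda>n. {[Inr (Letter n), Inl Product, Inr (Letter n)]}) ` AB) \<union>
     {Cancel} \<times> {cancel_rules G \<pi>1 R1 f1, cancel_rules H \<pi>2 R2 f2, {[Inr Hash1]}} \<union>
     {Copy} \<times> insert {[Inr Hash2]} ((\<lambda>n. {[Inr (Letter n), Inl Copy, Inr (Letter n)]}) ` AB)"

lemma ET0L_generated: "{w. gen rules (Inl Product) (map Inr w)} \<in> ET0L"
proof (rule ET0L_grammar)
  have 1: "rep1 \<one>\<^bsub>G\<^esub> \<in> R1" "\<pi>1 (rep1 \<one>\<^bsub>G\<^esub>) = \<one>\<^bsub>G\<^esub>" using rep1 by auto
  have 2: "rep2 \<one>\<^bsub>H\<^esub> \<in> R2" "\<pi>2 (rep2 \<one>\<^bsub>H\<^esub>) = \<one>\<^bsub>H\<^esub>" using rep2 by auto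
  show "finite rules" using A(1) B(1) by (simp add: rules_def AB_def)
  show "L \<in> ET0L" if "(X, L) \<in> rules" for X L
    using that ET0L_singleton ET0L_product_rules[OF A(1) R1 A(5)] ET0L_product_rules[OF B(1) R2 B(5)]
      ET0L_cancel_rules[OF A(1) R1 A(5) 1] ET0L_cancel_rules[OF B(1) R2 B(5) 2]
    unfolding rules_def by fast
qed

subsection \<open>Soundness\<close>

text \<open>The meanings range over all words over \<open>AB\<close>, because words built up letter
  by letter are not normal forms on the way. An equation between values survives every rule.\<close>

fun sem :: "nonterm \<Rightarrow> nat table_symbol list set" where
  "sem Product = {table_word u v w | u v w. u \<in> lists AB \<and> v \<in> lists AB \<and> w \<in> lists AB \<and>
     \<pi> u \<otimes>\<^bsub>K\<^esub> \<pi> v = \<pi> w}"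
| "sem Cancel = {map Letter u @ [Hash1] @ map Letter v | u v. u \<in> lists AB \<and> v \<in> lists AB \<and>
     \<pi> u \<otimes>\<^bsub>K\<^esub> \<pi> v = \<one>\<^bsub>K\<^esub>}"
| "sem Copy = {map Letter u @ [Hash2] @ map Letter (rev u) | u. u \<in> lists AB}"

text \<open>Inserting the trivial product \<open>u v\<close> and appending \<open>q\<close> preserve
  the equation: \<open>x u v y q = x y q = z q\<close>. With \<open>x\<close>, \<open>y\<close>,
  \<open>z\<close> empty this also covers the rule \<open>[Inl Cancel, Inl Copy]\<close>.\<close>

lemma sem_Product_rule:
  assumes "x \<in> lists AB" "y \<in> lists AB" "z \<in> lists AB" "\<pi> x \<otimes>\<^bsub>K\<^esub> \<pi> y = \<pi> z"
    and "c \<in> sem Cancel" "d \<in> sem Copy"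
  shows "map Letter x @ c @ map Letter y @ d @ map Letter (rev z) \<in> sem Product"
proof -
  from assms(5) obtain u v where c: "c = map Letter u @ [Hash1] @ map Letter v" "u \<in> lists AB" "v \<in> lists AB"
    "\<pi> u \<otimes>\<^bsub>K\<^esub> \<pi> v = \<one>\<^bsub>K\<^esub>" by auto
  from assms(6) obtain q where d: "d = map Letter q @ [Hash2] @ map Letter (rev q)" "q \<in> lists AB" by auto
  have cl: "\<pi> x \<in> carrier K" "\<pi> y \<in> carrier K" "\<pi> u \<in> carrier K" "\<pi> v \<in> carrier K" "\<pi> q \<in> carrier K"
    using assms(1,2) c d pi_closed by simp_all
  have "\<pi> (x @ u) \<otimes>\<^bsub>K\<^esub> \<pi> (v @ y @ q) = \<pi> x \<otimes>\<^bsub>K\<^esub> (\<pi> u \<otimes>\<^bsub>K\<^esub> \<pi> v) \<otimes>\<^bsub>K\<^esub> \<pi> y \<otimes>\<^bsub>K\<^esub> \<pi> q"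
    using assms(1,2) c(2,3) d(2) cl by (simp add: pi_append K.m_assoc)
  also have "\<dots> = \<pi> (z @ q)" using assms(3,4) c(4) d(2) cl by (simp add: pi_append)
  finally have "table_word (x @ u) (v @ y @ q) (z @ q) \<in> sem Product"
    using assms(1-3) c(2,3) d(2) by fastforce
  then show ?thesis by (simp add: c d table_word_def)
qed

lemma sem_Cancel_rule:
  assumes "x \<in> lists AB" "y \<in> lists AB" "\<pi> x \<otimes>\<^bsub>K\<^esub> \<pi> y = \<one>\<^bsub>K\<^esub>" and "c \<in> sem Cancel"
  shows "map Letter x @ c @ map Letter y \<in> sem Cancel"
proof -
  from assms(4) obtain u v where c: "c = map Letter u @ [Hash1] @ map Letter v" "u \<in> lists AB" "v \<in> lists AB"
    "\<pi> u \<otimes>\<^bsub>K\<^esub> \<pi> v = \<one>\<^bsub>K\<^esub>" by auto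
  have cl: "\<pi> x \<in> carrier K" "\<pi> y \<in> carrier K" "\<pi> u \<in> carrier K" "\<pi> v \<in> carrier K"
    using assms(1,2) c pi_closed by simp_all
  have "\<pi> (x @ u) \<otimes>\<^bsub>K\<^esub> \<pi> (v @ y) = \<pi> x \<otimes>\<^bsub>K\<^esub> (\<pi> u \<otimes>\<^bsub>K\<^esub> \<pi> v) \<otimes>\<^bsub>K\<^esub> \<pi> y"
    using assms(1,2) c(2,3) cl by (simp add: pi_append K.m_assoc)
  also have "\<dots> = \<one>\<^bsub>K\<^esub>" using assms(3) c(4) cl by simp
  finally have "map Letter (x @ u) @ [Hash1] @ map Letter (v @ y) \<in> sem Cancel"
    using assms(1,2) c(2,3) unfolding sem.simps by (intro CollectI exI conjI) (rule refl, simp_all)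
  then show ?thesis by (simp add: c)
qed

text \<open>\<open>sem\<close> in the form of rewriting pairs, so that the induction hypothesis for
  \<open>gen\<close> becomes a \<open>table_step\<close> with this set.\<close>

definition sem_pairs :: "(rule_symbol \<times> rule_symbol list) set" where
  "sem_pairs = {(c, w). case c of Inl X \<Rightarrow> w \<in> map Inr ` sem X | Inr a \<Rightarrow> w = [Inr a]}"

lemma sem_step_Inl:
  "table_step sem_pairs (Inl X # t) w \<longleftrightarrow> (\<exists>x\<in>sem X. \<exists>w'. w = map Inr x @ w' \<and> table_step sem_pairs t w')"
  unfolding table_step_Cons by (auto simp: sem_pairs_def)

lemma sem_step_Inr:
  "table_step sem_pairs (Inr a # t) w \<longleftrightarrow> (\<exists>w'. w = Inr a # w' \<and> table_step sem_pairs t w')"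
  unfolding table_step_Cons by (auto simp: sem_pairs_def)

lemma sem_step_letters:
  "table_step sem_pairs (letters f u @ t) w \<longleftrightarrow>
     (\<exists>w'. w = map Inr (map Letter (map f u)) @ w' \<and> table_step sem_pairs t w')"
proof (induction u arbitrary: w)
  case (Cons n u)
  show ?case by (auto simp: sem_step_Inr Cons.IH)
qed simp

text \<open>Abstracting from the factor lets one argument serve both; \<open>hom\<close> is where
  the multiplication of the factor enters.\<close>

lemma product_rules_sound:
  assumes "t \<in> product_rules M p R f" "table_step sem_pairs t w"
    and R: "\<And>u. u \<in> R \<Longrightarrow> map f u \<in> lists AB"
    and hom: "\<And>u v x. u \<in> R \<Longrightarrow> v \<in> R \<Longrightarrow> x \<in> R \<Longrightarrow> p u \<otimes>\<^bsub>M\<^esub> p v = p x \<Longrightarrow>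
      \<pi> (map f u) \<otimes>\<^bsub>K\<^esub> \<pi> (map f v) = \<pi> (map f x)"
  shows "w \<in> map Inr ` sem Product"
proof -
  from assms(1) obtain u v x where *: "u \<in> R" "v \<in> R" "x \<in> R" "p u \<otimes>\<^bsub>M\<^esub> p v = p x"
    "t = letters f u @ Inl Cancel # letters f v @ Inl Copy # letters f (rev x) @ []"
    unfolding product_rules_def by auto
  from assms(2) obtain c d where cd: "c \<in> sem Cancel" "d \<in> sem Copy"
    "w = map Inr (map Letter (map f u)) @ map Inr c @ map Inr (map Letter (map f v)) @ map Inr d @
       map Inr (map Letter (map f (rev x)))"
    unfolding *(5) sem_step_letters sem_step_Inl table_step_Nil
    by (elim exE bexE conjE) (rule that, assumption, assumption, simp)
  have "w = map Inr (map Letter (map f u) @ c @ map Letter (map f v) @ d @ map Letter (rev (map f x)))"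
    unfolding cd(3) by (simp add: rev_map)
  then show ?thesis
    using sem_Product_rule[OF R[OF *(1)] R[OF *(2)] R[OF *(3)] hom[OF *(1-4)] cd(1,2)] by blast
qed

lemma cancel_rules_sound:
  assumes "t \<in> cancel_rules M p R f" "table_step sem_pairs t w"
    and R: "\<And>u. u \<in> R \<Longrightarrow> map f u \<in> lists AB"
    and hom: "\<And>u v. u \<in> R \<Longrightarrow> v \<in> R \<Longrightarrow> p u \<otimes>\<^bsub>M\<^esub> p v = \<one>\<^bsub>M\<^esub> \<Longrightarrow>
      \<pi> (map f u) \<otimes>\<^bsub>K\<^esub> \<pi> (map f v) = \<one>\<^bsub>K\<^esub>"
  shows "w \<in> map Inr ` sem Cancel"
proof -
  from assms(1) obtain u v where *: "u \<in> R" "v \<in> R" "p u \<otimes>\<^bsub>M\<^esub> p v = \<one>\<^bsub>M\<^esub>"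
    "t = letters f u @ Inl Cancel # letters f v @ []"
    unfolding cancel_rules_def by auto
  from assms(2) obtain c where c: "c \<in> sem Cancel"
    "w = map Inr (map Letter (map f u)) @ map Inr c @ map Inr (map Letter (map f v))"
    unfolding *(4) sem_step_letters sem_step_Inl table_step_Nil
    by (elim exE bexE conjE) (rule that, assumption, simp)
  have "w = map Inr (map Letter (map f u) @ c @ map Letter (map f v))"
    unfolding c(2) by simp
  then show ?thesis
    using sem_Cancel_rule[OF R[OF *(1)] R[OF *(2)] hom[OF *(1-3)] c(1)] by blast
qed

lemma rule_sound:
  assumes "(X, L) \<in> rules" "t \<in> L" "table_step sem_pairs t w"
  shows "w \<in> map Inr ` sem X"
proof -
  have one: "\<one>\<^bsub>K\<^esub> = []" by (simp add: free_product_def)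
  have nil: "\<pi> [] = \<one>\<^bsub>K\<^esub>" by (simp add: \<pi>_def one)
  have f1: "map f1 u \<in> lists AB" "u \<in> lists A" if "u \<in> R1" for u using that R1 lists_f1 by blast+
  have f2: "map f2 u \<in> lists AB" "u \<in> lists B" if "u \<in> R2" for u using that R2 lists_f2 by blast+
  from assms(1) have "X = Product \<and> (L = product_rules G \<pi>1 R1 f1 \<or> L = product_rules H \<pi>2 R2 f2 \<or>
       L = {[Inl Cancel, Inl Copy]} \<or> (\<exists>n\<in>AB. L = {[Inr (Letter n), Inl Product, Inr (Letter n)]})) \<or>
     X = Cancel \<and> (L = cancel_rules G \<pi>1 R1 f1 \<or> L = cancel_rules H \<pi>2 R2 f2 \<or> L = {[Inr Hash1]}) \<or>
     X = Copy \<and> (L = {[Inr Hash2]} \<or> (\<exists>n\<in>AB. L = {[Inr (Letter n), Inl Copy, Inr (Letter n)]}))"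
    unfolding rules_def by (elim UnE; simp add: image_iff; elim disjE conjE; simp)
  then consider
      (prod1) "X = Product" "L = product_rules G \<pi>1 R1 f1" | (prod2) "X = Product" "L = product_rules H \<pi>2 R2 f2"
    | (prod3) "X = Product" "L = {[Inl Cancel, Inl Copy]}"
    | (prod4) n where "n \<in> AB" "X = Product" "L = {[Inr (Letter n), Inl Product, Inr (Letter n)]}"
    | (cancel1) "X = Cancel" "L = cancel_rules G \<pi>1 R1 f1" | (cancel2) "X = Cancel" "L = cancel_rules H \<pi>2 R2 f2"
    | (cancel3) "X = Cancel" "L = {[Inr Hash1]}"
    | (copy1) "X = Copy" "L = {[Inr Hash2]}"
    | (copy2) n where "n \<in> AB" "X = Copy" "L = {[Inr (Letter n), Inl Copy, Inr (Letter n)]}"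
    by (elim disjE conjE bexE) (rule that, assumption, assumption, (assumption)?)+
  then show ?thesis
  proof cases
    case prod1
    show ?thesis
      unfolding prod1(1)
    proof (rule product_rules_sound[OF _ assms(3)])
      show "t \<in> product_rules G \<pi>1 R1 f1" using assms(2) prod1 by simp
      show "\<pi> (map f1 u) \<otimes>\<^bsub>K\<^esub> \<pi> (map f1 v) = \<pi> (map f1 x)"
        if "u \<in> R1" "v \<in> R1" "x \<in> R1" "\<pi>1 u \<otimes>\<^bsub>G\<^esub> \<pi>1 v = \<pi>1 x" for u v x
        unfolding pi_f1_mult[OF f1(2)[OF that(1)] f1(2)[OF that(2)]] pi_f1[OF f1(2)[OF that(3)]] that(4) ..
    qed (rule f1)
  next
    case prod2
    show ?thesis
      unfolding prod2(1)
    proof (rule product_rules_sound[OF _ assms(3)])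
      show "t \<in> product_rules H \<pi>2 R2 f2" using assms(2) prod2 by simp
      show "\<pi> (map f2 u) \<otimes>\<^bsub>K\<^esub> \<pi> (map f2 v) = \<pi> (map f2 x)"
        if "u \<in> R2" "v \<in> R2" "x \<in> R2" "\<pi>2 u \<otimes>\<^bsub>H\<^esub> \<pi>2 v = \<pi>2 x" for u v x
        unfolding pi_f2_mult[OF f2(2)[OF that(1)] f2(2)[OF that(2)]] pi_f2[OF f2(2)[OF that(3)]] that(4) ..
    qed (rule f2)
  next
    case prod3
    then obtain c d where cd: "c \<in> sem Cancel" "d \<in> sem Copy" and w: "w = map Inr (c @ d)"
      using assms(2,3) by (auto simp: sem_step_Inl simp del: sem.simps)
    from sem_Product_rule[of "[]" "[]" "[]", OF _ _ _ _ cd] have "c @ d \<in> sem Product"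
      using nil by (simp del: sem.simps)
    then show ?thesis unfolding w prod3(1) by (rule imageI)
  next
    case prod4
    then obtain x where "x \<in> sem Product" and w: "w = map Inr ([Letter n] @ x @ [Letter n])"
      using assms(2,3) by (auto simp: sem_step_Inl sem_step_Inr simp del: sem.simps)
    then obtain u v z where x: "x = table_word u v z" "u \<in> lists AB" "v \<in> lists AB" "z \<in> lists AB"
      "\<pi> u \<otimes>\<^bsub>K\<^esub> \<pi> v = \<pi> z" by auto
    have n: "[n] \<in> lists AB" using prod4 by simp
    have "\<pi> ([n] @ u) \<otimes>\<^bsub>K\<^esub> \<pi> v = \<pi> ([n] @ z)"
      using x n pi_closed unfolding pi_append[OF n x(2)] pi_append[OF n x(4)]
      by (simp add: K.m_assoc)
    then have "table_word ([n] @ u) v ([n] @ z) \<in> sem Product" using x n by fastforce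
    then have "[Letter n] @ x @ [Letter n] \<in> sem Product"
      by (simp add: x(1) table_word_def del: sem.simps)
    then show ?thesis unfolding w prod4(2) by (rule imageI)
  next
    case cancel1
    show ?thesis
      unfolding cancel1(1)
    proof (rule cancel_rules_sound[OF _ assms(3)])
      show "t \<in> cancel_rules G \<pi>1 R1 f1" using assms(2) cancel1 by simp
      show "\<pi> (map f1 u) \<otimes>\<^bsub>K\<^esub> \<pi> (map f1 v) = \<one>\<^bsub>K\<^esub>"
        if "u \<in> R1" "v \<in> R1" "\<pi>1 u \<otimes>\<^bsub>G\<^esub> \<pi>1 v = \<one>\<^bsub>G\<^esub>" for u v
        unfolding pi_f1_mult[OF f1(2)[OF that(1)] f1(2)[OF that(2)]] that(3) one by simp
    qed (rule f1)
  next
    case cancel2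
    show ?thesis
      unfolding cancel2(1)
    proof (rule cancel_rules_sound[OF _ assms(3)])
      show "t \<in> cancel_rules H \<pi>2 R2 f2" using assms(2) cancel2 by simp
      show "\<pi> (map f2 u) \<otimes>\<^bsub>K\<^esub> \<pi> (map f2 v) = \<one>\<^bsub>K\<^esub>"
        if "u \<in> R2" "v \<in> R2" "\<pi>2 u \<otimes>\<^bsub>H\<^esub> \<pi>2 v = \<one>\<^bsub>H\<^esub>" for u v
        unfolding pi_f2_mult[OF f2(2)[OF that(1)] f2(2)[OF that(2)]] that(3) one by simp
    qed (rule f2)
  next
    case cancel3
    have "[Hash1] \<in> sem Cancel" using nil by (force intro: exI[of _ "[]"])
    moreover have "w = map Inr [Hash1]" using cancel3 assms(2,3) by (simp add: sem_step_Inr)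
    ultimately show ?thesis unfolding cancel3(1) by (simp only: imageI)
  next
    case copy1
    have "[Hash2] \<in> sem Copy" unfolding sem.simps by (intro CollectI exI[of _ "[]"]) simp
    moreover have "w = map Inr [Hash2]" using copy1 assms(2,3) by (simp add: sem_step_Inr)
    ultimately show ?thesis unfolding copy1(1) by (simp only: imageI)
  next
    case copy2
    then obtain x where "x \<in> sem Copy" and w: "w = map Inr ([Letter n] @ x @ [Letter n])"
      using assms(2,3) by (auto simp: sem_step_Inl sem_step_Inr simp del: sem.simps)
    then obtain u where u: "x = map Letter u @ [Hash2] @ map Letter (rev u)" "u \<in> lists AB" by auto
    then have "map Letter (n # u) @ [Hash2] @ map Letter (rev (n # u)) \<in> sem Copy"
      using copy2 unfolding sem.simps by (intro CollectI exI[of _ "n # u"]) simp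
    then have "[Letter n] @ x @ [Letter n] \<in> sem Copy" by (simp add: u(1) del: sem.simps)
    then show ?thesis unfolding w copy2(2) by (rule imageI)
  qed
qed

lemma gen_sound: "gen rules c w \<Longrightarrow> (c, w) \<in> sem_pairs"
proof (induction rule: gen.induct)
  case (rule X L t w)
  have "table_step sem_pairs t w" by (rule table_step_mono[OF rule(3)]) auto
  then show ?case using rule_sound[OF rule(1,2)] by (simp add: sem_pairs_def)
qed (simp add: sem_pairs_def)

subsection \<open>Completeness\<close>

definition gen_pairs :: "(rule_symbol \<times> rule_symbol list) set" where
  "gen_pairs = {(c, w). gen rules c w}"

lemma gen_rule: "(X, L) \<in> rules \<Longrightarrow> t \<in> L \<Longrightarrow> table_step gen_pairs t w \<Longrightarrow> gen rules (Inl X) w"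
  unfolding gen_pairs_def by (rule gen.rule)

lemma gen_step_letters: "table_step gen_pairs t w \<Longrightarrow> table_step gen_pairs (letters f u @ t) (letters f u @ w)"
proof (induction u)
  case (Cons n u)
  have "(Inr (Letter (f n)), [Inr (Letter (f n))]) \<in> gen_pairs"
    unfolding gen_pairs_def by (simp add: gen.terminal)
  from table_step_ConsI[OF this Cons.IH[OF Cons.prems]] show ?case by simp
qed simp

lemma gen_step_Inl:
  "gen rules (Inl X) x \<Longrightarrow> table_step gen_pairs t w \<Longrightarrow> table_step gen_pairs (Inl X # t) (x @ w)"
  by (rule table_step_ConsI) (simp_all add: gen_pairs_def)

lemma gen_step_Inr: "table_step gen_pairs t w \<Longrightarrow> table_step gen_pairs (Inr a # t) (Inr a # w)"
  using table_step_ConsI[of "Inr a" "[Inr a]" gen_pairs t w] by (simp add: gen_pairs_def gen.terminal)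

lemma gen_Copy:
  "q \<in> lists AB \<Longrightarrow> gen rules (Inl Copy) (letters (\<lambda>n. n) q @ [Inr Hash2] @ letters (\<lambda>n. n) (rev q))"
proof (induction q)
  case Nil
  show ?case
    by (rule gen_rule[of _ "{[Inr Hash2]}" "[Inr Hash2]"]) (simp_all add: rules_def gen_step_Inr)
next
  case (Cons n q)
  then have "(Copy, {[Inr (Letter n), Inl Copy, Inr (Letter n)]}) \<in> rules" by (simp add: rules_def)
  then have "gen rules (Inl Copy)
      (Inr (Letter n) # (letters (\<lambda>n. n) q @ [Inr Hash2] @ letters (\<lambda>n. n) (rev q)) @ [Inr (Letter n)])"
    by (rule gen_rule) (use Cons in \<open>auto intro!: gen_step_Inr gen_step_Inl simp del: append_assoc\<close>)
  then show ?case by simp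
qed

text \<open>Reversal of the third word puts the common prefix of the first and third words at the
  two ends of the table word, where it is added letter by letter.\<close>

lemma gen_Product_wrap:
  "p \<in> lists AB \<Longrightarrow> gen rules (Inl Product) x \<Longrightarrow>
     gen rules (Inl Product) (letters (\<lambda>n. n) p @ x @ letters (\<lambda>n. n) (rev p))"
proof (induction p)
  case (Cons n p)
  then have "(Product, {[Inr (Letter n), Inl Product, Inr (Letter n)]}) \<in> rules" by (simp add: rules_def)
  then have "gen rules (Inl Product)
      (Inr (Letter n) # (letters (\<lambda>n. n) p @ x @ letters (\<lambda>n. n) (rev p)) @ [Inr (Letter n)])"
    by (rule gen_rule) (use Cons in \<open>auto intro!: gen_step_Inr gen_step_Inl simp del: append_assoc\<close>)
  then show ?case by simp
qed simp

lemma letters_map: "letters f u = letters (\<lambda>n. n) (map f u)"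
  by (simp add: letters_def)

text \<open>The inverse of \<open>x # s\<close> ends with the inverse of \<open>x\<close>, so the
  pair formed by \<open>x\<close> and its inverse encloses the word for \<open>s\<close>, and
  cancellation nests syllable by syllable.\<close>

lemma gen_Cancel:
  "set s \<subseteq> carrier G <+> carrier H \<Longrightarrow>
     gen rules (Inl Cancel) (letters (\<lambda>n. n) (NF s) @ [Inr Hash1] @ letters (\<lambda>n. n) (NF (inverse_word G H s)))"
proof (induction s)
  case Nil
  show ?case
    by (rule gen_rule[of _ "{[Inr Hash1]}" "[Inr Hash1]"]) (simp_all add: rules_def gen_step_Inr)
next
  case (Cons x s)
  let ?w = "letters (\<lambda>n. n) (NF s) @ [Inr Hash1] @ letters (\<lambda>n. n) (NF (inverse_word G H s))"
  have IH: "gen rules (Inl Cancel) ?w" using Cons by simp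
  have step: "table_step gen_pairs (letters f u @ [Inl Cancel] @ letters f v) (letters f u @ ?w @ letters f v)"
    for f u v
    using gen_step_letters[OF gen_step_Inl[OF IH gen_step_letters[of "[]" "[]"]]] by simp
  have "gen rules (Inl Cancel) (letters (\<lambda>n. n) (syllable_word rep1 rep2 x) @ ?w @
      letters (\<lambda>n. n) (syllable_word rep1 rep2 (map_sum (m_inv G) (m_inv H) x)))"
  proof (cases x)
    case (Inl g)
    then have g: "g \<in> carrier G" using Cons.prems by auto
    have "letters f1 (rep1 g) @ [Inl Cancel] @ letters f1 (rep1 (inv\<^bsub>G\<^esub> g)) \<in> cancel_rules G \<pi>1 R1 f1"
      unfolding cancel_rules_def using g rep1(1,2)
      by (intro CollectI exI conjI) (rule refl, simp_all)
    moreover have "(Cancel, cancel_rules G \<pi>1 R1 f1) \<in> rules" by (simp add: rules_def)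
    ultimately show ?thesis
      using gen_rule[OF _ _ step] by (simp add: Inl letters_map[of f1])
  next
    case (Inr g)
    then have g: "g \<in> carrier H" using Cons.prems by auto
    have "letters f2 (rep2 g) @ [Inl Cancel] @ letters f2 (rep2 (inv\<^bsub>H\<^esub> g)) \<in> cancel_rules H \<pi>2 R2 f2"
      unfolding cancel_rules_def using g rep2(1,2)
      by (intro CollectI exI conjI) (rule refl, simp_all)
    moreover have "(Cancel, cancel_rules H \<pi>2 R2 f2) \<in> rules" by (simp add: rules_def)
    ultimately show ?thesis
      using gen_rule[OF _ _ step] by (simp add: Inr letters_map[of "\<lambda>n. Suc (2 * n)"])
  qed
  then show ?case by simp
qed

lemma map_Inr_table_word:
  "map Inr (table_word u v w) = letters (\<lambda>n. n) u @ [Inr Hash1] @ letters (\<lambda>n. n) v @ [Inr Hash2] @ letters (\<lambda>n. n) (rev w)"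
  by (simp add: table_word_def letters_def)

text \<open>Builds the table word without the common prefix, which \<open>gen_Product_wrap\<close>
  adds afterwards.\<close>

lemma gen_Product_rules:
  assumes "t \<in> product_rules M p R f" "(Product, product_rules M p R f) \<in> rules"
    and t: "t = letters f u @ [Inl Cancel] @ letters f v @ [Inl Copy] @ letters f (rev x)"
    and "set s \<subseteq> carrier G <+> carrier H" "q \<in> lists AB"
  shows "gen rules (Inl Product) (map Inr (table_word (map f u @ NF s)
     (NF (inverse_word G H s) @ map f v @ q) (map f x @ q)))"
proof -
  have "table_step gen_pairs t (letters f u @ (letters (\<lambda>n. n) (NF s) @ [Inr Hash1] @ letters (\<lambda>n. n) (NF (inverse_word G H s))) @
     letters f v @ (letters (\<lambda>n. n) q @ [Inr Hash2] @ letters (\<lambda>n. n) (rev q)) @ letters f (rev x) @ [])"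
    unfolding t append_Cons append_Nil
    using gen_step_letters[OF gen_step_Inl[OF gen_Cancel[OF assms(4)] gen_step_letters[OF gen_step_Inl[OF
      gen_Copy[OF assms(5)] gen_step_letters[of "[]" "[]"]]]]] by simp
  from gen_rule[OF assms(2,1) this] show ?thesis
    by (simp add: map_Inr_table_word letters_map[of f] rev_map)
qed

text \<open>The cases of \<open>reduced_product_cases\<close> match the ways to end the common
  prefix: \<open>[Inl Cancel, Inl Copy]\<close> if nothing merges, otherwise a rule from the table
  of the factor in which two syllables merge.\<close>

lemma gen_complete:
  assumes r: "r1 \<in> reduced_words G H" "r2 \<in> reduced_words G H"
  shows "gen rules (Inl Product) (map Inr (table_word (NF r1) (NF r2) (NF (r1 \<otimes>\<^bsub>K\<^esub> r2))))"
proof -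
  have wrap: "gen rules (Inl Product) (map Inr (table_word (NF p @ u) v (NF p @ w)))"
    if "gen rules (Inl Product) (map Inr (table_word u v w))" "set p \<subseteq> carrier G <+> carrier H" for p u v w
    using gen_Product_wrap[OF NF_closed[OF that(2)] that(1)] by (simp add: map_Inr_table_word)
  have K: "r1 \<otimes>\<^bsub>K\<^esub> r2 = foldr (syllable_mult G H) r1 r2" by (simp add: free_product_def)
  note c = reduced_carrier[OF r(1)] reduced_carrier[OF r(2)]
  from G H r show ?thesis
  proof (cases rule: reduced_product_cases)
    case (cancel p s q)
    have *: "set s \<subseteq> carrier G <+> carrier H" "set p \<subseteq> carrier G <+> carrier H" "set q \<subseteq> carrier G <+> carrier H"
      using c cancel by auto
    have "(Product, {[Inl Cancel, Inl Copy]}) \<in> rules" by (simp add: rules_def)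
    from gen_rule[OF this _ gen_step_Inl[OF gen_Cancel[OF *(1)] gen_step_Inl[OF gen_Copy[OF NF_closed[OF *(3)]]]]]
    have "gen rules (Inl Product) (map Inr (table_word (NF s) (NF (inverse_word G H s) @ NF q) (NF q)))"
      by (simp add: map_Inr_table_word)
    from wrap[OF this *(2)] show ?thesis
      unfolding K cancel(3) unfolding cancel(1,2) by simp
  next
    case (Inl p s q g g')
    have *: "set s \<subseteq> carrier G <+> carrier H" "set p \<subseteq> carrier G <+> carrier H" "set q \<subseteq> carrier G <+> carrier H"
      "g \<in> carrier G" "g' \<in> carrier G" using c Inl by auto
    have "letters f1 (rep1 g) @ [Inl Cancel] @ letters f1 (rep1 g') @ [Inl Copy] @
        letters f1 (rev (rep1 (g \<otimes>\<^bsub>G\<^esub> g'))) \<in> product_rules G \<pi>1 R1 f1"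
      unfolding product_rules_def using *(4,5) rep1(1,2)
      by (intro CollectI exI conjI) (rule refl, simp_all)
    from gen_Product_rules[OF this _ refl *(1) NF_closed[OF *(3)]]
    have "gen rules (Inl Product) (map Inr (table_word (map f1 (rep1 g) @ NF s)
        (NF (inverse_word G H s) @ map f1 (rep1 g') @ NF q) (map f1 (rep1 (g \<otimes>\<^bsub>G\<^esub> g')) @ NF q)))"
      by (simp add: rules_def)
    from wrap[OF this *(2)] show ?thesis
      unfolding K Inl(3) unfolding Inl(1,2) by simp
  next
    case (Inr p s q g g')
    have *: "set s \<subseteq> carrier G <+> carrier H" "set p \<subseteq> carrier G <+> carrier H" "set q \<subseteq> carrier G <+> carrier H"
      "g \<in> carrier H" "g' \<in> carrier H" using c Inr by auto
    have "letters f2 (rep2 g) @ [Inl Cancel] @ letters f2 (rep2 g') @ [Inl Copy] @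
        letters f2 (rev (rep2 (g \<otimes>\<^bsub>H\<^esub> g'))) \<in> product_rules H \<pi>2 R2 f2"
      unfolding product_rules_def using *(4,5) rep2(1,2)
      by (intro CollectI exI conjI) (rule refl, simp_all)
    from gen_Product_rules[OF this _ refl *(1) NF_closed[OF *(3)]]
    have "gen rules (Inl Product) (map Inr (table_word (map f2 (rep2 g) @ NF s)
        (NF (inverse_word G H s) @ map f2 (rep2 g') @ NF q) (map f2 (rep2 (g \<otimes>\<^bsub>H\<^esub> g')) @ NF q)))"
      by (simp add: rules_def)
    from wrap[OF this *(2)] show ?thesis
      unfolding K Inr(3) unfolding Inr(1,2) by simp
  qed
qed

text \<open>Soundness provides the equation for every generated triple of normal forms, and
  \<open>gen_complete\<close> provides every triple of the table; the filter discards the generated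
  words that are not in normal form.\<close>

lemma mult_table_free_product: "mult_table K \<pi> (NF ` reduced_words G H) \<in> ET0L"
proof -
  let ?R = "NF ` reduced_words G H"
  have "{w. gen rules (Inl Product) (map Inr w)} \<inter>
      {table_word u v w | u v w. u \<in> ?R \<and> v \<in> ?R \<and> w \<in> ?R} \<in> ET0L"
    using normal_forms_free_product unfolding normal_forms_def
    by (intro ET0L_Int_table_words[OF ET0L_generated]) (rule conjunct1)
  also have "{w. gen rules (Inl Product) (map Inr w)} \<inter>
      {table_word u v w | u v w. u \<in> ?R \<and> v \<in> ?R \<and> w \<in> ?R} = mult_table K \<pi> ?R"
  proof (intro Set.set_eqI iffI)
    fix t assume "t \<in> {w. gen rules (Inl Product) (map Inr w)} \<inter>
      {table_word u v w | u v w. u \<in> ?R \<and> v \<in> ?R \<and> w \<in> ?R}"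
    then obtain u v w where t: "t = table_word u v w" "u \<in> ?R" "v \<in> ?R" "w \<in> ?R"
      and "gen rules (Inl Product) (map Inr t)" by blast
    from gen_sound[OF this(5)] have "map Inr t \<in> (map Inr :: _ \<Rightarrow> rule_symbol list) ` sem Product"
      by (simp add: sem_pairs_def)
    then have "t \<in> sem Product" by (auto simp: inj_map_eq_map simp del: sem.simps)
    \<comment> \<open>The decomposition provided by \<open>sem Product\<close> is the given one,
      because a table word determines its three words.\<close>
    then have "\<pi> u \<otimes>\<^bsub>K\<^esub> \<pi> v = \<pi> w" by (auto simp: t(1) table_word_eq_iff)
    then show "t \<in> mult_table K \<pi> ?R" using t unfolding mult_table_eq by blast
  next
    fix t assume "t \<in> mult_table K \<pi> ?R"
    then obtain u v w where t: "t = table_word u v w" "u \<in> ?R" "v \<in> ?R" "w \<in> ?R"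
      "\<pi> u \<otimes>\<^bsub>K\<^esub> \<pi> v = \<pi> w" unfolding mult_table_eq by blast
    then obtain r1 r2 r3 where r: "u = NF r1" "v = NF r2" "w = NF r3" "r1 \<in> reduced_words G H"
      "r2 \<in> reduced_words G H" "r3 \<in> reduced_words G H" by blast
    then have "r1 \<otimes>\<^bsub>K\<^esub> r2 = r3" using t(5) pi_NF by simp
    then have "gen rules (Inl Product) (map Inr t)" using gen_complete[OF r(4,5)] t(1) r by simp
    then show "t \<in> {w. gen rules (Inl Product) (map Inr w)} \<inter>
      {table_word u v w | u v w. u \<in> ?R \<and> v \<in> ?R \<and> w \<in> ?R}" using t by blast
  qed
  finally show ?thesis .
qed

end

theorem corollary5p1:
  fixes G :: "('a, 'm) monoid_scheme" and H :: "('b, 'n) monoid_scheme"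
  assumes "group G" and "tabled ET0L G"
    and "group H" and "tabled ET0L H"
  shows "tabled ET0L (free_product G H)"
proof -
  from assms(2) obtain A :: "nat set" and \<pi>1 R1 where
    A: "finite A" "\<pi>1 \<in> epi (word_monoid A) G" "\<pi>1 [] = \<one>\<^bsub>G\<^esub>"
      "normal_forms G A \<pi>1 R1" "mult_table G \<pi>1 R1 \<in> ET0L" unfolding tabled_def by blast
  from assms(4) obtain B :: "nat set" and \<pi>2 R2 where
    B: "finite B" "\<pi>2 \<in> epi (word_monoid B) H" "\<pi>2 [] = \<one>\<^bsub>H\<^esub>"
      "normal_forms H B \<pi>2 R2" "mult_table H \<pi>2 R2 \<in> ET0L" unfolding tabled_def by blast
  have "\<pi>1 \<in> hom (word_monoid A) G" "\<pi>2 \<in> hom (word_monoid B) H"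
    using A(2) B(2) by (simp_all add: epi_def)
  then interpret tabled_pair G H A B \<pi>1 \<pi>2 R1 R2
    by (intro tabled_pair.intro assms A B)
  have "finite AB" using A B by (simp add: AB_def)
  moreover have "\<pi> [] = \<one>\<^bsub>free_product G H\<^esub>" by (simp add: \<pi>_def free_product_def)
  ultimately show ?thesis
    unfolding tabled_def using pi_epi normal_forms_free_product mult_table_free_product
    by (intro exI[of _ AB] exI[of _ \<pi>] exI[of _ "NF ` reduced_words G H"] conjI)
qed

end
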